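(* Let $L_M\ge1$, $L^{\mathrm I}:=L_1^{\mathrm I}+\dots+L_{M-1}^{\mathrm I}+L_M$, and write $i_*:=i^{(M)}_{L^{\mathrm I}}$ and $C_*:=C^{(M)}(L^{\mathrm I},i_* )$. The elliptic $\mathfrak{gl}_{M+1}$ partition function $\psi=\psi(\bm z^{(1)},\dots,\bm z^{(M)}|\{\bm w_{\mathrm I}^{(1)},\bm w_{\mathrm{II}}^{(1)}\},\dots,\{\bm w_{\mathrm I}^{(M-1)},\bm w_{\mathrm{II}}^{(M-1)}\},\bm w^{(M)}|\bm I|\lambda)$ satisfies: 1. (Case A) If $i_*\ne M+1$, then as a function of $w=w^{(M)}_{L_M}$, $\psi$ is an elliptic polynomial in $\Theta_{k_M}(\chi)$ with quasi-periodicities $$\psi(w+1)=(-1)^{k_M}\psi(w),$$ $$\psi(w+\tau)=(-1)^{k_M}\exp\Big(-2\pi i\Big(k_M w-\sum_{j=1}^{k_M}z^{(M)}_j+\lambda_{i_*}-\lambda_{M+1}+\gamma(L_M-C_* )\Big)-\pi i k_M\tau\Big)\psi(w).$$ 2. $\psi$ is symmetric with respect to $z^{(M)}_1,\dots,z^{(M)}_{k_M}$. 3. (Case A, $M\ge2$) If $i_*\ne M+1$, then $$\psi\big|_{w^{(M)}_{L_M}=z^{(M)}_{k_M}-\gamma}=\prod_{j=1}^{L_M-1}\big[z^{(M)}_{k_M}-w^{(M)}_j\big]\prod_{j=1}^{k_M-1}\big[z^{(M)}_j-z^{(M)}_{k_M}+\gamma\big]\ \frac{[\gamma]\,\big[\lambda_{M+1}-\lambda_{i_*}+\gamma(k_M-L_M+C_*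 )\big]}{\big[\lambda_{i_*}-\lambda_{M+1}+\gamma(1-C_* )\big]}$$ $$\times\ \psi\big(\bm z^{(1)},\dots,\bm z^{(M-1)},\bm z^{(M)}\setminus\{z^{(M)}_{k_M}\}\,\big|\,\{\bm w_{\mathrm I}^{(1)},\bm w_{\mathrm{II}}^{(1)}\},\dots,\{\bm w_{\mathrm I}^{(M-1)},\{z^{(M)}_{k_M}\}\cup\bm w_{\mathrm{II}}^{(M-1)}\},\bm w^{(M)}\setminus\{w^{(M)}_{L_M}\}\,\big|\,\bm J\,\big|\,\lambda\big),$$ where the right-hand partition function has sizes $k_M-1$, $L_{M-1}^{\mathrm{II}}+1$, $L_M-1$ in place of $k_M,L_{M-1}^{\mathrm{II}},L_M$ (others unchanged), and $\bm J^{(i)}=\bm I^{(i)}$ for $1\le i\le M-1$, $\bm J^{(M)}=\bm I^{(M)}\setminus\{L^{\mathrm I}\}$, $\widetilde{\bm J}^{(i)}=\widetilde{\bm I}^{(i)}$ for $1\le i\le M-1$. 4. (Case B) If $i_*=M+1$, then $$\psi=\prod_{j=1}^{k_M}\big[z^{(M)}_j-w^{(M)}_{L_M}-\gamma\big]\ \psi\big(\bm z^{(1)},\dots,\bm z^{(M)}\,\big|\,\{\bm w_{\mathrm I}^{(1)},\bm w_{\mathrm{II}}^{(1)}\},\dots,\{\bm w_{\mathrm I}^{(M-1)},\bm w_{\mathrm{II}}^{(M-1)}\},\bm w^{(M)}\setminus\{w^{(M)}_{L_M}\}\,\big|\,\bm J\,\big|\,\lambda\big),$$ where $L_M$ is replaced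 by $L_M-1$ (other sizes unchanged), and $\bm J^{(i)}=\{j\in\bm I^{(i)}:j\le L^{\mathrm I}\}\cup\{j-1:j\in\bm I^{(i)},\,j>L^{\mathrm I}\}$ for $1\le i\le M-1$, $\bm J^{(M)}=\bm I^{(M)}$, $\widetilde{\bm J}^{(i)}=\widetilde{\bm I}^{(i)}$ for $1\le i\le M-1$. 5. (Initial condition, $M\ge2$) If $k_M=1$ and $i_*\ne M+1$, then $$\psi=\frac{[\gamma]\,\big[z^{(M)}_1-w^{(M)}_{L_M}+\lambda_{M+1}-\lambda_{i_*}-\gamma(L_M-1)\big]}{[\lambda_{i_*}-\lambda_{M+1}]}\prod_{j=1}^{L_M-1}\big[z^{(M)}_1-w^{(M)}_j\big]$$ $$\times\ \psi\big(\bm z^{(1)},\dots,\bm z^{(M-1)}\,\big|\,\{\bm w_{\mathrm I}^{(1)},\bm w_{\mathrm{II}}^{(1)}\},\dots,\{\bm w_{\mathrm I}^{(M-2)},\bm w_{\mathrm{II}}^{(M-2)}\},\bm w_{\mathrm I}^{(M-1)}\cup\{z^{(M)}_1\}\cup\bm w_{\mathrm{II}}^{(M-1)}\,\big|\,\bm J\,\big|\,\lambda^{[M-1]}\big),$$ where the right-hand side is a $\mathfrak{gl}_M$ partition function ($M-1$ layers; only the components $\lambda^{[M-1]}_1,\dots,\lambda^{[M-1]}_M$ enter) with sizes $k_1,\dots,k_{M-1}$, $L_p^{\mathrm I},L_p^{\mathrm{II}}$ ($p\le M-2$) and top-layer size $L_{M-1}^{\mathrm I}+L_{M-1}^{\mathrm{II}}+1$,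 and $\bm J^{(i)}=\{j\in\bm I^{(i)}:j<L^{\mathrm I}\}\cup\{j-L_M+1:j\in\bm I^{(i)},\,j\ge L^{\mathrm I}\}$ for $1\le i\le M-1$. Moreover $\widetilde{\bm J}^{(i)}=\widetilde{\bm I}^{(i)}$ for $1\le i\le M-1$, where for $i=M-1$ (the top layer of the $\mathfrak{gl}_M$ function) $\widetilde{\bm J}^{(M-1)}$ denotes $\bm J^{(M-1)}$ shifted down by $L_1^{\mathrm I}+\dots+L_{M-2}^{\mathrm I}$. Here unions and set differences of lists of variables denote concatenation and deletion of ordered lists.
   Context: **Theta function.** Fix $\tau,\gamma\in\mathbb C$ nonzero with $\operatorname{Im}\tau>0$, and $[z]=-\sum_{j\in\mathbb Z+1/2}e^{i\pi j^2\tau+2\pi i j(z+1/2)}$, an odd function. Put $\alpha(z,\lambda)=\dfrac{[z][\lambda+\gamma]}{[\lambda]}$ and $\beta(z,\lambda)=-\dfrac{[z+\lambda][\gamma]}{[\lambda]}$. The dynamical variable is $\lambda=(\lambda_1,\dots,\lambda_{M+1})=\sum_i\lambda_i\mu_i\in\mathbb C^{M+1}$ ($\mu_i$ the standard basis), taken generic so that all denominators $[\lambda_i-\lambda_j+n\gamma]$ ($i\neq j$, $n\in\mathbb Z$) are nonzero. For a character (group homomorphism) $\chi:\mathbb Z+\tau\mathbb Z\to\mathbb C^\times$ and an integer $n\ge1$, $\Theta_n(\chi)$ is the space of holomorphic functions $\phi$ on $\mathbb C$ with $\phi(y+1)=\chi(1)\phi(y)$ and $\phi(y+\tau)=\chi(\tau)e^{-2\pi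 i n y-\pi i n\tau}\phi(y)$; its elements are called elliptic polynomials. **Sizes, variables, coordinates.** Fix $M\ge1$ and nonnegative integers $k_1,\dots,k_M$, $L_p^{\mathrm I},L_p^{\mathrm{II}}$ ($1\le p\le M-1$), $L_M$. There are ordered lists of variables $\bm z^{(p)}=(z^{(p)}_1,\dots,z^{(p)}_{k_p})$ ($1\le p\le M$), $\bm w^{(p)}_{\mathrm I}=(w^{(p)}_{\mathrm I,1},\dots,w^{(p)}_{\mathrm I,L^{\mathrm I}_p})$, $\bm w^{(p)}_{\mathrm{II}}=(w^{(p)}_{\mathrm{II},1},\dots,w^{(p)}_{\mathrm{II},L^{\mathrm{II}}_p})$ ($1\le p\le M-1$), $\bm w^{(M)}=(w^{(M)}_1,\dots,w^{(M)}_{L_M})$. The sizes are the lengths of the lists and are omitted from the notation of functions. Order the $w$-variables as $\bm w_{\mathrm I}^{(1)},\dots,\bm w_{\mathrm I}^{(M-1)},\bm w^{(M)},\bm w_{\mathrm{II}}^{(M-1)},\dots,\bm w_{\mathrm{II}}^{(1)}$; the $c$-th variable in this list defines the coordinate $c\in\{1,2,\dots\}$. A coordinate is in layer $p<M$ if its variable belongs to $\bm w_{\mathrm I}^{(p)}$ or $\bm w_{\mathrm{II}}^{(p)}$, and in layer $M$ if it belongs to $\bm w^{(M)}$. (Thus $L^{\mathrm I}$ is the coordinate of $w^{(M)}_{L_M}$.) **Colourings.** A colouring assigns to each coordinate $c$ of layer $p$ a colour $i_c^{(p)}\in\{1,\dots,p+1\}$; we also write $i_c$. For $1\le j\le M$,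 let $\widehat{\bm I}^{(j)}$ be the set of coordinates in layers $j,\dots,M$ and $\bm I^{(j)}=\bm I^{(j)}_{k_j}\subset\widehat{\bm I}^{(j)}$ the subset of those with colour in $\{1,\dots,j\}$. Colourings are always assumed admissible, i.e. $|\bm I^{(j)}|=k_j$ for all $j$. The tuple $\bm I=(\bm I^{(1)},\dots,\bm I^{(M)})$ determines the colouring. For $1\le j\le M-1$, the elements of $\widehat{\bm I}^{(j)}$ with colour in $\{1,\dots,j+1\}$ number $k_{j+1}+L_j^{\mathrm I}+L_j^{\mathrm{II}}$; relabel them in increasing order by $1,2,\dots,k_{j+1}+L_j^{\mathrm I}+L_j^{\mathrm{II}}$, and let $\widetilde{\bm I}^{(j)}$ be the image of $\bm I^{(j)}$. For another colouring given by a tuple $\bm J$, the sets $\widetilde{\bm J}^{(j)}$ are defined in the same way. $C^{(p)}(k,l)$ is the number of coordinates $c\le k$ lying in layers $p,\dots,M$ with colour $l$. For $1\le p\le M$ put $\lambda^{[p]}=\lambda+\gamma\sum_{c}\mu_{i_c}$, the sum over all coordinates $c$ whose variable belongs to $\bm w_{\mathrm I}^{(p)},\dots,\bm w_{\mathrm I}^{(M-1)}$; so $\lambda^{[M]}=\lambda$. **Partition function.** Put $N_p=L_p^{\mathrm I}+k_{p+1}+L_p^{\mathrm{II}}$ for $p<M$, $N_M=L_M$. Layer $p$ is a grid with rows $r=1,\dots,k_p$ (top to bottom; row $r$ carries $z^{(p)}_r$) and columns $s=1,\dots,N_p$ (left to right; column $s$ carries the $s$-th entry of the concatenated list $(\bm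 w^{(p)}_{\mathrm I},\bm z^{(p+1)},\bm w^{(p)}_{\mathrm{II}})$ if $p<M$, and $w^{(M)}_s$ if $p=M$). Edges carry colours in $\{1,\dots,M+1\}$: horizontal $h^{(p)}_{r,s}$ ($0\le s\le N_p$) and vertical $v^{(p)}_{r,s}$ ($0\le r\le k_p$); vertex $(r,s)$ has left, right, bottom, top edges $h^{(p)}_{r,s-1},h^{(p)}_{r,s},v^{(p)}_{r,s},v^{(p)}_{r-1,s}$. Boundary conditions: $h^{(p)}_{r,N_p}=p+1$ for all $r$; $v^{(p)}_{k_p,s}=p+1$ for all $s$ as bottom boundary colours; $h^{(1)}_{r,0}=1$; $h^{(p+1)}_{r,0}=v^{(p)}_{0,L_p^{\mathrm I}+r}$ for $1\le r\le k_{p+1}$, $p<M$; and the top edge $v^{(p)}_{0,s}$ of a column carrying a $w$-variable has the colour of the corresponding coordinate. The dynamical parameter at the upper-left corner of vertex $(r,s)$ of layer $p$ is $\Lambda=\lambda^{[p]}-\gamma\sum_{r'<r}\mu_{h^{(p)}_{r',0}}-\gamma\sum_{s'<s}\mu_{v^{(p)}_{r-1,s'}}$. A vertex with left, bottom, right, top colours $(a,b,c,d)$, row variable $z$, column variable $w$ and parameter $\Lambda$ has weight: $[z-w-\gamma]$ if $a=b=c=d$; $\alpha(z-w,\Lambda_a-\Lambda_b)$ if $c=a\neq b=d$; $\beta(z-w,\Lambda_b-\Lambda_a)$ if $c=b\ne a=d$; $0$ otherwise. Then $\psi$ is the sum over all edge colourings satisfying the boundary conditions of the product of the weights of all vertices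 in all layers. *)

theory Defs
  imports "HOL-Analysis.Analysis" "HOL-Library.Multiset"
begin

section \<open>Theta function and elliptic polynomials\<close>

text \<open>The summation index is $j = n + 1/2$ with $n$ an integer.\<close>

definition theta :: "complex \<Rightarrow> complex \<Rightarrow> complex" where
  "theta \<tau> z = - (\<Sum>\<^sub>\<infinity>n::int.
     exp (\<i> * pi * (of_int n + 1/2)\<^sup>2 * \<tau> + 2 * pi * \<i> * (of_int n + 1/2) * (z + 1/2)))"

definition period_lattice :: "complex \<Rightarrow> complex set" where
  "period_lattice \<tau> = {of_int m + of_int n * \<tau> | m n :: int. True}"

text \<open>Only the values of \<open>chi\<close> on the lattice matter.\<close>

definition lattice_character :: "complex \<Rightarrow> (complex \<Rightarrow> complex) \<Rightarrow> bool" where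
  "lattice_character \<tau> chi \<longleftrightarrow>
     (\<forall>x\<in>period_lattice \<tau>. chi x \<noteq> 0) \<and>
     (\<forall>x\<in>period_lattice \<tau>. \<forall>y\<in>period_lattice \<tau>. chi (x + y) = chi x * chi y)"

definition elliptic_polynomials ::
    "complex \<Rightarrow> nat \<Rightarrow> (complex \<Rightarrow> complex) \<Rightarrow> (complex \<Rightarrow> complex) set" where
  "elliptic_polynomials \<tau> n chi = {\<phi>. \<phi> holomorphic_on UNIV \<and>
     (\<forall>y. \<phi> (y + 1) = chi 1 * \<phi> y) \<and>
     (\<forall>y. \<phi> (y + \<tau>) = chi \<tau> * exp (- 2 * pi * \<i> * n * y - pi * \<i> * n * \<tau>) * \<phi> y)}"

section \<open>Variables, coordinates and colourings\<close>

text \<open>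
  The arguments of the partition function: the number \<open>M\<close> of layers (so that the colours are
  $1, \dots, M+1$) and the ordered lists of variables, whose lengths are the sizes
  $k_p$, $L_p^{\mathrm{I}}$, $L_p^{\mathrm{II}}$, $L_M$. Only the values of \<open>zvars\<close> at
  $1, \dots, M$ and of \<open>wIvars\<close>, \<open>wIIvars\<close> at $1, \dots, M-1$ are used.
\<close>

record pf_data =
  layers :: nat
  zvars :: "nat \<Rightarrow> complex list"
  wIvars :: "nat \<Rightarrow> complex list"
  wIIvars :: "nat \<Rightarrow> complex list"
  wMvars :: "complex list"

text \<open>The \<open>j\<close>-th entry of a list, counted from 1.\<close>

definition entry :: "'a list \<Rightarrow> nat \<Rightarrow> 'a" where
  "entry xs j = xs ! (j - 1)"

text \<open>
  In the list of all $w$-variables, the blocks $w_{\mathrm{I}}^{(p)}$ and $w_{\mathrm{II}}^{(p)}$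
  ($p < M$) are preceded by \<open>offsetI d p\<close> and \<open>offsetII d p\<close> variables; the block $w^{(M)}$ is
  preceded by \<open>offsetI d M\<close> variables.
\<close>

definition offsetI :: "pf_data \<Rightarrow> nat \<Rightarrow> nat" where
  "offsetI d p = (\<Sum>q=1..<p. length (wIvars d q))"

definition offsetII :: "pf_data \<Rightarrow> nat \<Rightarrow> nat" where
  "offsetII d p = offsetI d (layers d) + length (wMvars d)
     + (\<Sum>q=p+1..<layers d. length (wIIvars d q))"

definition coordsI :: "pf_data \<Rightarrow> nat \<Rightarrow> nat set" where
  "coordsI d p = {offsetI d p + 1..offsetI d p + length (wIvars d p)}"

definition coordsII :: "pf_data \<Rightarrow> nat \<Rightarrow> nat set" where
  "coordsII d p = {offsetII d p + 1..offsetII d p + length (wIIvars d p)}"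

definition coordsM :: "pf_data \<Rightarrow> nat set" where
  "coordsM d = {offsetI d (layers d) + 1..offsetI d (layers d) + length (wMvars d)}"

definition layer_coords :: "pf_data \<Rightarrow> nat \<Rightarrow> nat set" where
  "layer_coords d p = (if p < layers d then coordsI d p \<union> coordsII d p else coordsM d)"

definition Ihat :: "pf_data \<Rightarrow> nat \<Rightarrow> nat set" where
  "Ihat d j = (\<Union>p\<in>{j..layers d}. layer_coords d p)"

definition colouring :: "pf_data \<Rightarrow> (nat \<Rightarrow> nat) \<Rightarrow> bool" where
  "colouring d col \<longleftrightarrow>
     (\<forall>p\<in>{1..layers d}. \<forall>c\<in>layer_coords d p. col c \<in> {1..p+1})"

definition tuple_of_colouring :: "pf_data \<Rightarrow> (nat \<Rightarrow> nat) \<Rightarrow> nat \<Rightarrow> nat set" where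
  "tuple_of_colouring d col j = {c \<in> Ihat d j. col c \<in> {1..j}}"

text \<open>
  A colouring is represented by its tuple \<open>I\<close> of coordinate sets, of which only
  $I^{(1)}, \dots, I^{(M)}$ matter.
\<close>

definition admissible :: "pf_data \<Rightarrow> (nat \<Rightarrow> nat set) \<Rightarrow> bool" where
  "admissible d I \<longleftrightarrow> (\<exists>col. colouring d col \<and>
     (\<forall>j\<in>{1..layers d}. I j = tuple_of_colouring d col j \<and> card (I j) = length (zvars d j)))"

text \<open>
  Recovers the colour from the tuple: for a coordinate \<open>c\<close> of layer \<open>p\<close>, it is the least
  \<open>a \<le> p\<close> with $c \in I^{(a)}$, and \<open>p + 1\<close> if there is none (see the lemma
  \<open>colour_tuple_of_colouring\<close> below).
\<close>

definition colour :: "pf_data \<Rightarrow> (nat \<Rightarrow> nat set) \<Rightarrow> nat \<Rightarrow> nat" where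
  "colour d I c = (LEAST a. 1 \<le> a \<and> (c \<in> Ihat d a \<longrightarrow> c \<in> I a))"

definition Itilde :: "pf_data \<Rightarrow> (nat \<Rightarrow> nat set) \<Rightarrow> nat \<Rightarrow> nat set" where
  "Itilde d I j =
     (\<lambda>c. card {c' \<in> Ihat d j. colour d I c' \<in> {1..j+1} \<and> c' \<le> c}) ` I j"

definition colour_count :: "pf_data \<Rightarrow> (nat \<Rightarrow> nat set) \<Rightarrow> nat \<Rightarrow> nat \<Rightarrow> nat \<Rightarrow> nat" where
  "colour_count d I p k l = card {c \<in> Ihat d p. c \<le> k \<and> colour d I c = l}"

section \<open>Dynamical parameter and weights\<close>

text \<open>A dynamical variable is a function on indices, used only at $1, \dots, M+1$.\<close>

definition mu :: "nat \<Rightarrow> nat \<Rightarrow> complex" where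
  "mu i a = (if a = i then 1 else 0)"

definition generic :: "complex \<Rightarrow> complex \<Rightarrow> nat \<Rightarrow> (nat \<Rightarrow> complex) \<Rightarrow> bool" where
  "generic \<tau> \<gamma> M lam \<longleftrightarrow> (\<forall>i\<in>{1..M+1}. \<forall>j\<in>{1..M+1}. \<forall>n::int.
     i \<noteq> j \<longrightarrow> theta \<tau> (lam i - lam j + of_int n * \<gamma>) \<noteq> 0)"

definition shifted_lam ::
    "complex \<Rightarrow> pf_data \<Rightarrow> (nat \<Rightarrow> nat set) \<Rightarrow> (nat \<Rightarrow> complex) \<Rightarrow> nat \<Rightarrow> nat \<Rightarrow> complex" where
  "shifted_lam \<gamma> d I lam p a =
     lam a + \<gamma> * (\<Sum>c\<in>(\<Union>q\<in>{p..<layers d}. coordsI d q). mu (colour d I c) a)"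

definition alpha :: "complex \<Rightarrow> complex \<Rightarrow> complex \<Rightarrow> complex \<Rightarrow> complex" where
  "alpha \<tau> \<gamma> z l = theta \<tau> z * theta \<tau> (l + \<gamma>) / theta \<tau> l"

definition beta :: "complex \<Rightarrow> complex \<Rightarrow> complex \<Rightarrow> complex \<Rightarrow> complex" where
  "beta \<tau> \<gamma> z l = - (theta \<tau> (z + l) * theta \<tau> \<gamma> / theta \<tau> l)"

text \<open>The colours \<open>a\<close>, \<open>b\<close>, \<open>c\<close>, \<open>e\<close> are those of the left, bottom, right and top edges.\<close>

definition weight ::
    "complex \<Rightarrow> complex \<Rightarrow> complex \<Rightarrow> complex \<Rightarrow> (nat \<Rightarrow> complex) \<Rightarrow>
     nat \<Rightarrow> nat \<Rightarrow> nat \<Rightarrow> nat \<Rightarrow> complex" where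
  "weight \<tau> \<gamma> z w \<Lambda> a b c e =
     (if a = b \<and> b = c \<and> c = e then theta \<tau> (z - w - \<gamma>)
      else if c = a \<and> a \<noteq> b \<and> b = e then alpha \<tau> \<gamma> (z - w) (\<Lambda> a - \<Lambda> b)
      else if c = b \<and> b \<noteq> a \<and> a = e then beta \<tau> \<gamma> (z - w) (\<Lambda> b - \<Lambda> a)
      else 0)"

section \<open>Partition function\<close>

definition column_vars :: "pf_data \<Rightarrow> nat \<Rightarrow> complex list" where
  "column_vars d p =
     (if p < layers d then wIvars d p @ zvars d (p + 1) @ wIIvars d p else wMvars d)"

definition nrows :: "pf_data \<Rightarrow> nat \<Rightarrow> nat" where
  "nrows d p = length (zvars d p)"

definition ncols :: "pf_data \<Rightarrow> nat \<Rightarrow> nat" where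
  "ncols d p = length (column_vars d p)"

text \<open>
  \<open>Hor p r s\<close> (\<open>0 \<le> s\<close>) and \<open>Ver p r s\<close> (\<open>0 \<le> r\<close>) are the edges of layer \<open>p\<close> just right of,
  respectively just below, vertex \<open>(r, s)\<close>.
\<close>

datatype edge = Hor nat nat nat | Ver nat nat nat

definition edges :: "pf_data \<Rightarrow> edge set" where
  "edges d =
     {Hor p r s | p r s. p \<in> {1..layers d} \<and> r \<in> {1..nrows d p} \<and> s \<in> {0..ncols d p}} \<union>
     {Ver p r s | p r s. p \<in> {1..layers d} \<and> r \<in> {0..nrows d p} \<and> s \<in> {1..ncols d p}}"

definition boundary_conditions :: "pf_data \<Rightarrow> (nat \<Rightarrow> nat set) \<Rightarrow> (edge \<Rightarrow> nat) \<Rightarrow> bool" where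
  "boundary_conditions d I \<sigma> \<longleftrightarrow>
     (\<forall>p\<in>{1..layers d}. \<forall>r\<in>{1..nrows d p}. \<sigma> (Hor p r (ncols d p)) = p + 1) \<and>
     (\<forall>p\<in>{1..layers d}. \<forall>s\<in>{1..ncols d p}. \<sigma> (Ver p (nrows d p) s) = p + 1) \<and>
     (\<forall>r\<in>{1..nrows d 1}. \<sigma> (Hor 1 r 0) = 1) \<and>
     (\<forall>p\<in>{1..<layers d}. \<forall>r\<in>{1..nrows d (p + 1)}.
        \<sigma> (Hor (p + 1) r 0) = \<sigma> (Ver p 0 (length (wIvars d p) + r))) \<and>
     (\<forall>p\<in>{1..<layers d}. \<forall>s\<in>{1..length (wIvars d p)}.
        \<sigma> (Ver p 0 s) = colour d I (offsetI d p + s)) \<and>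
     (\<forall>p\<in>{1..<layers d}. \<forall>s\<in>{1..length (wIIvars d p)}.
        \<sigma> (Ver p 0 (length (wIvars d p) + nrows d (p + 1) + s)) = colour d I (offsetII d p + s)) \<and>
     (\<forall>s\<in>{1..length (wMvars d)}.
        \<sigma> (Ver (layers d) 0 s) = colour d I (offsetI d (layers d) + s))"

definition states :: "pf_data \<Rightarrow> (nat \<Rightarrow> nat set) \<Rightarrow> (edge \<Rightarrow> nat) set" where
  "states d I = {\<sigma> \<in> edges d \<rightarrow>\<^sub>E {1..layers d + 1}. boundary_conditions d I \<sigma>}"

text \<open>The dynamical parameter at the upper-left corner of vertex \<open>(r, s)\<close> of layer \<open>p\<close>.\<close>

definition dyn_param ::
    "complex \<Rightarrow> pf_data \<Rightarrow> (nat \<Rightarrow> nat set) \<Rightarrow> (nat \<Rightarrow> complex) \<Rightarrow> (edge \<Rightarrow> nat) \<Rightarrow>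
     nat \<Rightarrow> nat \<Rightarrow> nat \<Rightarrow> nat \<Rightarrow> complex" where
  "dyn_param \<gamma> d I lam \<sigma> p r s a = shifted_lam \<gamma> d I lam p a
     - \<gamma> * (\<Sum>r'=1..<r. mu (\<sigma> (Hor p r' 0)) a)
     - \<gamma> * (\<Sum>s'=1..<s. mu (\<sigma> (Ver p (r - 1) s')) a)"

definition psi ::
    "complex \<Rightarrow> complex \<Rightarrow> pf_data \<Rightarrow> (nat \<Rightarrow> nat set) \<Rightarrow> (nat \<Rightarrow> complex) \<Rightarrow> complex" where
  "psi \<tau> \<gamma> d I lam = (\<Sum>\<sigma>\<in>states d I. \<Prod>p=1..layers d. \<Prod>r=1..nrows d p. \<Prod>s=1..ncols d p.
     weight \<tau> \<gamma> (entry (zvars d p) r) (entry (column_vars d p) s) (dyn_param \<gamma> d I lam \<sigma> p r s)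
       (\<sigma> (Hor p r (s - 1))) (\<sigma> (Ver p r s)) (\<sigma> (Hor p r s)) (\<sigma> (Ver p (r - 1) s)))"

section \<open>Colourings and their tuples\<close>

lemma offsetI_mono: "p \<le> q \<Longrightarrow> offsetI d p \<le> offsetI d q"
  unfolding offsetI_def by (rule sum_mono2) auto

lemma offsetI_Suc: "1 \<le> p \<Longrightarrow> offsetI d (Suc p) = offsetI d p + length (wIvars d p)"
  by (simp add: offsetI_def)

lemma offsetI_less:
  assumes "1 \<le> p" "p < q" shows "offsetI d p + length (wIvars d p) \<le> offsetI d q"
  using offsetI_mono[of "Suc p" q d] offsetI_Suc[of p d] assms by simp

lemma offsetII_less:
  assumes "p < q" "q < layers d" shows "offsetII d q + length (wIIvars d q) \<le> offsetII d p"
proof -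
  have "{p+1..<layers d} \<supseteq> insert q {q+1..<layers d}" using assms by auto
  then have "(\<Sum>i\<in>insert q {q+1..<layers d}. length (wIIvars d i))
      \<le> (\<Sum>i=p+1..<layers d. length (wIIvars d i))"
    by (intro sum_mono2) auto
  then show ?thesis by (simp add: offsetII_def)
qed

lemma layer_coords_disjoint:
  assumes "1 \<le> p" "p < q" "q \<le> layers d"
  shows "layer_coords d p \<inter> layer_coords d q = {}"
proof -
  have a: "offsetI d p + length (wIvars d p) \<le> offsetI d q" using offsetI_less assms by blast
  have b: "offsetI d p + length (wIvars d p) \<le> offsetI d (layers d)"
    using offsetI_less[of p "layers d"] assms by simp
  have c: "q < layers d \<Longrightarrow> offsetI d q + length (wIvars d q) \<le> offsetI d (layers d)"
    using offsetI_less[of q "layers d"] assms by simp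
  have e: "q < layers d \<Longrightarrow> offsetII d q + length (wIIvars d q) \<le> offsetII d p"
    using offsetII_less assms by blast
  have f: "offsetI d (layers d) + length (wMvars d) \<le> offsetII d r" for r
    by (simp add: offsetII_def)
  show ?thesis
    using assms a b c e f[of p] f[of q]
    by (cases "q < layers d")
      (auto simp: layer_coords_def coordsI_def coordsII_def coordsM_def)
qed

lemma mem_Ihat_iff:
  assumes "p \<in> {1..layers d}" "c \<in> layer_coords d p" "1 \<le> j"
  shows "c \<in> Ihat d j \<longleftrightarrow> j \<le> p"
proof
  assume "c \<in> Ihat d j"
  then obtain q where q: "j \<le> q" "q \<le> layers d" "c \<in> layer_coords d q"
    by (auto simp: Ihat_def)
  have "q = p"
    using layer_coords_disjoint[of p q d] layer_coords_disjoint[of q p d] q assms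
    by (cases q p rule: linorder_cases) auto
  then show "j \<le> p" using q by simp
qed (use assms in \<open>auto simp: Ihat_def\<close>)

lemma colour_tuple_of_colouring:
  assumes "colouring d col" "\<forall>j\<in>{1..layers d}. I j = tuple_of_colouring d col j"
    and "p \<in> {1..layers d}" "c \<in> layer_coords d p"
  shows "colour d I c = col c"
  unfolding colour_def
proof (rule Least_equality)
  have col: "1 \<le> col c" "col c \<le> p + 1" using assms by (auto simp: colouring_def)
  then show "1 \<le> col c \<and> (c \<in> Ihat d (col c) \<longrightarrow> c \<in> I (col c))"
    using assms mem_Ihat_iff[OF assms(3,4)] by (auto simp: tuple_of_colouring_def)
  fix a assume a: "1 \<le> a \<and> (c \<in> Ihat d a \<longrightarrow> c \<in> I a)"
  show "col c \<le> a"
  proof (cases "a \<le> p")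
    case True
    then show ?thesis
      using a assms mem_Ihat_iff[OF assms(3,4), of a] by (auto simp: tuple_of_colouring_def)
  qed (use col in simp)
qed

text \<open>Only the components $1, \dots, M+1$ of the dynamical variable enter.\<close>

lemma psi_cong_lam:
  assumes "\<And>a. a \<in> {1..layers d + 1} \<Longrightarrow> lam a = lam' a"
  shows "psi \<tau> \<gamma> d I lam = psi \<tau> \<gamma> d I lam'"
  unfolding psi_def
proof (intro sum.cong prod.cong refl)
  fix \<sigma> p r s
  assume \<sigma>: "\<sigma> \<in> states d I" and p: "p \<in> {1..layers d}"
    and r: "r \<in> {1..nrows d p}" and s: "s \<in> {1..ncols d p}"
  have E: "\<sigma> e \<in> {1..layers d + 1}" if "e \<in> edges d" for e
    using \<sigma> that by (auto simp: states_def)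
  have "Hor p r (s - 1) \<in> edges d" "Ver p r s \<in> edges d"
    using p r s by (auto simp: edges_def)
  then have *: "dyn_param \<gamma> d I lam \<sigma> p r s (\<sigma> e) = dyn_param \<gamma> d I lam' \<sigma> p r s (\<sigma> e)"
    if "e \<in> {Hor p r (s - 1), Ver p r s}" for e
    using that assms[OF E[of e]] by (auto simp: dyn_param_def shifted_lam_def)
  show "weight \<tau> \<gamma> (entry (zvars d p) r) (entry (column_vars d p) s) (dyn_param \<gamma> d I lam \<sigma> p r s)
       (\<sigma> (Hor p r (s - 1))) (\<sigma> (Ver p r s)) (\<sigma> (Hor p r s)) (\<sigma> (Ver p (r - 1) s)) =
     weight \<tau> \<gamma> (entry (zvars d p) r) (entry (column_vars d p) s) (dyn_param \<gamma> d I lam' \<sigma> p r s)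
       (\<sigma> (Hor p r (s - 1))) (\<sigma> (Ver p r s)) (\<sigma> (Hor p r s)) (\<sigma> (Ver p (r - 1) s))"
    by (simp only: weight_def *[of "Hor p r (s - 1)", simplified] *[of "Ver p r s", simplified]
        One_nat_def)
qed

end

theory Submission
  imports Defs "HOL-Complex_Analysis.Complex_Analysis"
begin

text \<open>
  Layers interact only through the words of colours on their interfaces, so \<open>\<psi>\<close> is a product of
  the partition functions of rectangular grids, summed over these words. Case A of the last coordinate
  of layer \<open>M\<close> is read off the last column of the top grid: exactly one vertex of that column in each
  state has a \<open>\<beta>\<close>-weight with a colour change, and at $w = z - \gamma$ the vertex in the lower right
  corner must be that vertex, which freezes the last row and the last column. In case B the last column
  is frozen, and for $k_M = 1$ the only row is.

  For the symmetry, two crossing lines with parameters $z, z'$ are pulled through the top grid and then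
  through the grid of layer $M - 1$ by the dynamical Yang--Baxter equation, which follows from
  Fay's identity. The crossing contributes $[z - z' - \gamma]$ on either end, and this factor is
  cancelled by continuity.
\<close>

section \<open>Theta functions\<close>

text \<open>The lines z^(M) are rows of layer M and columns of layer M - 1, and the colours on the
  interface between these layers are summed over. A crossing that is pulled leftwards out of layer M
  therefore meets no fixed boundary word and has to be handed on to layer M - 1. The right boundary
  of layer M and the bottom boundary of layer M - 1 are constant words, and on a pair of equal
  colours the crossing is a scalar; hence the same factor on both ends. For M = 1 the constant left
  boundary plays the part of layer M - 1. Handing on requires one dynamical parameter for both grids
  at the crossing. This is the purpose of the shift in \<lambda>^[M-1], which is undone by the
  columns of the first block of w-variables.

  Grids can be cut and glued because conservation of colour makes the parameter at a corner
  independent of the path to it. Sums over edge colourings do not lend themselves to induction, so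
  they are converted once into recursive row and grid sums. All changes of data go through one
  device, an increasing map from the new coordinates to the old ones.\<close>

definition theta_term :: "real \<Rightarrow> complex \<Rightarrow> complex \<Rightarrow> int \<Rightarrow> complex" where
  "theta_term s \<tau> z n =
     exp (\<i> * pi * (of_int n + of_real s)\<^sup>2 * \<tau> + 2 * pi * \<i> * (of_int n + of_real s) * z)"

text \<open>The characteristic \<open>s\<close> is kept as a parameter because a product of two
  series with s = 1/2 is resolved into series with s = 0 and s = 1/2 at 2\<tau>.\<close>

definition theta_char :: "real \<Rightarrow> complex \<Rightarrow> complex \<Rightarrow> complex" where
  "theta_char s \<tau> z = (\<Sum>\<^sub>\<infinity>n. theta_term s \<tau> z n)"

lemma theta_eq_theta_char: "theta \<tau> z = - theta_char (1/2) \<tau> (z + 1/2)"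
  by (simp add: theta_def theta_char_def theta_term_def)

lemma norm_theta_term:
  "norm (theta_term s \<tau> z n) = exp (- pi * (of_int n + s)\<^sup>2 * Im \<tau> - 2 * pi * (of_int n + s) * Im z)"
  by (simp add: theta_term_def power2_eq_square algebra_simps)

section \<open>Convergence and holomorphy of the theta series\<close>

lemma exp_neg_abs_summable_on_int: "(\<lambda>n::int. exp (- \<bar>real_of_int n\<bar>)) summable_on UNIV"
proof -
  have nat: "(\<lambda>k::nat. exp (- real k)) summable_on UNIV"
  proof (rule norm_summable_imp_summable_on)
    have "(\<lambda>k. norm (exp (- real k))) = (\<lambda>k. exp (-1) ^ k)"
      by (simp add: exp_of_nat_mult[symmetric])
    then show "summable (\<lambda>k. norm (exp (- real k)))"
      by (simp add: summable_geometric_iff)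
  qed
  have "(\<lambda>n::int. exp (- \<bar>real_of_int n\<bar>)) summable_on range int"
    using nat by (subst summable_on_reindex) (auto simp: o_def inj_on_def)
  moreover have "(\<lambda>n::int. exp (- \<bar>real_of_int n\<bar>)) summable_on range (\<lambda>k. - int k)"
    using nat by (subst summable_on_reindex) (auto simp: o_def inj_on_def)
  ultimately have "(\<lambda>n::int. exp (- \<bar>real_of_int n\<bar>)) summable_on
      (range int \<union> (range (\<lambda>k. - int k) - range int))"
    by (intro summable_on_Un_disjoint) (auto intro: summable_on_subset_banach)
  moreover have "range int \<union> (range (\<lambda>k. - int k) - range int) = UNIV"
    using int_cases2 by blast
  ultimately show ?thesis by simp
qed

text \<open>Completing the square: the Gaussian absorbs the linear exponent b |m|, and the summand 1
  in b = 2 \<pi> B + 1 leaves the factor exp(- |m|) over. The constant depends on z only through B,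
  so this is a common majorant on a horizontal strip.\<close>

lemma norm_theta_term_le:
  assumes "Im \<tau> > 0" "\<bar>Im z\<bar> \<le> B"
  shows "norm (theta_term s \<tau> z n)
    \<le> exp ((2 * pi * B + 1)\<^sup>2 / (4 * pi * Im \<tau>) + \<bar>s\<bar>) * exp (- \<bar>real_of_int n\<bar>)"
proof -
  define m where "m = real_of_int n + s"
  define a where "a = pi * Im \<tau>"
  define b where "b = 2 * pi * B + 1"
  have a: "a > 0" using assms by (simp add: a_def)
  have "0 \<le> (2 * a * \<bar>m\<bar> - b)\<^sup>2 / (4 * a)" using a by simp
  also have "\<dots> = a * m\<^sup>2 - b * \<bar>m\<bar> + b\<^sup>2 / (4 * a)"
    using a by (simp add: power2_eq_square field_simps)
  finally have 1: "b * \<bar>m\<bar> - a * m\<^sup>2 \<le> b\<^sup>2 / (4 * a)" by simp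
  have "- 2 * pi * m * Im z \<le> \<bar>2 * pi * m * Im z\<bar>" by linarith
  also have "\<dots> = 2 * pi * \<bar>m\<bar> * \<bar>Im z\<bar>" by (simp add: abs_mult)
  also have "\<dots> \<le> 2 * pi * \<bar>m\<bar> * B"
    using assms by (intro mult_left_mono) auto
  finally have 2: "- a * m\<^sup>2 - 2 * pi * m * Im z \<le> b * \<bar>m\<bar> - a * m\<^sup>2 - \<bar>m\<bar>"
    by (simp add: b_def algebra_simps)
  have 3: "- \<bar>m\<bar> \<le> \<bar>s\<bar> - \<bar>real_of_int n\<bar>" by (simp add: m_def)
  have "- a * m\<^sup>2 - 2 * pi * m * Im z \<le> (b\<^sup>2 / (4 * a) + \<bar>s\<bar>) + (- \<bar>real_of_int n\<bar>)"
    using 1 2 3 by linarith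
  then show ?thesis
    unfolding norm_theta_term exp_add[symmetric] exp_le_cancel_iff
    by (simp add: a_def b_def m_def mult_ac)
qed

lemma theta_majorant_summable:
  "(\<lambda>n. exp C * exp (- \<bar>real_of_int n\<bar>)) summable_on UNIV"
  by (intro summable_on_cmult_right exp_neg_abs_summable_on_int)

lemma theta_term_abs_summable:
  assumes "Im \<tau> > 0"
  shows "(\<lambda>n. norm (theta_term s \<tau> z n)) summable_on UNIV"
  by (rule summable_on_comparison_test[OF theta_majorant_summable])
    (use norm_theta_term_le[OF assms, of z "\<bar>Im z\<bar>"] in auto)

lemma theta_char_holomorphic:
  assumes "Im \<tau> > 0"
  shows "theta_char s \<tau> holomorphic_on UNIV"
proof -
  have "theta_char s \<tau> holomorphic_on ball z 1" for z
  proof (rule holomorphic_uniform_limit)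
    show "uniform_limit (cball z 1) (\<lambda>X y. \<Sum>n\<in>X. theta_term s \<tau> y n) (theta_char s \<tau>)
        (finite_subsets_at_top UNIV)"
      unfolding theta_char_def
    proof (rule Weierstrass_m_test_general[OF _ theta_majorant_summable])
      fix n y assume "y \<in> cball z 1"
      then have "\<bar>Im y\<bar> \<le> \<bar>Im z\<bar> + 1"
        using abs_Im_le_cmod[of "z - y"] by (simp add: dist_norm)
      from norm_theta_term_le[OF assms this] show "norm (theta_term s \<tau> y n)
         \<le> exp ((2 * pi * (\<bar>Im z\<bar> + 1) + 1)\<^sup>2 / (4 * pi * Im \<tau>) + \<bar>s\<bar>) * exp (- \<bar>real_of_int n\<bar>)" .
    qed
    show "\<forall>\<^sub>F X in finite_subsets_at_top UNIV.
        continuous_on (cball z 1) (\<lambda>y. \<Sum>n\<in>X. theta_term s \<tau> y n) \<and>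
        (\<lambda>y. \<Sum>n\<in>X. theta_term s \<tau> y n) holomorphic_on ball z 1"
      unfolding theta_term_def by (intro always_eventually allI conjI continuous_intros holomorphic_intros)
  qed auto
  then show ?thesis
    by (metis UNIV_I centre_in_ball holomorphic_on_open open_UNIV open_ball zero_less_one)
qed

lemma theta_holomorphic: "Im \<tau> > 0 \<Longrightarrow> theta \<tau> holomorphic_on UNIV"
  unfolding theta_eq_theta_char[abs_def]
  by (intro holomorphic_intros holomorphic_on_compose[OF _ holomorphic_on_subset[OF theta_char_holomorphic],
        unfolded o_def]) auto

section \<open>Parity and quasi-periodicity\<close>

lemma theta_minus: "theta \<tau> (- z) = - theta \<tau> z"
proof -
  \<comment> \<open>The substitution n -> - n - 1 negates n + 1/2. The half added to z then leaves
    over exp(- \<i> \<pi>) = - 1, which is why the function is odd and not even.\<close>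
  have "theta_char (1/2) \<tau> (- z + 1/2) = (\<Sum>\<^sub>\<infinity>n. theta_term (1/2) \<tau> (- z + 1/2) (- n - 1))"
    unfolding theta_char_def
    by (rule infsum_reindex_bij_betw[symmetric], rule bij_betwI[of _ _ _ "\<lambda>n. - n - 1"]) auto
  also have "\<dots> = (\<Sum>\<^sub>\<infinity>n. - theta_term (1/2) \<tau> (z + 1/2) n)"
  proof (rule infsum_cong)
    fix n :: int
    have "theta_term (1/2) \<tau> (- z + 1/2) (- n - 1) =
        theta_term (1/2) \<tau> (z + 1/2) n * (exp (- (2 * pi * \<i> * of_int n)) * exp (- (\<i> * pi)))"
      unfolding theta_term_def exp_add[symmetric]
      by (rule arg_cong[of _ _ exp]) (simp add: field_simps power2_eq_square)
    also have "exp (- (2 * pi * \<i> * of_int n)) = (1::complex)"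
      using exp_integer_2pi[of "- of_int n"] by (simp add: mult_ac)
    also have "exp (- (\<i> * pi)) = - 1"
      by (simp add: exp_minus)
    finally show "theta_term (1/2) \<tau> (- z + 1/2) (- n - 1) = - theta_term (1/2) \<tau> (z + 1/2) n"
      by simp
  qed
  finally show ?thesis
    by (simp add: theta_eq_theta_char theta_char_def infsum_uminus)
qed

lemma theta_0 [simp]: "theta \<tau> 0 = 0"
  using theta_minus[of \<tau> 0] by simp

lemma theta_plus_1: "theta \<tau> (z + 1) = - theta \<tau> z"
proof -
  have "theta_term (1/2) \<tau> (z + 1 + 1/2) n = theta_term (1/2) \<tau> (z + 1/2) n * (- 1)" for n
  proof -
    have "theta_term (1/2) \<tau> (z + 1 + 1/2) n =
        theta_term (1/2) \<tau> (z + 1/2) n * (exp (2 * pi * \<i> * of_int n) * exp (\<i> * pi))"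
      unfolding theta_term_def exp_add[symmetric]
      by (rule arg_cong[of _ _ exp]) (simp add: field_simps power2_eq_square)
    also have "exp (2 * pi * \<i> * of_int n) = (1::complex)"
      using exp_integer_2pi[of "of_int n"] by (simp add: mult_ac)
    finally show ?thesis by simp
  qed
  then show ?thesis
    by (simp add: theta_eq_theta_char theta_char_def infsum_uminus)
qed

text \<open>Adding \<tau> to z completes the square with n + 1 in place of n, so the series is
  merely shifted by one index.\<close>

lemma theta_plus_tau:
  "theta \<tau> (z + \<tau>) = - exp (- \<i> * pi * \<tau> - 2 * pi * \<i> * z) * theta \<tau> z"
proof -
  have "theta_term (1/2) \<tau> (z + \<tau> + 1/2) n =
      - exp (- \<i> * pi * \<tau> - 2 * pi * \<i> * z) * theta_term (1/2) \<tau> (z + 1/2) (n + 1)" for n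
  proof -
    have "theta_term (1/2) \<tau> (z + \<tau> + 1/2) n =
      (exp (- (\<i> * pi)) * exp (- \<i> * pi * \<tau> - 2 * pi * \<i> * z)) * theta_term (1/2) \<tau> (z + 1/2) (n + 1)"
      unfolding theta_term_def exp_add[symmetric]
      by (rule arg_cong[of _ _ exp]) (simp add: field_simps power2_eq_square)
    then show ?thesis by (simp add: exp_minus)
  qed
  then have "theta_char (1/2) \<tau> (z + \<tau> + 1/2) =
      - exp (- \<i> * pi * \<tau> - 2 * pi * \<i> * z) * (\<Sum>\<^sub>\<infinity>n. theta_term (1/2) \<tau> (z + 1/2) (n + 1))"
    unfolding theta_char_def infsum_cmult_right'[symmetric] by (intro infsum_cong) simp
  also have "(\<Sum>\<^sub>\<infinity>n. theta_term (1/2) \<tau> (z + 1/2) (n + 1)) = theta_char (1/2) \<tau> (z + 1/2)"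
    unfolding theta_char_def
    by (rule infsum_reindex_bij_betw, rule bij_betwI[of _ _ _ "\<lambda>n. n - 1"]) auto
  finally show ?thesis by (simp add: theta_eq_theta_char)
qed

section \<open>Product formula and Fay's identity\<close>

lemma theta_term_product_summable:
  assumes "Im \<tau> > 0"
  shows "(\<lambda>(m, n). theta_term s \<tau> x m * theta_term t \<tau> y n) summable_on UNIV \<times> UNIV"
proof (rule abs_summable_summable)
  let ?f = "\<lambda>m. norm (theta_term s \<tau> x m)" and ?g = "\<lambda>n. norm (theta_term t \<tau> y n)"
  have "(\<lambda>(m, n). ?f m * ?g n) summable_on UNIV \<times> UNIV"
  proof (rule summable_on_SigmaI)
    show "((\<lambda>n. case (m, n) of (m, n) \<Rightarrow> ?f m * ?g n) has_sum ?f m * infsum ?g UNIV) UNIV" for m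
      using theta_term_abs_summable[OF assms] by (auto intro!: has_sum_cmult_right has_sum_infsum)
    show "(\<lambda>m. ?f m * infsum ?g UNIV) summable_on UNIV"
      by (intro summable_on_cmult_left theta_term_abs_summable assms)
  qed auto
  then show "(\<lambda>p. norm (case p of (m, n) \<Rightarrow> theta_term s \<tau> x m * theta_term t \<tau> y n)) summable_on UNIV \<times> UNIV"
    by (simp add: norm_mult case_prod_unfold)
qed

lemma theta_char_mult:
  assumes "Im \<tau> > 0"
  shows "theta_char s \<tau> x * theta_char t \<tau> y =
    (\<Sum>\<^sub>\<infinity>(m, n). theta_term s \<tau> x m * theta_term t \<tau> y n)"
  using infsum_Sigma_banach[OF theta_term_product_summable[OF assms, of s x t y]]
  by (simp add: theta_char_def infsum_cmult_left' infsum_cmult_right')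

text \<open>
  In the double series of the left-hand side substitute \<open>p = m + n + 1\<close>, \<open>q = m - n\<close>: these are
  integers of opposite parity, and the even and odd values of \<open>p\<close> give the two products on the right.
\<close>

lemma theta_product:
  assumes "Im \<tau> > 0"
  shows "theta \<tau> (x + y) * theta \<tau> (x - y) =
      theta_char 0 (2 * \<tau>) (2 * x) * theta_char (1/2) (2 * \<tau>) (2 * y)
    - theta_char (1/2) (2 * \<tau>) (2 * x) * theta_char 0 (2 * \<tau>) (2 * y)"
proof -
  let ?T = "\<lambda>(m, n). theta_term (1/2) \<tau> (x + y + 1/2) m * theta_term (1/2) \<tau> (x - y + 1/2) n"
  let ?P = "range (\<lambda>(a, b). (a + b, a - b - 1 :: int))"
  let ?Q = "range (\<lambda>(a, b). (a + b, a - b :: int))"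
  have \<tau>2: "Im (2 * \<tau>) > 0" using assms by simp
  have un: "?P \<union> ?Q = UNIV"
  proof -
    have "(m, n) \<in> ?P \<union> ?Q" for m n :: int
    proof (cases "even (m + n)")
      case True
      then have "(m, n) = (case ((m + n) div 2, (m - n) div 2) of (a, b) \<Rightarrow> (a + b, a - b))"
        by auto presburger+
      then show ?thesis by blast
    next
      case False
      then have "(m, n) = (case ((m + n + 1) div 2, (m - n - 1) div 2) of (a, b) \<Rightarrow> (a + b, a - b - 1))"
        by auto presburger+
      then show ?thesis by blast
    qed
    then show ?thesis by auto
  qed
  have disj: "?P \<inter> ?Q = {}"
    by auto presburger
  have summ: "?T summable_on S" for S
    using theta_term_product_summable[OF assms] by (rule summable_on_subset_banach) auto
  have e1: "exp (2 * complex_of_real pi * \<i> * of_int n) = 1" for n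
    using exp_integer_2pi[of "of_int n"] by (simp add: mult_ac)
  have P: "?T (a + b, a - b - 1) = theta_term 0 (2 * \<tau>) (2 * x) a * theta_term (1/2) (2 * \<tau>) (2 * y) b" for a b
  proof -
    have "?T (a + b, a - b - 1) = exp (2 * pi * \<i> * of_int a) *
        (theta_term 0 (2 * \<tau>) (2 * x) a * theta_term (1/2) (2 * \<tau>) (2 * y) b)"
      unfolding theta_term_def exp_add[symmetric] prod.case
      by (rule arg_cong[of _ _ exp]) (simp add: field_simps power2_eq_square)
    then show ?thesis by (simp add: e1)
  qed
  have Q: "?T (a + b, a - b) = - (theta_term (1/2) (2 * \<tau>) (2 * x) a * theta_term 0 (2 * \<tau>) (2 * y) b)" for a b
  proof -
    have "?T (a + b, a - b) = (exp (2 * pi * \<i> * of_int a) * exp (\<i> * pi)) *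
        (theta_term (1/2) (2 * \<tau>) (2 * x) a * theta_term 0 (2 * \<tau>) (2 * y) b)"
      unfolding theta_term_def exp_add[symmetric] prod.case
      by (rule arg_cong[of _ _ exp]) (simp add: field_simps power2_eq_square)
    then show ?thesis by (simp add: e1)
  qed
  have "theta \<tau> (x + y) * theta \<tau> (x - y) = infsum ?T (?P \<union> ?Q)"
    unfolding un by (simp add: theta_eq_theta_char theta_char_mult[OF assms])
  also have "\<dots> = infsum ?T ?P + infsum ?T ?Q"
    by (rule infsum_Un_disjoint[OF summ summ disj])
  also have "infsum ?T ?P = (\<Sum>\<^sub>\<infinity>(a, b). theta_term 0 (2 * \<tau>) (2 * x) a * theta_term (1/2) (2 * \<tau>) (2 * y) b)"
    by (subst infsum_reindex) (use P in \<open>auto simp: inj_on_def o_def case_prod_unfold\<close>)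
  also have "infsum ?T ?Q = - (\<Sum>\<^sub>\<infinity>(a, b). theta_term (1/2) (2 * \<tau>) (2 * x) a * theta_term 0 (2 * \<tau>) (2 * y) b)"
    by (subst infsum_reindex)
      (use Q in \<open>auto simp: inj_on_def o_def case_prod_unfold infsum_uminus[symmetric] simp del: infsum_uminus\<close>)
  finally show ?thesis
    by (simp add: theta_char_mult[OF \<tau>2])
qed

text \<open>With \<open>theta_product\<close> this becomes a Pluecker relation between \<open>2 \<times> 2\<close> minors.\<close>

lemma theta_three_term:
  assumes "Im \<tau> > 0"
  shows "theta \<tau> (x + z) * theta \<tau> (x - z) * (theta \<tau> (y + w) * theta \<tau> (y - w))
       - theta \<tau> (x + w) * theta \<tau> (x - w) * (theta \<tau> (y + z) * theta \<tau> (y - z))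
       = theta \<tau> (x + y) * theta \<tau> (x - y) * (theta \<tau> (z + w) * theta \<tau> (z - w))"
  unfolding theta_product[OF assms] by algebra

text \<open>The three-term relation in coordinates without halves, so that the arguments of the
  weights can be substituted directly. The half-sum \<open>s\<close> and half-difference
  \<open>t\<close> of c and d lead back to x = a + b + s, z = s, y = b + s, w = t.\<close>

lemma theta_fay:
  assumes "Im \<tau> > 0"
  shows "theta \<tau> (a + b + c + d) * theta \<tau> (a + b) * (theta \<tau> (b + c) * theta \<tau> (b + d))
       - theta \<tau> (a + b + d) * theta \<tau> (a + b + c) * (theta \<tau> (b + c + d) * theta \<tau> b)
       = theta \<tau> (a + 2 * b + c + d) * theta \<tau> a * (theta \<tau> c * theta \<tau> d)"
proof -
  define s t where "s = (c + d) / 2" and "t = (d - c) / 2"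
  have cd: "c = s - t" "d = s + t" by (simp_all add: s_def t_def field_simps)
  show ?thesis
    unfolding cd using theta_three_term[OF assms, of "a + b + s" s "b + s" t]
    by (simp add: algebra_simps)
qed

section \<open>The weights and the dynamical Yang--Baxter equation\<close>

context
  fixes \<tau> \<gamma> :: complex
  assumes \<tau>: "Im \<tau> > 0"
begin

private abbreviation (input) "th \<equiv> theta \<tau>"
private abbreviation (input) "A \<equiv> alpha \<tau> \<gamma>"
private abbreviation (input) "B \<equiv> beta \<tau> \<gamma>"

section \<open>Specialisations of Fay's identity\<close>

lemma theta_relation_1: "th (v - \<gamma>) * th (z + v) * th (z - m - \<gamma>) * th m
  = th (z - m) * th v * th (z + v - \<gamma>) * th (m + \<gamma>) - th z * th (v + m) * th (z + v - m - \<gamma>) * th \<gamma>"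
  using theta_fay[OF \<tau>, of "-\<gamma>" "-m" z "v + m"] theta_minus[of \<tau> "m + \<gamma>"]
  by (simp add: algebra_simps theta_minus)

lemma theta_relation_2: "th (z - \<gamma>) * th (v - \<gamma>) * th (z + v - m) * th m
  = th z * th v * th (m - \<gamma>) * th (z + v - m - \<gamma>) + th (z - m) * th (v - m) * th (z + v - \<gamma>) * th \<gamma>"
  using theta_fay[OF \<tau>, of v "-\<gamma>" z "\<gamma> - m"] theta_minus[of \<tau> "m - \<gamma>"]
  by (simp add: algebra_simps theta_minus)

lemma theta_relation_3: "th (v + m) * th (z + v) * th (z - \<gamma>) * th (m + \<gamma>)
  = th v * th (z - m - \<gamma>) * th (z + v + m) * th \<gamma> + th z * th (z + v - \<gamma>) * th (v + m + \<gamma>) * th m"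
  using theta_fay[OF \<tau>, of \<gamma> m v "z - m - \<gamma>"]
  by (simp add: algebra_simps theta_minus)

lemma theta_relation_4: "th (v + m) * th (z + v - m - \<gamma>) * th (z + m) * th (m + \<gamma>)
  + th (z - m - \<gamma>) * th (z + v + m) * th (v - m - \<gamma>) * th m = th z * th v * th (z + v - \<gamma>) * th (2 * m + \<gamma>)"
  using theta_fay[OF \<tau>, of z m v "- (2 * m + \<gamma>)"] theta_minus[of \<tau> "m + \<gamma>"] theta_minus[of \<tau> "2 * m + \<gamma>"]
  by (simp add: algebra_simps theta_minus)

text \<open>The three-term relation with w = 0. It contains no spectral parameter and serves to
  compare products of two \<open>alpha\<close> at adjacent dynamical arguments.\<close>

lemma theta_relation_5: "th (m + 2 * \<gamma>) * th m ^ 3 - th (m + \<gamma>) ^ 3 * th (m - \<gamma>) = th (2 * m + \<gamma>) * th \<gamma> ^ 3"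
  using theta_three_term[OF \<tau>, of "m + \<gamma>" \<gamma> m 0]
  by (simp add: algebra_simps theta_minus power3_eq_cube)

lemma theta_relation_6: "th z * th (z + v + p) * th (v + q) * th (p + q) - th (z + v) * th (z + p) * th (v + p + q) * th q
   = th v * th (z - q) * th (z + v + p + q) * th p"
  using theta_fay[OF \<tau>, of v q p "z - q"]
  by (simp add: algebra_simps theta_minus)

lemma theta_relation_7: "th v * th (z + p) * th (z + v + q) * th (p + q) - th (z + v) * th (z + p + q) * th (v + q) * th p
   = th z * th (z + v + p + q) * th (v - p) * th q"
  using theta_fay[OF \<tau>, of z p q "v - p"]
  by (simp add: algebra_simps theta_minus)

lemma theta_relation_8: "th (v + q) * th (z + v + p) * th (z + q) * th p - th (z + p) * th (z + v + q) * th (v + p) * th q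
  = th z * th v * th (z + v + p + q) * th (p - q)"
  using theta_fay[OF \<tau>, of z q v "p - q"]
  by (simp add: algebra_simps theta_minus)

lemma theta_relation_9: "th (p + \<gamma>) * th (p - \<gamma>) * th q ^ 2 - th (q + \<gamma>) * th (q - \<gamma>) * th p ^ 2
  = th (p + q) * th (p - q) * th \<gamma> ^ 2"
  using theta_three_term[OF \<tau>, of p \<gamma> q 0]
  by (simp add: algebra_simps theta_minus power2_eq_square)

section \<open>Quadratic and cubic relations between the weights\<close>

lemma alpha_beta_relation_1:
  assumes "th p \<noteq> 0" "th q \<noteq> 0" "th (p + q) \<noteq> 0"
  shows "A (z + v) (- q) * (B z p * B v (p + q)) = A z (- q) * (B (z + v) p * B v q) + A v (- q) * (B z (- q) * B (z + v) (p + q))"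
proof -
  have m: "th (- q + \<gamma>) = - th (q - \<gamma>)" "th (- q) = - th q" using theta_minus[of \<tau> "q - \<gamma>"] theta_minus[of \<tau> q] by simp_all
  \<comment> \<open>Over a common denominator the difference of the two sides is an explicit factor
    times a theta relation; all relations below are obtained in this way from one or two theta
    relations. The letters stand for z = z1 - z2, v = z2 - z3 and for the differences p, q of the
    dynamical variable between consecutive members of three distinct colours.\<close>
  have "A (z + v) (- q) * (B z p * B v (p + q)) - (A z (- q) * (B (z + v) p * B v q) + A v (- q) * (B z (- q) * B (z + v) (p + q)))
    = - (th z * th (z + v + p) * th (v + q) * th (p + q) - th (z + v) * th (z + p) * th (v + p + q) * th q
     - th v * th (z - q) * th (z + v + p + q) * th p) * (th (q - \<gamma>) * th \<gamma>^2 / (th p * th q^2 * th (p + q)))"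
    unfolding alpha_def beta_def m using assms
    by (simp add: field_simps power2_eq_square)
  then show ?thesis by (simp add: theta_relation_6)
qed

lemma alpha_beta_relation_2:
  assumes "th p \<noteq> 0" "th q \<noteq> 0" "th (p + q) \<noteq> 0"
  shows "A z (- p) * (B (z + v) (p + q) * B v (- p)) + A v (- p) * (B z p * B (z + v) q) = A (z + v) (- p) * (B z (p + q) * B v q)"
proof -
  have m: "th (- p + \<gamma>) = - th (p - \<gamma>)" "th (- p) = - th p" using theta_minus[of \<tau> "p - \<gamma>"] theta_minus[of \<tau> p] by simp_all
  have "A z (- p) * (B (z + v) (p + q) * B v (- p)) + A v (- p) * (B z p * B (z + v) q) - A (z + v) (- p) * (B z (p + q) * B v q)
    = (th v * th (z + p) * th (z + v + q) * th (p + q) - th (z + v) * th (z + p + q) * th (v + q) * th p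
   - th z * th (z + v + p + q) * th (v - p) * th q) * (th (p - \<gamma>) * th \<gamma>^2 / (th p^2 * th q * th (p + q)))"
    unfolding alpha_def beta_def m using assms
    by (simp add: field_simps power2_eq_square)
  then show ?thesis by (simp add: theta_relation_7)
qed

text \<open>The two products of a pair of \<open>alpha\<close> share their spectral part, and the
  difference of their dynamical parts is evaluated by \<open>theta_relation_9\<close>. What remains
  are the triple products of \<open>beta\<close>, compared by
  \<open>theta_relation_8\<close>.\<close>

lemma alpha_beta_relation_3:
  assumes "th p \<noteq> 0" "th q \<noteq> 0" "th (p + q) \<noteq> 0"
  shows "A z (- p) * (A v p * B (z + v) (p + q)) + B z p * (B (z + v) q * B v p)
    = A z q * (A v (- q) * B (z + v) (p + q)) + B z q * (B (z + v) p * B v q)"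
proof -
  have m: "th (- p + \<gamma>) = - th (p - \<gamma>)" "th (- p) = - th p" "th (- q + \<gamma>) = - th (q - \<gamma>)" "th (- q) = - th q"
    using theta_minus[of \<tau> "p - \<gamma>"] theta_minus[of \<tau> "q - \<gamma>"] by (simp_all add: theta_minus)
  have "A z (- p) * (A v p * B (z + v) (p + q)) + B z p * (B (z + v) q * B v p)
    - (A z q * (A v (- q) * B (z + v) (p + q)) + B z q * (B (z + v) p * B v q))
   = (th (v + q) * th (z + v + p) * th (z + q) * th p - th (z + p) * th (z + v + q) * th (v + p) * th q
  - th z * th v * th (z + v + p + q) * th (p - q)) * (th \<gamma>^3 / (th p^2 * th q^2))
   - (th (p + \<gamma>) * th (p - \<gamma>) * th q ^ 2 - th (q + \<gamma>) * th (q - \<gamma>) * th p ^ 2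
  - th (p + q) * th (p - q) * th \<gamma> ^ 2) * (th z * th v * th (z + v + p + q) * th \<gamma> / (th (p + q) * th p^2 * th q^2))"
    unfolding alpha_def beta_def m using assms
    by (simp add: field_simps power2_eq_square power3_eq_cube)
  then show ?thesis by (simp add: theta_relation_8 theta_relation_9)
qed

text \<open>In the remaining identities two of the three colours agree.\<close>

lemma alpha_beta_relation_4:
  assumes "th m \<noteq> 0" "th (m + \<gamma>) \<noteq> 0"
  shows "th (z - \<gamma>) * (B v (- (m + \<gamma>)) * A (z + v) m) =
     A v m * (B (z + v) (- (m + \<gamma>)) * B z m) + B v (- m) * (th (z + v - \<gamma>) * A z m)"
proof -
  have m: "th (v + - (m + \<gamma>)) = th (v - m - \<gamma>)" "th (z + v + - (m + \<gamma>)) = th (z + v - m - \<gamma>)" "th (-(m + \<gamma>)) = - th (m + \<gamma>)" "th (- m) = - th m"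
    using theta_minus[of \<tau> "m + \<gamma>"] theta_minus[of \<tau> m] by (simp_all add: algebra_simps)
  have "th (z - \<gamma>) * (B v (- (m + \<gamma>)) * A (z + v) m) -
     (A v m * (B (z + v) (- (m + \<gamma>)) * B z m) + B v (- m) * (th (z + v - \<gamma>) * A z m))
    = (th (z - \<gamma>) * th (v + z) * th (v - m - \<gamma>) * th m
  - (th (v - m) * th z * th (v + z - \<gamma>) * th (m + \<gamma>) - th v * th (z + m) * th (v + z - m - \<gamma>) * th \<gamma>)) * (th \<gamma> / th m^2)"
    unfolding alpha_def beta_def m using assms
    by (simp add: field_simps power2_eq_square power3_eq_cube)
  then show ?thesis by (simp add: theta_relation_1)
qed

lemma alpha_beta_relation_5:
  assumes "th m \<noteq> 0" "th (m + \<gamma>) \<noteq> 0"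
  shows "th (z - \<gamma>) * (th (v - \<gamma>) * B (z + v) (- m)) =
     A v m * (B (z + v) (- (m + \<gamma>)) * A z (- m)) + B v (- m) * (th (z + v - \<gamma>) * B z (- m))"
proof -
  have m: "th (z + v + - (m + \<gamma>)) = th (z + v - m - \<gamma>)" "th (-(m + \<gamma>)) = - th (m + \<gamma>)" "th (- m) = - th m"
     "th (- m + \<gamma>) = - th (m - \<gamma>)"
    using theta_minus[of \<tau> "m + \<gamma>"] theta_minus[of \<tau> m] theta_minus[of \<tau> "m - \<gamma>"] by (simp_all add: algebra_simps)
  have "th (z - \<gamma>) * (th (v - \<gamma>) * B (z + v) (- m)) -
     (A v m * (B (z + v) (- (m + \<gamma>)) * A z (- m)) + B v (- m) * (th (z + v - \<gamma>) * B z (- m)))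
    = (th (z - \<gamma>) * th (v - \<gamma>) * th (z + v - m) * th m
  - (th z * th v * th (m - \<gamma>) * th (z + v - m - \<gamma>) + th (z - m) * th (v - m) * th (z + v - \<gamma>) * th \<gamma>)) * (th \<gamma> / th m^2)"
    unfolding alpha_def beta_def m using assms
    by (simp add: field_simps power2_eq_square power3_eq_cube)
  then show ?thesis by (simp add: theta_relation_2)
qed

lemma alpha_beta_relation_6:
  assumes "th m \<noteq> 0" "th (m + \<gamma>) \<noteq> 0"
  shows "A v (m + \<gamma>) * (B z (- (m + \<gamma>)) * B (z + v) m) + A z (m + \<gamma>) * (B v (m + \<gamma>) * th (z + v - \<gamma>))
    = B v m * (A (z + v) (m + \<gamma>) * th (z - \<gamma>))"
proof -
  have m: "th (z + - (m + \<gamma>)) = th (z - m - \<gamma>)" "th (-(m + \<gamma>)) = - th (m + \<gamma>)" "th (v + (m + \<gamma>)) = th (v + m + \<gamma>)"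
    using theta_minus[of \<tau> "m + \<gamma>"] by (simp_all add: algebra_simps)
  have "A v (m + \<gamma>) * (B z (- (m + \<gamma>)) * B (z + v) m) + A z (m + \<gamma>) * (B v (m + \<gamma>) * th (z + v - \<gamma>))
    - B v m * (A (z + v) (m + \<gamma>) * th (z - \<gamma>))
   = (th (v + m) * th (z + v) * th (z - \<gamma>) * th (m + \<gamma>)
  - (th v * th (z - m - \<gamma>) * th (z + v + m) * th \<gamma> + th z * th (z + v - \<gamma>) * th (v + m + \<gamma>) * th m))
   * (th \<gamma> * th (m + \<gamma> + \<gamma>) / (th m * th (m + \<gamma>)^2))"
    unfolding alpha_def beta_def m using assms
    by (simp add: field_simps power2_eq_square power3_eq_cube)
  then show ?thesis by (simp add: theta_relation_3)
qed

lemma alpha_beta_relation_7: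
  assumes "th m \<noteq> 0" "th (m + \<gamma>) \<noteq> 0"
  shows "th (v - \<gamma>) * (B z (- (m + \<gamma>)) * A (z + v) (- m)) =
    B v m * (B (z + v) (- (m + \<gamma>)) * A z (- m)) + A v (- m) * (B z (- m) * th (z + v - \<gamma>))"
proof -
  have m: "th (z + - (m + \<gamma>)) = th (z - m - \<gamma>)" "th (z + v + - (m + \<gamma>)) = th (z + v - m - \<gamma>)" "th (-(m + \<gamma>)) = - th (m + \<gamma>)" "th (- m) = - th m"
     "th (- m + \<gamma>) = - th (m - \<gamma>)"
    using theta_minus[of \<tau> "m + \<gamma>"] theta_minus[of \<tau> m] theta_minus[of \<tau> "m - \<gamma>"] by (simp_all add: algebra_simps)
  have "th (v - \<gamma>) * (B z (- (m + \<gamma>)) * A (z + v) (- m)) -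
    (B v m * (B (z + v) (- (m + \<gamma>)) * A z (- m)) + A v (- m) * (B z (- m) * th (z + v - \<gamma>)))
    = (th (v - \<gamma>) * th (z + v) * th (z - m - \<gamma>) * th m
  - (th (z - m) * th v * th (z + v - \<gamma>) * th (m + \<gamma>) - th z * th (v + m) * th (z + v - m - \<gamma>) * th \<gamma>)) * (th \<gamma> * th (m - \<gamma>) / (th m^2 * th (m + \<gamma>)))"
    unfolding alpha_def beta_def m using assms
    by (simp add: field_simps power2_eq_square power3_eq_cube)
  then show ?thesis by (simp add: theta_relation_1)
qed

text \<open>As in \<open>alpha_beta_relation_3\<close>, the products of two \<open>alpha\<close> are
  first compared by an identity in the dynamical variable alone, here
  \<open>theta_relation_5\<close>; \<open>theta_relation_4\<close> accounts for the products of
  three \<open>beta\<close>.\<close>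

lemma alpha_beta_relation_8:
  assumes "th m \<noteq> 0" "th (m + \<gamma>) \<noteq> 0"
  shows "B z (- (m + \<gamma>)) * (B v (- (m + \<gamma>)) * B (z + v) m) + A z (m + \<gamma>) * (A v (- (m + \<gamma>)) * th (z + v - \<gamma>))
   = B v m * (B (z + v) (- (m + \<gamma>)) * B z m) + A v (- m) * (A z m * th (z + v - \<gamma>))"
proof -
  have m: "th (z + - (m + \<gamma>)) = th (z - m - \<gamma>)" "th (v + - (m + \<gamma>)) = th (v - m - \<gamma>)"  "th (z + v + - (m + \<gamma>)) = th (z + v - m - \<gamma>)" "th (-(m + \<gamma>)) = - th (m + \<gamma>)" "th (- m) = - th m"
     "th (- m + \<gamma>) = - th (m - \<gamma>)" "th (- (m + \<gamma>) + \<gamma>) = - th m" "th (m + \<gamma> + \<gamma>) = th (m + 2 * \<gamma>)"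
    using theta_minus[of \<tau> "m + \<gamma>"] theta_minus[of \<tau> m] theta_minus[of \<tau> "m - \<gamma>"] by (simp_all add: algebra_simps)
  have "B z (- (m + \<gamma>)) * (B v (- (m + \<gamma>)) * B (z + v) m) + A z (m + \<gamma>) * (A v (- (m + \<gamma>)) * th (z + v - \<gamma>))
   - (B v m * (B (z + v) (- (m + \<gamma>)) * B z m) + A v (- m) * (A z m * th (z + v - \<gamma>)))
    = (th (m + 2 * \<gamma>) * th m ^ 3 - th (m + \<gamma>) ^ 3 * th (m - \<gamma>) - th (2 * m + \<gamma>) * th \<gamma> ^ 3)
       * (th z * th v * th (z + v - \<gamma>) / (th m^2 * th (m + \<gamma>)^2))
     - (th (v + m) * th (z + v - m - \<gamma>) * th (z + m) * th (m + \<gamma>)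
  + th (z - m - \<gamma>) * th (z + v + m) * th (v - m - \<gamma>) * th m - th z * th v * th (z + v - \<gamma>) * th (2 * m + \<gamma>))
     * (th \<gamma>^3 / (th m^2 * th (m + \<gamma>)^2))"
    unfolding alpha_def beta_def m using assms
    by (simp add: field_simps power2_eq_square power3_eq_cube)
  then show ?thesis by (simp add: theta_relation_4 theta_relation_5)
qed

lemma alpha_beta_relation_9:
  assumes "th m \<noteq> 0" "th (m + \<gamma>) \<noteq> 0"
  shows "A z m * (B v m * B (z + v) (- (m + \<gamma>))) + B z (- m) * (A v m * th (z + v - \<gamma>)) = th (v - \<gamma>) * (A (z + v) m * B z (- (m + \<gamma>)))"
proof -
  have m: "th (z + - (m + \<gamma>)) = th (z - m - \<gamma>)" "th (z + v + - (m + \<gamma>)) = th (z + v - m - \<gamma>)" "th (-(m + \<gamma>)) = - th (m + \<gamma>)" "th (- m) = - th m"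
    using theta_minus[of \<tau> "m + \<gamma>"] theta_minus[of \<tau> m] by (simp_all add: algebra_simps)
  have "A z m * (B v m * B (z + v) (- (m + \<gamma>))) + B z (- m) * (A v m * th (z + v - \<gamma>)) - th (v - \<gamma>) * (A (z + v) m * B z (- (m + \<gamma>)))
    = - (th (v - \<gamma>) * th (z + v) * th (z - m - \<gamma>) * th m
  - (th (z - m) * th v * th (z + v - \<gamma>) * th (m + \<gamma>) - th z * th (v + m) * th (z + v - m - \<gamma>) * th \<gamma>)) * (th \<gamma> / th m^2)"
    unfolding alpha_def beta_def m using assms
    by (simp add: field_simps power2_eq_square power3_eq_cube)
  then show ?thesis by (simp add: theta_relation_1)
qed

lemma alpha_beta_relation_10:
  assumes "th m \<noteq> 0" "th (m + \<gamma>) \<noteq> 0"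
  shows "A z m * (A v (- m) * B (z + v) (- (m + \<gamma>))) + B z (- m) * (B v (- m) * th (z + v - \<gamma>)) = th (z - \<gamma>) * (th (v - \<gamma>) * B (z + v) (- m))"
proof -
  have m: "th (z + v + - (m + \<gamma>)) = th (z + v - m - \<gamma>)" "th (-(m + \<gamma>)) = - th (m + \<gamma>)" "th (- m) = - th m" "th (- m + \<gamma>) = - th (m - \<gamma>)"
    using theta_minus[of \<tau> "m + \<gamma>"] theta_minus[of \<tau> m] theta_minus[of \<tau> "m - \<gamma>"] by (simp_all add: algebra_simps)
  have "A z m * (A v (- m) * B (z + v) (- (m + \<gamma>))) + B z (- m) * (B v (- m) * th (z + v - \<gamma>)) - th (z - \<gamma>) * (th (v - \<gamma>) * B (z + v) (- m))
    = - (th (z - \<gamma>) * th (v - \<gamma>) * th (z + v - m) * th m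
  - (th z * th v * th (m - \<gamma>) * th (z + v - m - \<gamma>) + th (z - m) * th (v - m) * th (z + v - \<gamma>) * th \<gamma>)) * (th \<gamma> / th m^2)"
    unfolding alpha_def beta_def m using assms
    by (simp add: field_simps power2_eq_square power3_eq_cube)
  then show ?thesis by (simp add: theta_relation_2)
qed

end

section \<open>Evaluation of vertex sums and shifts of the dynamical parameter\<close>

definition colours :: "nat \<Rightarrow> nat set" where
  "colours M = {1..M + 1}"

lemma finite_colours [simp]: "finite (colours M)"
  by (simp add: colours_def)

text \<open>Only the multiset of the word enters. Together with conservation of colour this makes
  the parameter at a corner independent of the path by which the corner is reached.\<close>

definition dyn_shift :: "complex \<Rightarrow> (nat \<Rightarrow> complex) \<Rightarrow> nat list \<Rightarrow> nat \<Rightarrow> complex" where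
  "dyn_shift \<gamma> \<Lambda> xs a = \<Lambda> a - \<gamma> * of_nat (count (mset xs) a)"

text \<open>By the ice rule the right and top colours are the left and bottom ones in one of two
  orders, so at most two terms survive. This lemma and the next two evaluate the sums in the
  Yang--Baxter equation without expanding them over all colours.\<close>

lemma sum_weight_out:
  assumes "finite C" "a \<in> C" "b \<in> C"
  shows "(\<Sum>x\<in>C. \<Sum>y\<in>C. weight \<tau> \<gamma> z w \<Lambda> a b y x * F x y) =
    (if a = b then theta \<tau> (z - w - \<gamma>) * F a a
     else alpha \<tau> \<gamma> (z - w) (\<Lambda> a - \<Lambda> b) * F b a + beta \<tau> \<gamma> (z - w) (\<Lambda> b - \<Lambda> a) * F a b)"
proof (cases "a = b")
  case True
  then have "weight \<tau> \<gamma> z w \<Lambda> a b y x * F x y =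
      (if y = a then if x = a then theta \<tau> (z - w - \<gamma>) * F a a else 0 else 0)" for x y
    by (auto simp: weight_def)
  with True assms show ?thesis by (simp add: sum.delta)
next
  case False
  then have "weight \<tau> \<gamma> z w \<Lambda> a b y x * F x y =
      (if y = a then if x = b then alpha \<tau> \<gamma> (z - w) (\<Lambda> a - \<Lambda> b) * F b a else 0 else 0) +
      (if y = b then if x = a then beta \<tau> \<gamma> (z - w) (\<Lambda> b - \<Lambda> a) * F a b else 0 else 0)" for x y
    by (auto simp: weight_def)
  with False assms show ?thesis by (simp add: sum.distrib sum.delta)
qed

lemma sum_weight_top:
  assumes "finite C" "a \<in> C" "b \<in> C"
  shows "(\<Sum>x\<in>C. weight \<tau> \<gamma> z w \<Lambda> a b c x * F x) =
    (if a = b then if c = a then theta \<tau> (z - w - \<gamma>) * F a else 0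
     else if c = a then alpha \<tau> \<gamma> (z - w) (\<Lambda> a - \<Lambda> b) * F b
     else if c = b then beta \<tau> \<gamma> (z - w) (\<Lambda> b - \<Lambda> a) * F a else 0)"
proof -
  have "weight \<tau> \<gamma> z w \<Lambda> a b c x * F x =
     (if x = (if c = a then b else a) then
       (if a = b then if c = a then theta \<tau> (z - w - \<gamma>) * F a else 0
        else if c = a then alpha \<tau> \<gamma> (z - w) (\<Lambda> a - \<Lambda> b) * F b
        else if c = b then beta \<tau> \<gamma> (z - w) (\<Lambda> b - \<Lambda> a) * F a else 0) else 0)" for x
    by (auto simp: weight_def)
  then show ?thesis using assms by (simp add: sum.delta)
qed

lemma sum_weight_right:
  assumes "finite C" "a \<in> C" "b \<in> C"
  shows "(\<Sum>x\<in>C. weight \<tau> \<gamma> z w \<Lambda> a b x e * F x) =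
    (if a = b then if e = a then theta \<tau> (z - w - \<gamma>) * F a else 0
     else if e = b then alpha \<tau> \<gamma> (z - w) (\<Lambda> a - \<Lambda> b) * F a
     else if e = a then beta \<tau> \<gamma> (z - w) (\<Lambda> b - \<Lambda> a) * F b else 0)"
proof -
  have "weight \<tau> \<gamma> z w \<Lambda> a b x e * F x =
     (if x = (if e = a then b else a) then
       (if a = b then if e = a then theta \<tau> (z - w - \<gamma>) * F a else 0
     else if e = b then alpha \<tau> \<gamma> (z - w) (\<Lambda> a - \<Lambda> b) * F a
     else if e = a then beta \<tau> \<gamma> (z - w) (\<Lambda> b - \<Lambda> a) * F b else 0) else 0)" for x
    by (auto simp: weight_def)
  then show ?thesis using assms by (simp add: sum.delta)
qed

lemma weight_nonzero:
  "weight \<tau> \<gamma> z w \<Lambda> a b c e \<noteq> 0 \<Longrightarrow> (c = a \<and> e = b) \<or> (c = b \<and> e = a)"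
  by (auto simp: weight_def split: if_splits)

lemma mset_pair_eq_iff: "{#q, r#} = {#j, k#} \<longleftrightarrow> q = j \<and> r = k \<or> q = k \<and> r = j"
  by (auto simp: add_eq_conv_ex)

lemma mset_triple_cases:
  assumes "{#p, q, r#} = {#i, j, k#}"
  obtains "p = i" "q = j" "r = k" | "p = i" "q = k" "r = j" | "p = j" "q = i" "r = k"
    | "p = j" "q = k" "r = i" | "p = k" "q = i" "r = j" | "p = k" "q = j" "r = i"
proof -
  have "p \<in># {#i, j, k#}" by (simp flip: assms)
  then consider "p = i" | "p = j" | "p = k" by auto
  then show thesis
    by cases (use assms that in \<open>auto simp: mset_pair_eq_iff add_mset_commute[of k] add_mset_commute[of i j]\<close>)
qed

text \<open>Three lines cross pairwise, and the line of \<open>z3\<close> may pass on either side of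
  the crossing of the other two. By conservation of colour both sides vanish unless the outgoing
  colours permute i, j, k. Otherwise the ice rule leaves at most two terms on each side, and the
  pattern of coincidences among i, j, k decides which relation between the weights applies.\<close>

lemma dynamical_yang_baxter:
  assumes "Im \<tau> > 0" and "generic \<tau> \<gamma> M \<Lambda>"
    and "i \<in> colours M" "j \<in> colours M" "k \<in> colours M"
  shows
    "(\<Sum>x\<in>colours M. \<Sum>y\<in>colours M. weight \<tau> \<gamma> z1 z2 \<Lambda> i j y x *
       (\<Sum>m\<in>colours M. weight \<tau> \<gamma> z1 z3 (dyn_shift \<gamma> \<Lambda> [x]) y k c2 m * weight \<tau> \<gamma> z2 z3 \<Lambda> x m c1 e)) =
     (\<Sum>m\<in>colours M. \<Sum>y\<in>colours M. weight \<tau> \<gamma> z2 z3 (dyn_shift \<gamma> \<Lambda> [i]) j k y m *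
       (\<Sum>x\<in>colours M. weight \<tau> \<gamma> z1 z3 \<Lambda> i m x e * weight \<tau> \<gamma> z1 z2 (dyn_shift \<gamma> \<Lambda> [e]) x y c2 c1))"
    (is "?L = ?R")
proof (cases "{#c2, c1, e#} = {#i, j, k#}")
  case False
  have "weight \<tau> \<gamma> z1 z2 \<Lambda> i j y x * (weight \<tau> \<gamma> z1 z3 (dyn_shift \<gamma> \<Lambda> [x]) y k c2 m * weight \<tau> \<gamma> z2 z3 \<Lambda> x m c1 e) = 0"
    (is "?a * (?b * ?c) = 0") for x y m
  proof (rule ccontr)
    assume "\<not> ?thesis"
    then have "?a \<noteq> 0" "?b \<noteq> 0" "?c \<noteq> 0" by auto
    from this[THEN weight_nonzero] show False
      using False by (auto simp: add_mset_commute)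
  qed
  moreover have "weight \<tau> \<gamma> z2 z3 (dyn_shift \<gamma> \<Lambda> [i]) j k y m * (weight \<tau> \<gamma> z1 z3 \<Lambda> i m x e * weight \<tau> \<gamma> z1 z2 (dyn_shift \<gamma> \<Lambda> [e]) x y c2 c1) = 0"
    (is "?a * (?b * ?c) = 0") for x y m
  proof (rule ccontr)
    assume "\<not> ?thesis"
    then have "?a \<noteq> 0" "?b \<noteq> 0" "?c \<noteq> 0" by auto
    from this[THEN weight_nonzero] show False
      using False by (auto simp: add_mset_commute)
  qed
  ultimately show ?thesis by (simp only: sum_distrib_left sum.neutral_const)
next
  case True
  have C: "finite (colours M)" by simp
  have nz: "theta \<tau> (\<Lambda> a - \<Lambda> b) \<noteq> 0" "theta \<tau> (\<Lambda> a - \<Lambda> b - \<gamma>) \<noteq> 0" "theta \<tau> (\<Lambda> a - \<Lambda> b + \<gamma>) \<noteq> 0"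
    if "a \<noteq> b" "a \<in> colours M" "b \<in> colours M" for a b
  proof -
    have "theta \<tau> (\<Lambda> a - \<Lambda> b + of_int n * \<gamma>) \<noteq> 0" for n
      using assms(2) that by (simp add: generic_def colours_def)
    from this[of 0] this[of "-1"] this[of 1]
    show "theta \<tau> (\<Lambda> a - \<Lambda> b) \<noteq> 0" "theta \<tau> (\<Lambda> a - \<Lambda> b - \<gamma>) \<noteq> 0" "theta \<tau> (\<Lambda> a - \<Lambda> b + \<gamma>) \<noteq> 0"
      by simp_all
  qed
  let ?z = "z1 - z2" and ?v = "z2 - z3"
  note out = sum_weight_out[OF C] and top = sum_weight_top[OF C] and right = sum_weight_right[OF C]
  show ?thesis
  proof (cases "i = j"; cases "j = k"; cases "i = k")
    assume A: "i = j" "j \<noteq> k" "i \<noteq> k"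
    \<comment> \<open>When two colours agree, the dynamical differences in the relation take two
      adjacent values m and m + \<gamma>. Here the lower one is the difference after a shift by the
      repeated colour.\<close>
    define m where "m = \<Lambda> j - \<Lambda> k - \<gamma>"
    have Lk: "\<Lambda> k = \<Lambda> j - (m + \<gamma>)" by (simp add: m_def)
    have m: "theta \<tau> m \<noteq> 0" "theta \<tau> (m + \<gamma>) \<noteq> 0"
      using nz[of j k] A assms(3-5) by (simp_all add: m_def)
    note Y = alpha_beta_relation_4[OF assms(1) m, where z = ?z and v = ?v] alpha_beta_relation_5[OF assms(1) m, where z = ?z and v = ?v]
    show ?thesis
      unfolding out[OF assms(3,4)] out[OF assms(4,5)] using True
    proof (rule mset_triple_cases)
    qed (use A assms(3-5) Y in \<open>simp_all add: top right, simp_all add: top right weight_def dyn_shift_def Lk alpha_def mult_ac add_ac\<close>)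
  next
    assume A: "i \<noteq> j" "j \<noteq> k" "i = k"
    define m where "m = \<Lambda> k - \<Lambda> j - \<gamma>"
    have Lk: "\<Lambda> k = \<Lambda> j + (m + \<gamma>)" by (simp add: m_def)
    have m: "theta \<tau> m \<noteq> 0" "theta \<tau> (m + \<gamma>) \<noteq> 0"
      using nz[of k j] A assms(3-5) by (simp_all add: m_def)
    note Y = alpha_beta_relation_8[OF assms(1) m, where z = ?z and v = ?v] alpha_beta_relation_6[OF assms(1) m, where z = ?z and v = ?v] alpha_beta_relation_7[OF assms(1) m, where z = ?z and v = ?v]
    show ?thesis
      unfolding out[OF assms(3,4)] out[OF assms(4,5)] using True
    proof (rule mset_triple_cases)
    qed (use A assms(3-5) Y in \<open>simp_all add: top right, simp_all add: top right weight_def dyn_shift_def Lk mult_ac add_ac\<close>)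
  next
    assume A: "i \<noteq> j" "j = k" "i \<noteq> k"
    define m where "m = \<Lambda> i - \<Lambda> k"
    have Li: "\<Lambda> i = \<Lambda> k + m" by (simp add: m_def)
    have m: "theta \<tau> m \<noteq> 0" "theta \<tau> (m + \<gamma>) \<noteq> 0"
      using nz[of i k] A assms(3-5) by (simp_all add: m_def)
    note Y = alpha_beta_relation_9[OF assms(1) m, where z = ?z and v = ?v] alpha_beta_relation_10[OF assms(1) m, where z = ?z and v = ?v]
    show ?thesis
      unfolding out[OF assms(3,4)] out[OF assms(4,5)] using True
    proof (rule mset_triple_cases)
    qed (use A assms(3-5) Y in \<open>simp_all add: top right, simp_all add: top right weight_def dyn_shift_def Li alpha_def mult_ac add_ac\<close>)
  next
    assume A: "i \<noteq> j" "j \<noteq> k" "i \<noteq> k"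
    define p q where "p = \<Lambda> j - \<Lambda> i" and "q = \<Lambda> k - \<Lambda> j"
    have L: "\<Lambda> j = \<Lambda> i + p" "\<Lambda> k = \<Lambda> i + p + q" by (simp_all add: p_def q_def)
    have m: "theta \<tau> p \<noteq> 0" "theta \<tau> q \<noteq> 0" "theta \<tau> (p + q) \<noteq> 0"
      using nz[of j i] nz[of k j] nz[of k i] A assms(3-5) by (simp_all add: p_def q_def)
    note Y = alpha_beta_relation_1[OF assms(1) m, where \<gamma> = \<gamma> and z = ?z and v = ?v] alpha_beta_relation_2[OF assms(1) m, where \<gamma> = \<gamma> and z = ?z and v = ?v] alpha_beta_relation_3[OF assms(1) m, where \<gamma> = \<gamma> and z = ?z and v = ?v]
    show ?thesis
      unfolding out[OF assms(3,4)] out[OF assms(4,5)] using True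
    proof (rule mset_triple_cases)
    qed (use A assms(3-5) Y in \<open>simp_all add: top right, simp_all add: top right weight_def dyn_shift_def L alpha_def mult_ac add_ac\<close>)
  next
    assume A: "i = j" "j = k" "i = k"
    show ?thesis
      unfolding out[OF assms(3,4)] out[OF assms(4,5)] using True
    proof (rule mset_triple_cases)
    qed (use A assms(3-5) in \<open>simp_all add: top right, simp_all add: top right weight_def\<close>)
  qed simp_all
qed

lemma dyn_shift_Nil [simp]: "dyn_shift \<gamma> \<Lambda> [] = \<Lambda>"
  by (simp add: dyn_shift_def fun_eq_iff)

lemma dyn_shift_dyn_shift: "dyn_shift \<gamma> (dyn_shift \<gamma> \<Lambda> xs) ys = dyn_shift \<gamma> \<Lambda> (xs @ ys)"
  by (simp add: dyn_shift_def fun_eq_iff algebra_simps)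

lemma dyn_shift_cong: "mset xs = mset ys \<Longrightarrow> dyn_shift \<gamma> \<Lambda> xs = dyn_shift \<gamma> \<Lambda> ys"
  by (simp add: dyn_shift_def fun_eq_iff)

text \<open>Genericity excludes all integer multiples of \<gamma> at once, which is why it survives
  every shift met inside a grid.\<close>

lemma generic_integer_shift:
  assumes "generic \<tau> \<gamma> M \<Lambda>" and "\<And>a. a \<in> {1..M+1} \<Longrightarrow> \<Lambda>' a = \<Lambda> a + of_int (n a) * \<gamma>"
  shows "generic \<tau> \<gamma> M \<Lambda>'"
  unfolding generic_def
proof (intro ballI allI impI)
  fix i j and m :: int
  assume A: "i \<in> {1..M+1}" "j \<in> {1..M+1}" "i \<noteq> j"
  have "\<Lambda>' i - \<Lambda>' j + of_int m * \<gamma> = \<Lambda> i - \<Lambda> j + of_int (m + n i - n j) * \<gamma>"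
    using assms(2) A by (simp add: algebra_simps)
  then show "theta \<tau> (\<Lambda>' i - \<Lambda>' j + of_int m * \<gamma>) \<noteq> 0"
    using assms(1) A unfolding generic_def by metis
qed

lemma generic_dyn_shift:
  "generic \<tau> \<gamma> M \<Lambda> \<Longrightarrow> generic \<tau> \<gamma> M (dyn_shift \<gamma> \<Lambda> xs)"
  by (erule generic_integer_shift[where n = "\<lambda>a. - int (count (mset xs) a)"])
    (simp add: dyn_shift_def mult.commute)

section \<open>Sums over words of colours\<close>

definition words :: "nat \<Rightarrow> nat \<Rightarrow> nat list set" where
  "words M n = {xs. length xs = n \<and> set xs \<subseteq> colours M}"

lemma finite_words [simp]: "finite (words M n)"
  using finite_lists_length_eq[of "colours M" n] by (simp add: words_def conj_commute)

lemma words_0 [simp]: "words M 0 = {[]}"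
  by (auto simp: words_def)

lemma Cons_mem_words [simp]: "x # xs \<in> words M (Suc n) \<longleftrightarrow> x \<in> colours M \<and> xs \<in> words M n"
  by (auto simp: words_def)

lemma length_words: "xs \<in> words M n \<Longrightarrow> length xs = n"
  by (simp add: words_def)

lemma words_Suc: "words M (Suc n) = (\<lambda>(x, xs). x # xs) ` (colours M \<times> words M n)"
  by (auto simp: words_def length_Suc_conv image_iff)

lemma sum_words_Suc: "(\<Sum>xs\<in>words M (Suc n). f xs) = (\<Sum>x\<in>colours M. \<Sum>xs\<in>words M n. f (x # xs))"
proof -
  have "inj_on (\<lambda>(x, xs). x # xs) (colours M \<times> words M n)" by (auto simp: inj_on_def)
  then show ?thesis
    by (simp add: words_Suc sum.reindex sum.cartesian_product case_prod_unfold o_def)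
qed

lemma sum_words_append:
  "(\<Sum>xs\<in>words M (m + n). f xs) = (\<Sum>xs\<in>words M m. \<Sum>ys\<in>words M n. f (xs @ ys))"
  by (induction m arbitrary: f) (simp_all add: sum_words_Suc)

lemma words_2E:
  assumes "xs \<in> words M 2"
  obtains x y where "xs = [x, y]" "x \<in> colours M" "y \<in> colours M"
  using assms by (auto simp: words_def length_Suc_conv numeral_2_eq_2)

lemma sum_words_2: "(\<Sum>xs\<in>words M 2. f xs) = (\<Sum>x\<in>colours M. \<Sum>y\<in>colours M. f [x, y])"
  by (simp add: numeral_2_eq_2 sum_words_Suc)

lemma sum_swap4:
  "(\<Sum>a\<in>A. \<Sum>b\<in>B. \<Sum>c\<in>C. \<Sum>d\<in>D. f a b c d) = (\<Sum>c\<in>C. \<Sum>d\<in>D. \<Sum>a\<in>A. \<Sum>b\<in>B. f a b c d)"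
proof -
  have "(\<Sum>a\<in>A. \<Sum>b\<in>B. \<Sum>c\<in>C. \<Sum>d\<in>D. f a b c d) = (\<Sum>a\<in>A. \<Sum>c\<in>C. \<Sum>b\<in>B. \<Sum>d\<in>D. f a b c d)"
    by (intro sum.cong refl sum.swap)
  also have "\<dots> = (\<Sum>a\<in>A. \<Sum>c\<in>C. \<Sum>d\<in>D. \<Sum>b\<in>B. f a b c d)"
    by (intro sum.cong refl sum.swap)
  also have "\<dots> = (\<Sum>c\<in>C. \<Sum>a\<in>A. \<Sum>d\<in>D. \<Sum>b\<in>B. f a b c d)"
    by (rule sum.swap)
  also have "\<dots> = (\<Sum>c\<in>C. \<Sum>d\<in>D. \<Sum>a\<in>A. \<Sum>b\<in>B. f a b c d)"
    by (intro sum.cong refl sum.swap)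
  finally show ?thesis .
qed

section \<open>Grids and the exchange of their lines\<close>

locale vertex_model =
  fixes \<tau> \<gamma> :: complex
  assumes Im_tau: "Im \<tau> > 0"
begin

abbreviation (input) "sh \<equiv> dyn_shift \<gamma>"

text \<open>The one-row transfer matrix: \<open>a\<close> and \<open>c\<close> are the left and
  right colours, \<open>bs\<close> and \<open>es\<close> the bottom and top words. The parameter
  \<Lambda> belongs to the upper left corner and moves along the top edges, hence the shift by
  \<open>hd es\<close>. Recursion on the variables, with \<open>hd\<close> and \<open>tl\<close>,
  avoids side conditions on the lengths of the words.\<close>

primrec row :: "nat \<Rightarrow> complex \<Rightarrow> complex list \<Rightarrow> (nat \<Rightarrow> complex) \<Rightarrow> nat \<Rightarrow> nat list \<Rightarrow> nat \<Rightarrow> nat list \<Rightarrow> complex" where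
  "row M z [] \<Lambda> a bs c es = (if a = c then 1 else 0)"
| "row M z (w # ws) \<Lambda> a bs c es = (\<Sum>x\<in>colours M.
     weight \<tau> \<gamma> z w \<Lambda> a (hd bs) x (hd es) * row M z ws (sh \<Lambda> [hd es]) x (tl bs) c (tl es))"

text \<open>Rows are stacked from the top: \<open>us\<close> is the word just below the first row,
  and the corner of the next row is reached along the left edge, hence the shift by
  \<open>hd as\<close>.\<close>

primrec grid :: "nat \<Rightarrow> complex list \<Rightarrow> complex list \<Rightarrow> (nat \<Rightarrow> complex) \<Rightarrow> nat list \<Rightarrow> nat list \<Rightarrow> nat list \<Rightarrow> nat list \<Rightarrow> complex" where
  "grid M [] ws \<Lambda> as bs cs es = (if es = bs then 1 else 0)"
| "grid M (z # zs) ws \<Lambda> as bs cs es = (\<Sum>us\<in>words M (length ws).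
     row M z ws \<Lambda> (hd as) us (hd cs) es * grid M zs ws (sh \<Lambda> [hd as]) (tl as) bs (tl cs) us)"

text \<open>Conservation of colour, vertex by vertex: what enters on the left and from below leaves
  on the right and at the top. This freezes rows and identifies dynamical parameters that were
  computed along different paths.\<close>

lemma row_nonzero:
  assumes "row M z ws \<Lambda> a bs c es \<noteq> 0" "length bs = length ws" "length es = length ws"
  shows "add_mset a (mset bs) = add_mset c (mset es)"
  using assms
proof (induction ws arbitrary: \<Lambda> a bs es)
  case Nil
  then show ?case by (simp split: if_splits)
next
  case (Cons w ws)
  from Cons.prems obtain b bs' e es' where [simp]: "bs = b # bs'" "es = e # es'"
    by (metis length_Suc_conv list.size(4) add.commute plus_1_eq_Suc)
  from Cons.prems obtain x where "weight \<tau> \<gamma> z w \<Lambda> a b x e * row M z ws (sh \<Lambda> [e]) x bs' c es' \<noteq> 0"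
    by (auto elim: sum.not_neutral_contains_not_neutral)
  then have "weight \<tau> \<gamma> z w \<Lambda> a b x e \<noteq> 0" "row M z ws (sh \<Lambda> [e]) x bs' c es' \<noteq> 0" by auto
  then have "x = a \<and> e = b \<or> x = b \<and> e = a" "add_mset x (mset bs') = add_mset c (mset es')"
    using weight_nonzero Cons.IH[of _ x bs' es'] Cons.prems by auto
  then show ?case by (auto simp: add_mset_commute)
qed

lemma grid_nonzero:
  assumes "grid M zs ws \<Lambda> as bs cs es \<noteq> 0"
    and "length as = length zs" "length cs = length zs" "length bs = length ws" "length es = length ws"
  shows "mset as + mset bs = mset cs + mset es"
  using assms
proof (induction zs arbitrary: \<Lambda> as cs es)
  case Nil
  then show ?case by (simp split: if_splits)
next
  case (Cons z zs)
  from Cons.prems obtain a as' c cs' where [simp]: "as = a # as'" "cs = c # cs'"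
    by (metis length_Suc_conv list.size(4) add.commute plus_1_eq_Suc)
  from Cons.prems obtain us where us: "us \<in> words M (length ws)"
    "row M z ws \<Lambda> a us c es * grid M zs ws (sh \<Lambda> [a]) as' bs cs' us \<noteq> 0"
    by (auto elim: sum.not_neutral_contains_not_neutral)
  then have "add_mset a (mset us) = add_mset c (mset es)"
    using row_nonzero[of M z ws \<Lambda> a us c es] Cons.prems by (auto simp: words_def)
  moreover have "mset as' + mset bs = mset cs' + mset us"
    using us Cons.IH[of _ as' cs' us] Cons.prems by (auto simp: words_def)
  ultimately show ?case
    by simp
qed

section \<open>Cutting grids into blocks\<close>

lemma row_append:
  assumes "a \<in> colours M" "length bs1 = length ws1" "length es1 = length ws1"
  shows "row M z (ws1 @ ws2) \<Lambda> a (bs1 @ bs2) c (es1 @ es2) = (\<Sum>x\<in>colours M.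
     row M z ws1 \<Lambda> a bs1 x es1 * row M z ws2 (sh \<Lambda> es1) x bs2 c es2)"
  using assms
proof (induction ws1 arbitrary: \<Lambda> a bs1 es1)
  case Nil
  have "(if a = x then 1 else 0) * row M z ws2 \<Lambda> x bs2 c es2
      = (if x = a then row M z ws2 \<Lambda> a bs2 c es2 else 0)" for x by auto
  then show ?case using Nil by (simp add: sum.delta)
next
  case (Cons w ws1)
  from Cons.prems obtain b bs' e es' where [simp]: "bs1 = b # bs'" "es1 = e # es'"
    by (metis length_Suc_conv list.size(4) add.commute plus_1_eq_Suc)
  have "row M z ((w # ws1) @ ws2) \<Lambda> a (bs1 @ bs2) c (es1 @ es2)
    = (\<Sum>y\<in>colours M. weight \<tau> \<gamma> z w \<Lambda> a b y e * (\<Sum>x\<in>colours M.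
     row M z ws1 (sh \<Lambda> [e]) y bs' x es' * row M z ws2 (sh (sh \<Lambda> [e]) es') x bs2 c es2))"
    using Cons by simp
  also have "\<dots> = (\<Sum>x\<in>colours M. row M z (w # ws1) \<Lambda> a bs1 x es1 * row M z ws2 (sh \<Lambda> es1) x bs2 c es2)"
    unfolding sum_distrib_left row.simps sum_distrib_right
    by (subst sum.swap) (simp add: dyn_shift_dyn_shift mult.assoc)
  finally show ?case .
qed

lemma grid_append_rows:
  assumes "es \<in> words M (length ws)" "length as1 = length zs1" "length cs1 = length zs1"
  shows "grid M (zs1 @ zs2) ws \<Lambda> (as1 @ as2) bs (cs1 @ cs2) es = (\<Sum>us\<in>words M (length ws).
     grid M zs1 ws \<Lambda> as1 us cs1 es * grid M zs2 ws (sh \<Lambda> as1) as2 bs cs2 us)"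
  using assms
proof (induction zs1 arbitrary: \<Lambda> as1 cs1 es)
  case Nil
  have "(if es = us then 1 else 0) * grid M zs2 ws \<Lambda> as2 bs cs2 us
      = (if us = es then grid M zs2 ws \<Lambda> as2 bs cs2 es else 0)" for us by auto
  then show ?case using Nil by (simp add: sum.delta)
next
  case (Cons z zs1)
  from Cons.prems obtain a as' c cs' where [simp]: "as1 = a # as'" "cs1 = c # cs'"
    by (metis length_Suc_conv list.size(4) add.commute plus_1_eq_Suc)
  have "grid M ((z # zs1) @ zs2) ws \<Lambda> (as1 @ as2) bs (cs1 @ cs2) es
    = (\<Sum>vs\<in>words M (length ws). row M z ws \<Lambda> a vs c es * (\<Sum>us\<in>words M (length ws).
     grid M zs1 ws (sh \<Lambda> [a]) as' us cs' vs * grid M zs2 ws (sh (sh \<Lambda> [a]) as') as2 bs cs2 us))"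
    using Cons by simp
  also have "\<dots> = (\<Sum>us\<in>words M (length ws). grid M (z # zs1) ws \<Lambda> as1 us cs1 es * grid M zs2 ws (sh \<Lambda> as1) as2 bs cs2 us)"
    unfolding sum_distrib_left grid.simps sum_distrib_right
    by (subst sum.swap) (simp add: dyn_shift_dyn_shift mult.assoc)
  finally show ?case .
qed

text \<open>Below the first row the inner corner between the two blocks is reached along the left
  edge and the lower word \<open>u1\<close> in one description, and along the top word
  \<open>es1\<close> and the intermediate colour \<open>x\<close> in the other. Conservation of
  colour in the first block makes the two shifts equal whenever the term is nonzero.\<close>

lemma grid_append_cols:
  assumes "as \<in> words M (length zs)" "length cs = length zs"
    and "length bs1 = length ws1" "length es1 = length ws1" "length bs2 = length ws2" "length es2 = length ws2"
  shows "grid M zs (ws1 @ ws2) \<Lambda> as (bs1 @ bs2) cs (es1 @ es2) = (\<Sum>ms\<in>words M (length zs).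
     grid M zs ws1 \<Lambda> as bs1 ms es1 * grid M zs ws2 (sh \<Lambda> es1) ms bs2 cs es2)"
  using assms
proof (induction zs arbitrary: \<Lambda> as cs es1 es2)
  case Nil
  then show ?case by simp
next
  case (Cons z zs)
  from Cons.prems obtain a as' c cs' where [simp]: "as = a # as'" "cs = c # cs'"
    by (metis length_Suc_conv list.size(4) add.commute plus_1_eq_Suc length_words)
  have a: "a \<in> colours M" "as' \<in> words M (length zs)" using Cons.prems by auto
  let ?W1 = "words M (length ws1)" and ?W2 = "words M (length ws2)" and ?V = "words M (length zs)"
  let ?r1 = "\<lambda>u1 x. row M z ws1 \<Lambda> a u1 x es1" and ?r2 = "\<lambda>u2 x. row M z ws2 (sh \<Lambda> es1) x u2 c es2"
  let ?g1 = "\<lambda>ms u1. grid M zs ws1 (sh \<Lambda> [a]) as' bs1 ms u1"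
  have step: "row M z (ws1 @ ws2) \<Lambda> a (u1 @ u2) c (es1 @ es2) * grid M zs (ws1 @ ws2) (sh \<Lambda> [a]) as' (bs1 @ bs2) cs' (u1 @ u2)
     = (\<Sum>x\<in>colours M. \<Sum>ms\<in>?V. (?r1 u1 x * ?g1 ms u1) * (?r2 u2 x * grid M zs ws2 (sh (sh \<Lambda> es1) [x]) ms bs2 cs' u2))"
    if u: "u1 \<in> ?W1" "u2 \<in> ?W2" for u1 u2
  proof -
    have len: "length u1 = length ws1" "length u2 = length ws2" using u by (auto simp: words_def)
    have "row M z (ws1 @ ws2) \<Lambda> a (u1 @ u2) c (es1 @ es2) * grid M zs (ws1 @ ws2) (sh \<Lambda> [a]) as' (bs1 @ bs2) cs' (u1 @ u2)
      = (\<Sum>x\<in>colours M. ?r1 u1 x * ?r2 u2 x) *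
        (\<Sum>ms\<in>?V. ?g1 ms u1 * grid M zs ws2 (sh (sh \<Lambda> [a]) u1) ms bs2 cs' u2)"
      using Cons.IH[of as' cs' u1 u2 "sh \<Lambda> [a]"] row_append[of a M u1 ws1 es1 z ws2 \<Lambda> u2 c es2] Cons.prems len a
      by simp
    also have "\<dots> = (\<Sum>x\<in>colours M. \<Sum>ms\<in>?V. (?r1 u1 x * ?g1 ms u1) * (?r2 u2 x * grid M zs ws2 (sh (sh \<Lambda> [a]) u1) ms bs2 cs' u2))"
      by (simp add: sum_product mult_ac)
    also have "\<dots> = (\<Sum>x\<in>colours M. \<Sum>ms\<in>?V. (?r1 u1 x * ?g1 ms u1) * (?r2 u2 x * grid M zs ws2 (sh (sh \<Lambda> es1) [x]) ms bs2 cs' u2))"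
    proof (intro sum.cong refl)
      fix x ms
      have "sh (sh \<Lambda> [a]) u1 = sh (sh \<Lambda> es1) [x]" if "?r1 u1 x \<noteq> 0"
        using row_nonzero[OF that] len Cons.prems
        by (simp add: dyn_shift_dyn_shift) (rule dyn_shift_cong, simp)
      then show "(?r1 u1 x * ?g1 ms u1) * (?r2 u2 x * grid M zs ws2 (sh (sh \<Lambda> [a]) u1) ms bs2 cs' u2)
         = (?r1 u1 x * ?g1 ms u1) * (?r2 u2 x * grid M zs ws2 (sh (sh \<Lambda> es1) [x]) ms bs2 cs' u2)"
        by fastforce
    qed
    finally show ?thesis .
  qed
  have "grid M (z # zs) (ws1 @ ws2) \<Lambda> as (bs1 @ bs2) cs (es1 @ es2)
     = (\<Sum>u1\<in>?W1. \<Sum>u2\<in>?W2. \<Sum>x\<in>colours M. \<Sum>ms\<in>?V.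
        (?r1 u1 x * ?g1 ms u1) * (?r2 u2 x * grid M zs ws2 (sh (sh \<Lambda> es1) [x]) ms bs2 cs' u2))"
    using step by (simp add: sum_words_append)
  also have "\<dots> = (\<Sum>x\<in>colours M. \<Sum>ms\<in>?V. \<Sum>u1\<in>?W1. \<Sum>u2\<in>?W2.
        (?r1 u1 x * ?g1 ms u1) * (?r2 u2 x * grid M zs ws2 (sh (sh \<Lambda> es1) [x]) ms bs2 cs' u2))"
    by (rule sum_swap4)
  also have "\<dots> = (\<Sum>ms\<in>words M (length (z # zs)).
     grid M (z # zs) ws1 \<Lambda> as bs1 ms es1 * grid M (z # zs) ws2 (sh \<Lambda> es1) ms bs2 cs es2)"
    by (simp add: sum_words_Suc sum_product)
  finally show ?case .
qed

text \<open>The weights of a crossing of the lines \<open>z\<close>, \<open>w\<close> that is turned by 45 degrees: \<open>xs\<close> are the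
  colours of its left and bottom edges, \<open>ys\<close> those of its top and right edges.\<close>

definition rmat :: "complex \<Rightarrow> complex \<Rightarrow> (nat \<Rightarrow> complex) \<Rightarrow> nat list \<Rightarrow> nat list \<Rightarrow> complex" where
  "rmat z w \<Lambda> xs ys = weight \<tau> \<gamma> z w \<Lambda> (xs ! 0) (xs ! 1) (ys ! 1) (ys ! 0)"

lemma rmat_nonzero:
  assumes "rmat z w \<Lambda> xs ys \<noteq> 0" "xs \<in> words M 2" "ys \<in> words M 2"
  shows "mset xs = mset ys"
  using assms weight_nonzero[of \<tau> \<gamma> z w \<Lambda> "xs ! 0" "xs ! 1" "ys ! 1" "ys ! 0"]
  by (auto simp: rmat_def add_mset_commute elim!: words_2E)

lemma rmat_diag_right:
  assumes "xs \<in> words M 2"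
  shows "rmat z w \<Lambda> xs [c, c] = (if xs = [c, c] then theta \<tau> (z - w - \<gamma>) else 0)"
  using assms by (auto simp: rmat_def weight_def elim!: words_2E)

lemma rmat_diag_left:
  assumes "ys \<in> words M 2"
  shows "rmat z w \<Lambda> [c, c] ys = (if ys = [c, c] then theta \<tau> (z - w - \<gamma>) else 0)"
  using assms by (auto simp: rmat_def weight_def elim!: words_2E)

lemma sum_mult_delta:
  fixes f :: "'a \<Rightarrow> 'b :: semiring_1"
  assumes "finite C"
  shows "(\<Sum>x\<in>C. f x * (if x = c then 1 else 0)) = (if c \<in> C then f c else 0)"
proof -
  have "f x * (if x = c then 1 else 0) = (if x = c then f c else 0)" for x by simp
  then show ?thesis using assms by (simp add: sum.delta)
qed

section \<open>Pulling a crossing through a grid\<close>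

lemma grid_two_rows_one_col:
  assumes "b \<in> colours M" "c1 \<in> colours M" "c2 \<in> colours M"
  shows "grid M [z1, z2] [w] \<Lambda> [x, y] [b] [c1, c2] [e] =
    (\<Sum>m\<in>colours M. weight \<tau> \<gamma> z1 w \<Lambda> x m c1 e * weight \<tau> \<gamma> z2 w (sh \<Lambda> [x]) y b c2 m)"
  using assms by (simp add: sum_words_Suc sum_mult_delta)

text \<open>The Yang--Baxter equation with \<open>w\<close> as the third line: a crossing to the
  left of the column reappears on its right, and the two rows are interchanged. Pairs of colours on
  either side of the crossing are read from top to bottom.\<close>

lemma rmat_grid_one_col:
  assumes "generic \<tau> \<gamma> M \<Lambda>" "is \<in> words M 2" "cs \<in> words M 2" "b \<in> colours M"
  shows "(\<Sum>xs\<in>words M 2. rmat z1 z2 \<Lambda> is xs * grid M [z2, z1] [w] \<Lambda> xs [b] cs [e]) =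
    (\<Sum>xs\<in>words M 2. grid M [z1, z2] [w] \<Lambda> is [b] xs [e] * rmat z1 z2 (sh \<Lambda> [e]) xs cs)"
proof -
  obtain i j where ij: "is = [i, j]" "i \<in> colours M" "j \<in> colours M" using assms(2) by (rule words_2E)
  obtain c1 c2 where c: "cs = [c1, c2]" "c1 \<in> colours M" "c2 \<in> colours M" using assms(3) by (rule words_2E)
  have "(\<Sum>xs\<in>words M 2. rmat z1 z2 \<Lambda> is xs * grid M [z2, z1] [w] \<Lambda> xs [b] cs [e]) =
    (\<Sum>x\<in>colours M. \<Sum>y\<in>colours M. weight \<tau> \<gamma> z1 z2 \<Lambda> i j y x *
       (\<Sum>m\<in>colours M. weight \<tau> \<gamma> z1 w (dyn_shift \<gamma> \<Lambda> [x]) y b c2 m * weight \<tau> \<gamma> z2 w \<Lambda> x m c1 e))"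
    unfolding sum_words_2 using ij c assms(4)
    by (simp add: grid_two_rows_one_col rmat_def mult_ac del: grid.simps)
  also have "\<dots> = (\<Sum>m\<in>colours M. \<Sum>y\<in>colours M. weight \<tau> \<gamma> z2 w (dyn_shift \<gamma> \<Lambda> [i]) j b y m *
       (\<Sum>x\<in>colours M. weight \<tau> \<gamma> z1 w \<Lambda> i m x e * weight \<tau> \<gamma> z1 z2 (dyn_shift \<gamma> \<Lambda> [e]) x y c2 c1))"
    by (rule dynamical_yang_baxter[OF Im_tau assms(1) ij(2,3) assms(4)])
  also have "\<dots> = (\<Sum>m\<in>colours M. \<Sum>y\<in>colours M. \<Sum>x\<in>colours M. weight \<tau> \<gamma> z1 w \<Lambda> i m x e *
      weight \<tau> \<gamma> z2 w (dyn_shift \<gamma> \<Lambda> [i]) j b y m * weight \<tau> \<gamma> z1 z2 (dyn_shift \<gamma> \<Lambda> [e]) x y c2 c1)"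
    by (simp add: sum_distrib_left mult_ac)
  also have "\<dots> = (\<Sum>y\<in>colours M. \<Sum>x\<in>colours M. \<Sum>m\<in>colours M. weight \<tau> \<gamma> z1 w \<Lambda> i m x e *
      weight \<tau> \<gamma> z2 w (dyn_shift \<gamma> \<Lambda> [i]) j b y m * weight \<tau> \<gamma> z1 z2 (dyn_shift \<gamma> \<Lambda> [e]) x y c2 c1)"
    by (subst sum.swap) (intro sum.cong refl sum.swap)
  also have "\<dots> = (\<Sum>x\<in>colours M. \<Sum>y\<in>colours M. \<Sum>m\<in>colours M. weight \<tau> \<gamma> z1 w \<Lambda> i m x e *
      weight \<tau> \<gamma> z2 w (dyn_shift \<gamma> \<Lambda> [i]) j b y m * weight \<tau> \<gamma> z1 z2 (dyn_shift \<gamma> \<Lambda> [e]) x y c2 c1)"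
    by (rule sum.swap)
  also have "\<dots> = (\<Sum>xs\<in>words M 2. grid M [z1, z2] [w] \<Lambda> is [b] xs [e] * rmat z1 z2 (sh \<Lambda> [e]) xs cs)"
    unfolding sum_words_2 using ij c assms(4)
    by (simp add: grid_two_rows_one_col rmat_def sum_distrib_right del: grid.simps)
  finally show ?thesis .
qed

text \<open>The crossing passes one column at a time. Each column shifts its parameter by the colour
  of the top edge, which adds up to the shift by \<open>es\<close>.\<close>

lemma rmat_grid_rows:
  assumes "generic \<tau> \<gamma> M \<Lambda>" "is \<in> words M 2" "cs \<in> words M 2"
    and "bs \<in> words M (length ws)" "length es = length ws"
  shows "(\<Sum>xs\<in>words M 2. rmat z1 z2 \<Lambda> is xs * grid M [z2, z1] ws \<Lambda> xs bs cs es) =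
    (\<Sum>xs\<in>words M 2. grid M [z1, z2] ws \<Lambda> is bs xs es * rmat z1 z2 (sh \<Lambda> es) xs cs)"
  using assms
proof (induction ws arbitrary: \<Lambda> "is" bs es)
  case Nil
  have g: "grid M [u, v] [] \<Lambda> xs [] ys [] = (if xs = ys then 1 else 0)"
    if "xs \<in> words M 2" "ys \<in> words M 2" for u v xs ys
    using that by (auto elim!: words_2E)
  have "(\<Sum>xs\<in>words M 2. rmat z1 z2 \<Lambda> is xs * grid M [z2, z1] [] \<Lambda> xs [] cs [])
      = (\<Sum>xs\<in>words M 2. rmat z1 z2 \<Lambda> is xs * (if xs = cs then 1 else 0))"
    using Nil by (intro sum.cong) (simp_all add: g del: grid.simps)
  moreover have "(\<Sum>xs\<in>words M 2. grid M [z1, z2] [] \<Lambda> is [] xs [] * rmat z1 z2 \<Lambda> xs cs)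
      = (\<Sum>xs\<in>words M 2. rmat z1 z2 \<Lambda> xs cs * (if xs = is then 1 else 0))"
    using Nil by (intro sum.cong) (auto simp add: g simp del: grid.simps)
  ultimately show ?case using Nil by (simp add: sum_mult_delta del: grid.simps)
next
  case (Cons w ws)
  from Cons.prems obtain b bs' e es' where [simp]: "bs = b # bs'" "es = e # es'"
    by (metis length_Suc_conv list.size(4) add.commute plus_1_eq_Suc length_words)
  have len: "length bs' = length ws" using Cons.prems by (simp add: words_def)
  have splt: "grid M [u, v] (w # ws) \<Lambda> xs (b # bs') ys (e # es') =
      (\<Sum>ms\<in>words M 2. grid M [u, v] [w] \<Lambda> xs [b] ms [e] * grid M [u, v] ws (sh \<Lambda> [e]) ms bs' ys es')"
    if "xs \<in> words M 2" "ys \<in> words M 2" for u v xs ys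
    using grid_append_cols[of xs M "[u, v]" ys "[b]" "[w]" "[e]" bs' ws es' \<Lambda>] that Cons.prems len
    by (simp add: numeral_2_eq_2 length_words del: grid.simps)
  let ?R = "rmat z1 z2"
  have "(\<Sum>xs\<in>words M 2. ?R \<Lambda> is xs * grid M [z2, z1] (w # ws) \<Lambda> xs bs cs es) =
    (\<Sum>xs\<in>words M 2. \<Sum>ms\<in>words M 2. ?R \<Lambda> is xs * (grid M [z2, z1] [w] \<Lambda> xs [b] ms [e] * grid M [z2, z1] ws (sh \<Lambda> [e]) ms bs' cs es'))"
    using Cons.prems by (simp add: splt sum_distrib_left del: grid.simps cong: sum.cong)
  also have "\<dots> = (\<Sum>ms\<in>words M 2. (\<Sum>xs\<in>words M 2. ?R \<Lambda> is xs * grid M [z2, z1] [w] \<Lambda> xs [b] ms [e]) * grid M [z2, z1] ws (sh \<Lambda> [e]) ms bs' cs es')"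
    by (subst sum.swap) (simp add: sum_distrib_right mult.assoc del: grid.simps)
  also have "\<dots> = (\<Sum>ms\<in>words M 2. (\<Sum>xs\<in>words M 2. grid M [z1, z2] [w] \<Lambda> is [b] xs [e] * ?R (sh \<Lambda> [e]) xs ms) * grid M [z2, z1] ws (sh \<Lambda> [e]) ms bs' cs es')"
    using Cons.prems by (intro sum.cong refl arg_cong2[of _ _ _ _ "(*)"] rmat_grid_one_col) auto
  also have "\<dots> = (\<Sum>xs\<in>words M 2. grid M [z1, z2] [w] \<Lambda> is [b] xs [e] * (\<Sum>ms\<in>words M 2. ?R (sh \<Lambda> [e]) xs ms * grid M [z2, z1] ws (sh \<Lambda> [e]) ms bs' cs es'))"
    unfolding sum_distrib_right sum_distrib_left by (subst sum.swap) (simp add: mult.assoc del: grid.simps)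
  also have "\<dots> = (\<Sum>xs\<in>words M 2. grid M [z1, z2] [w] \<Lambda> is [b] xs [e] * (\<Sum>ms\<in>words M 2. grid M [z1, z2] ws (sh \<Lambda> [e]) xs bs' ms es' * ?R (sh (sh \<Lambda> [e]) es') ms cs))"
    using Cons.prems by (intro sum.cong refl arg_cong2[of _ _ _ _ "(*)"] Cons.IH generic_dyn_shift) auto
  also have "\<dots> = (\<Sum>ms\<in>words M 2. (\<Sum>xs\<in>words M 2. grid M [z1, z2] [w] \<Lambda> is [b] xs [e] * grid M [z1, z2] ws (sh \<Lambda> [e]) xs bs' ms es') * ?R (sh \<Lambda> es) ms cs)"
    unfolding sum_distrib_right sum_distrib_left by (subst sum.swap) (simp add: mult.assoc dyn_shift_dyn_shift del: grid.simps)
  also have "\<dots> = (\<Sum>ms\<in>words M 2. grid M [z1, z2] (w # ws) \<Lambda> is bs ms es * ?R (sh \<Lambda> es) ms cs)"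
    using Cons.prems by (simp add: splt del: grid.simps cong: sum.cong)
  finally show ?case .
qed

text \<open>The same Yang--Baxter equation, now with the row as the first line and the two columns
  as the second and third: the crossing moves from above the row to below it.\<close>

lemma row_two_cols_rmat:
  assumes "generic \<tau> \<gamma> M \<Lambda>" "us \<in> words M 2" "es \<in> words M 2" "l \<in> colours M" "c \<in> colours M"
  shows "(\<Sum>xs\<in>words M 2. row M z [w1, w2] \<Lambda> l us c xs * rmat w1 w2 \<Lambda> xs es) =
    (\<Sum>vs\<in>words M 2. rmat w1 w2 (sh \<Lambda> [l]) us vs * row M z [w2, w1] \<Lambda> l vs c es)"
proof -
  obtain i j where ij: "us = [i, j]" "i \<in> colours M" "j \<in> colours M" using assms(2) by (rule words_2E)
  obtain e1 e2 where e: "es = [e1, e2]" "e1 \<in> colours M" "e2 \<in> colours M" using assms(3) by (rule words_2E)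
  have "(\<Sum>xs\<in>words M 2. row M z [w1, w2] \<Lambda> l us c xs * rmat w1 w2 \<Lambda> xs es) =
     (\<Sum>x\<in>colours M. \<Sum>m\<in>colours M. \<Sum>y\<in>colours M. weight \<tau> \<gamma> z w1 \<Lambda> l i y x *
       (weight \<tau> \<gamma> z w2 (sh \<Lambda> [x]) y j c m * weight \<tau> \<gamma> w1 w2 \<Lambda> x m e2 e1))"
    unfolding sum_words_2 using ij e assms(5)
    by (simp add: rmat_def sum_mult_delta sum_distrib_right mult.assoc)
  also have "\<dots> = (\<Sum>x\<in>colours M. \<Sum>y\<in>colours M. weight \<tau> \<gamma> z w1 \<Lambda> l i y x *
       (\<Sum>m\<in>colours M. weight \<tau> \<gamma> z w2 (sh \<Lambda> [x]) y j c m * weight \<tau> \<gamma> w1 w2 \<Lambda> x m e2 e1))"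
    unfolding sum_distrib_left by (intro sum.cong refl sum.swap)
  also have "\<dots> = (\<Sum>m\<in>colours M. \<Sum>y\<in>colours M. weight \<tau> \<gamma> w1 w2 (sh \<Lambda> [l]) i j y m *
       (\<Sum>x\<in>colours M. weight \<tau> \<gamma> z w2 \<Lambda> l m x e1 * weight \<tau> \<gamma> z w1 (sh \<Lambda> [e1]) x y c e2))"
    by (rule dynamical_yang_baxter[OF Im_tau assms(1) assms(4) ij(2,3)])
  also have "\<dots> = (\<Sum>vs\<in>words M 2. rmat w1 w2 (sh \<Lambda> [l]) us vs * row M z [w2, w1] \<Lambda> l vs c es)"
    unfolding sum_words_2 using ij e assms(5)
    by (simp add: rmat_def sum_mult_delta)
  finally show ?thesis .
qed

lemma grid_cols_rmat:
  assumes "generic \<tau> \<gamma> M \<Lambda>" "bs \<in> words M 2" "es \<in> words M 2"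
    and "ls \<in> words M (length zs)" "cs \<in> words M (length zs)"
  shows "(\<Sum>xs\<in>words M 2. grid M zs [w1, w2] \<Lambda> ls bs cs xs * rmat w1 w2 \<Lambda> xs es) =
    (\<Sum>ys\<in>words M 2. rmat w1 w2 (sh \<Lambda> ls) bs ys * grid M zs [w2, w1] \<Lambda> ls ys cs es)"
  using assms
proof (induction zs arbitrary: \<Lambda> ls cs es)
  case Nil
  then show ?case by (simp add: sum_mult_delta eq_commute[of es] mult.commute[of "if _ then _ else _"])
next
  case (Cons z zs)
  from Cons.prems obtain l ls' c cs' where [simp]: "ls = l # ls'" "cs = c # cs'"
    by (metis length_Suc_conv list.size(4) add.commute plus_1_eq_Suc length_words)
  let ?R = "rmat w1 w2"
  have two: "Suc (Suc 0) = 2" by simp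
  have "(\<Sum>xs\<in>words M 2. grid M (z # zs) [w1, w2] \<Lambda> ls bs cs xs * ?R \<Lambda> xs es) =
    (\<Sum>xs\<in>words M 2. \<Sum>us\<in>words M 2. row M z [w1, w2] \<Lambda> l us c xs * grid M zs [w1, w2] (sh \<Lambda> [l]) ls' bs cs' us * ?R \<Lambda> xs es)"
    by (simp add: sum_distrib_right two del: row.simps)
  also have "\<dots> = (\<Sum>us\<in>words M 2. grid M zs [w1, w2] (sh \<Lambda> [l]) ls' bs cs' us * (\<Sum>xs\<in>words M 2. row M z [w1, w2] \<Lambda> l us c xs * ?R \<Lambda> xs es))"
    unfolding sum_distrib_left by (subst sum.swap) (simp add: mult_ac del: row.simps)
  also have "\<dots> = (\<Sum>us\<in>words M 2. grid M zs [w1, w2] (sh \<Lambda> [l]) ls' bs cs' us * (\<Sum>vs\<in>words M 2. ?R (sh \<Lambda> [l]) us vs * row M z [w2, w1] \<Lambda> l vs c es))"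
    using Cons.prems by (intro sum.cong refl arg_cong2[of _ _ _ _ "(*)"] row_two_cols_rmat) auto
  also have "\<dots> = (\<Sum>vs\<in>words M 2. (\<Sum>us\<in>words M 2. grid M zs [w1, w2] (sh \<Lambda> [l]) ls' bs cs' us * ?R (sh \<Lambda> [l]) us vs) * row M z [w2, w1] \<Lambda> l vs c es)"
    unfolding sum_distrib_left sum_distrib_right by (subst sum.swap) (simp add: mult_ac del: row.simps)
  also have "\<dots> = (\<Sum>vs\<in>words M 2. (\<Sum>ys\<in>words M 2. ?R (sh (sh \<Lambda> [l]) ls') bs ys * grid M zs [w2, w1] (sh \<Lambda> [l]) ls' ys cs' vs) * row M z [w2, w1] \<Lambda> l vs c es)"
    using Cons.prems by (intro sum.cong refl arg_cong2[of _ _ _ _ "(*)"] Cons.IH generic_dyn_shift) auto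
  also have "\<dots> = (\<Sum>ys\<in>words M 2. ?R (sh \<Lambda> ls) bs ys * (\<Sum>vs\<in>words M 2. row M z [w2, w1] \<Lambda> l vs c es * grid M zs [w2, w1] (sh \<Lambda> [l]) ls' ys cs' vs))"
    unfolding sum_distrib_left sum_distrib_right by (subst sum.swap) (simp add: mult_ac dyn_shift_dyn_shift del: row.simps)
  also have "\<dots> = (\<Sum>ys\<in>words M 2. ?R (sh \<Lambda> ls) bs ys * grid M (z # zs) [w2, w1] \<Lambda> ls ys cs es)"
    by (simp add: two del: row.simps)
  finally show ?case .
qed

text \<open>At the right boundary both lines carry the colour \<open>c\<close>, where the crossing
  is a scalar. Multiplying by this scalar inserts the crossing there; pulled through to the left, it
  acts on the left colours \<open>is\<close>.\<close>

lemma grid_swap_rows: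
  assumes "generic \<tau> \<gamma> M \<Lambda>" "is \<in> words M 2" "c \<in> colours M"
    and "length Y1 = length A" "length Y3 = length B" "es \<in> words M (length ws)" "bs \<in> words M (length ws)"
    and "n = length (A @ [z1, z2] @ B)"
  shows "theta \<tau> (z1 - z2 - \<gamma>) * grid M (A @ [z1, z2] @ B) ws \<Lambda> (Y1 @ is @ Y3) bs (replicate n c) es =
    (\<Sum>xs\<in>words M 2. rmat z1 z2 (sh \<Lambda> Y1) is xs * grid M (A @ [z2, z1] @ B) ws \<Lambda> (Y1 @ xs @ Y3) bs (replicate n c) es)"
proof -
  let ?W = "words M (length ws)"
  have cs: "replicate n c = replicate (length A) c @ [c, c] @ replicate (length B) c"
    unfolding assms(8) by (simp add: replicate_add[symmetric] replicate_app_Cons_same flip: replicate_Suc)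
  have cc: "[c, c] \<in> words M 2" using assms(3) by (simp add: words_def)
  have splt: "grid M (A @ [u, v] @ B) ws \<Lambda> (Y1 @ xs @ Y3) bs (replicate n c) es =
    (\<Sum>us\<in>?W. \<Sum>vs\<in>?W. grid M A ws \<Lambda> Y1 us (replicate (length A) c) es *
      (grid M [u, v] ws (sh \<Lambda> Y1) xs vs [c, c] us * grid M B ws (sh (sh \<Lambda> Y1) xs) Y3 bs (replicate (length B) c) vs))"
    if "xs \<in> words M 2" for u v xs
    unfolding cs using assms that
    by (subst grid_append_rows, simp_all only: sum_distrib_left)
      (auto intro!: sum.cong simp: grid_append_rows[of _ M ws xs "[u, v]" "[c, c]", symmetric] length_words
        sum_distrib_left[symmetric] simp del: grid.simps append.simps)
  have ex: "theta \<tau> (z1 - z2 - \<gamma>) * grid M [z1, z2] ws (sh \<Lambda> Y1) is vs [c, c] us =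
      (\<Sum>xs\<in>words M 2. rmat z1 z2 (sh \<Lambda> Y1) is xs * grid M [z2, z1] ws (sh \<Lambda> Y1) xs vs [c, c] us)"
    if "us \<in> ?W" "vs \<in> ?W" for us vs
  proof -
    have "(\<Sum>xs\<in>words M 2. grid M [z1, z2] ws (sh \<Lambda> Y1) is vs xs us * rmat z1 z2 (sh (sh \<Lambda> Y1) us) xs [c, c])
       = (\<Sum>xs\<in>words M 2. (theta \<tau> (z1 - z2 - \<gamma>) * grid M [z1, z2] ws (sh \<Lambda> Y1) is vs xs us) * (if xs = [c, c] then 1 else 0))"
      by (intro sum.cong refl) (simp add: rmat_diag_right)
    then show ?thesis
      using rmat_grid_rows[OF generic_dyn_shift[OF assms(1)] assms(2) cc that(2), of us z1 z2 Y1] cc that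
      by (simp add: sum_mult_delta length_words del: grid.simps)
  qed
  \<comment> \<open>The rows below the crossing see its left colours only through the shift of their
    parameter, and the crossing preserves the multiset of colours.\<close>
  have shc: "rmat z1 z2 (sh \<Lambda> Y1) is xs * (g * grid M B ws (sh (sh \<Lambda> Y1) is) Y3 bs cs vs) =
     rmat z1 z2 (sh \<Lambda> Y1) is xs * (g * grid M B ws (sh (sh \<Lambda> Y1) xs) Y3 bs cs vs)"
    if "xs \<in> words M 2" for xs g vs cs
    using rmat_nonzero[OF _ assms(2) that, of z1 z2 "sh \<Lambda> Y1"] dyn_shift_cong[of "is" xs]
    by (cases "rmat z1 z2 (sh \<Lambda> Y1) is xs = 0") auto
  let ?gA = "\<lambda>us. grid M A ws \<Lambda> Y1 us (replicate (length A) c) es"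
  let ?gB = "\<lambda>xs vs. grid M B ws (sh (sh \<Lambda> Y1) xs) Y3 bs (replicate (length B) c) vs"
  have "theta \<tau> (z1 - z2 - \<gamma>) * grid M (A @ [z1, z2] @ B) ws \<Lambda> (Y1 @ is @ Y3) bs (replicate n c) es
    = (\<Sum>us\<in>?W. \<Sum>vs\<in>?W. ?gA us * ((theta \<tau> (z1 - z2 - \<gamma>) * grid M [z1, z2] ws (sh \<Lambda> Y1) is vs [c, c] us) * ?gB is vs))"
    unfolding splt[OF assms(2)] by (simp add: sum_distrib_left mult_ac del: grid.simps)
  also have "\<dots> = (\<Sum>us\<in>?W. \<Sum>vs\<in>?W. \<Sum>xs\<in>words M 2. ?gA us * (rmat z1 z2 (sh \<Lambda> Y1) is xs * (grid M [z2, z1] ws (sh \<Lambda> Y1) xs vs [c, c] us * ?gB xs vs)))"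
    by (intro sum.cong refl) (simp add: ex sum_distrib_left sum_distrib_right mult.assoc shc del: grid.simps)
  also have "\<dots> = (\<Sum>us\<in>?W. \<Sum>xs\<in>words M 2. \<Sum>vs\<in>?W. ?gA us * (rmat z1 z2 (sh \<Lambda> Y1) is xs * (grid M [z2, z1] ws (sh \<Lambda> Y1) xs vs [c, c] us * ?gB xs vs)))"
    by (intro sum.cong refl sum.swap)
  also have "\<dots> = (\<Sum>xs\<in>words M 2. \<Sum>us\<in>?W. \<Sum>vs\<in>?W. ?gA us * (rmat z1 z2 (sh \<Lambda> Y1) is xs * (grid M [z2, z1] ws (sh \<Lambda> Y1) xs vs [c, c] us * ?gB xs vs)))"
    by (rule sum.swap)
  also have "\<dots> = (\<Sum>xs\<in>words M 2. rmat z1 z2 (sh \<Lambda> Y1) is xs * grid M (A @ [z2, z1] @ B) ws \<Lambda> (Y1 @ xs @ Y3) bs (replicate n c) es)"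
    by (intro sum.cong refl) (simp add: splt sum_distrib_left mult_ac del: grid.simps append.simps)
  finally show ?thesis .
qed

text \<open>The counterpart for columns: a crossing placed on the top edges leaves at the bottom,
  where both lines carry the colour \<open>b\<close> and it is a scalar.\<close>

lemma grid_swap_cols:
  assumes "generic \<tau> \<gamma> M \<Lambda>" "es \<in> words M 2" "b \<in> colours M"
    and "length E1 = length A" "length E3 = length B" "ls \<in> words M (length zs)" "cs \<in> words M (length zs)"
    and "n = length (A @ [w1, w2] @ B)"
  shows "(\<Sum>xs\<in>words M 2. grid M zs (A @ [w1, w2] @ B) \<Lambda> ls (replicate n b) cs (E1 @ xs @ E3) * rmat w1 w2 (sh \<Lambda> E1) xs es)
    = theta \<tau> (w1 - w2 - \<gamma>) * grid M zs (A @ [w2, w1] @ B) \<Lambda> ls (replicate n b) cs (E1 @ es @ E3)"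
proof -
  let ?W = "words M (length zs)"
  have bs: "replicate n b = replicate (length A) b @ [b, b] @ replicate (length B) b"
    unfolding assms(8) by (simp add: replicate_add[symmetric] replicate_app_Cons_same flip: replicate_Suc)
  have bb: "[b, b] \<in> words M 2" using assms(3) by (simp add: words_def)
  let ?gA = "\<lambda>us. grid M zs A \<Lambda> ls (replicate (length A) b) us E1"
  let ?gB = "\<lambda>xs vs. grid M zs B (sh (sh \<Lambda> E1) xs) vs (replicate (length B) b) cs E3"
  have splt: "grid M zs (A @ [u, v] @ B) \<Lambda> ls (replicate n b) cs (E1 @ xs @ E3) =
    (\<Sum>us\<in>?W. \<Sum>vs\<in>?W. ?gA us * (grid M zs [u, v] (sh \<Lambda> E1) us [b, b] vs xs * ?gB xs vs))"
    if "xs \<in> words M 2" for u v xs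
  proof -
    have l: "length xs = 2" "length cs = length zs" using that assms by (auto simp: words_def)
    have "grid M zs (A @ [u, v] @ B) \<Lambda> ls (replicate n b) cs (E1 @ xs @ E3) =
      (\<Sum>us\<in>?W. ?gA us * grid M zs ([u, v] @ B) (sh \<Lambda> E1) us ([b, b] @ replicate (length B) b) cs (xs @ E3))"
      unfolding bs using l assms by (subst grid_append_cols) auto
    also have "\<dots> = (\<Sum>us\<in>?W. ?gA us * (\<Sum>vs\<in>?W. grid M zs [u, v] (sh \<Lambda> E1) us [b, b] vs xs * ?gB xs vs))"
      using l assms by (intro sum.cong refl arg_cong2[of _ _ _ _ "(*)"] grid_append_cols) auto
    finally show ?thesis by (simp add: sum_distrib_left)
  qed
  have ex: "(\<Sum>xs\<in>words M 2. grid M zs [w1, w2] (sh \<Lambda> E1) us [b, b] vs xs * rmat w1 w2 (sh \<Lambda> E1) xs es) =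
     theta \<tau> (w1 - w2 - \<gamma>) * grid M zs [w2, w1] (sh \<Lambda> E1) us [b, b] vs es"
    if "us \<in> ?W" "vs \<in> ?W" for us vs
  proof -
    have "(\<Sum>ys\<in>words M 2. rmat w1 w2 (sh (sh \<Lambda> E1) us) [b, b] ys * grid M zs [w2, w1] (sh \<Lambda> E1) us ys vs es)
      = (\<Sum>ys\<in>words M 2. (theta \<tau> (w1 - w2 - \<gamma>) * grid M zs [w2, w1] (sh \<Lambda> E1) us ys vs es) * (if ys = [b, b] then 1 else 0))"
      by (intro sum.cong refl) (simp add: rmat_diag_left)
    then show ?thesis
      using grid_cols_rmat[OF generic_dyn_shift[OF assms(1)] bb assms(2) that, of w1 w2 E1] bb
      by (simp add: sum_mult_delta)
  qed
  have shc: "g * ?gB xs vs * rmat w1 w2 (sh \<Lambda> E1) xs es = g * ?gB es vs * rmat w1 w2 (sh \<Lambda> E1) xs es"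
    if "xs \<in> words M 2" for xs g vs
    using rmat_nonzero[OF _ that assms(2), of w1 w2 "sh \<Lambda> E1"] dyn_shift_cong[of xs es]
    by (cases "rmat w1 w2 (sh \<Lambda> E1) xs es = 0") auto
  have "(\<Sum>xs\<in>words M 2. grid M zs (A @ [w1, w2] @ B) \<Lambda> ls (replicate n b) cs (E1 @ xs @ E3) * rmat w1 w2 (sh \<Lambda> E1) xs es)
    = (\<Sum>xs\<in>words M 2. \<Sum>us\<in>?W. \<Sum>vs\<in>?W. ?gA us * (grid M zs [w1, w2] (sh \<Lambda> E1) us [b, b] vs xs * ?gB xs vs * rmat w1 w2 (sh \<Lambda> E1) xs es))"
    by (intro sum.cong refl) (simp add: splt sum_distrib_right mult.assoc del: append.simps)
  also have "\<dots> = (\<Sum>xs\<in>words M 2. \<Sum>us\<in>?W. \<Sum>vs\<in>?W. ?gA us * (grid M zs [w1, w2] (sh \<Lambda> E1) us [b, b] vs xs * ?gB es vs * rmat w1 w2 (sh \<Lambda> E1) xs es))"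
    by (intro sum.cong refl) (simp only: shc)
  also have "\<dots> = (\<Sum>us\<in>?W. \<Sum>xs\<in>words M 2. \<Sum>vs\<in>?W. ?gA us * (grid M zs [w1, w2] (sh \<Lambda> E1) us [b, b] vs xs * ?gB es vs * rmat w1 w2 (sh \<Lambda> E1) xs es))"
    by (rule sum.swap)
  also have "\<dots> = (\<Sum>us\<in>?W. \<Sum>vs\<in>?W. \<Sum>xs\<in>words M 2. ?gA us * (grid M zs [w1, w2] (sh \<Lambda> E1) us [b, b] vs xs * ?gB es vs * rmat w1 w2 (sh \<Lambda> E1) xs es))"
    by (intro sum.cong refl sum.swap)
  also have "\<dots> = (\<Sum>us\<in>?W. \<Sum>vs\<in>?W. ?gA us * ((\<Sum>xs\<in>words M 2. grid M zs [w1, w2] (sh \<Lambda> E1) us [b, b] vs xs * rmat w1 w2 (sh \<Lambda> E1) xs es) * ?gB es vs))"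
    by (simp add: sum_distrib_left sum_distrib_right mult_ac)
  also have "\<dots> = theta \<tau> (w1 - w2 - \<gamma>) * grid M zs (A @ [w2, w1] @ B) \<Lambda> ls (replicate n b) cs (E1 @ es @ E3)"
    unfolding splt[OF assms(2)] sum_distrib_left
    by (intro sum.cong refl) (simp only: ex mult.left_commute mult.assoc)
  finally show ?thesis .
qed

end

section \<open>Decomposition of the partition function into layers\<close>

text \<open>An entry of a product of matrices K 1, ..., K m, written as a sum over paths with fixed
  ends. In this form it can be matched with a sum over edge colourings, while
  \<open>chain_sum_Suc\<close> gives the recursion.\<close>

definition chain_sum :: "(nat \<Rightarrow> 'a \<Rightarrow> 'a \<Rightarrow> complex) \<Rightarrow> (nat \<Rightarrow> 'a set) \<Rightarrow> nat \<Rightarrow> 'a \<Rightarrow> 'a \<Rightarrow> complex" where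
  "chain_sum K A m x y = (\<Sum>f\<in>{f \<in> Pi\<^sub>E {0..m} A. f 0 = x \<and> f m = y}. \<Prod>i=1..m. K i (f (i - 1)) (f i))"

lemma chain_sum_0:
  assumes "x \<in> A 0"
  shows "chain_sum K A 0 x y = (if x = y then 1 else 0)"
proof (cases "x = y")
  case True
  have "{f \<in> Pi\<^sub>E {0..0} A. f 0 = x \<and> f 0 = y} = {\<lambda>i\<in>{0}. x}"
    using True assms by (auto simp: PiE_iff fun_eq_iff extensional_def)
  then show ?thesis using True by (simp add: chain_sum_def)
next
  case False
  then have "{f \<in> Pi\<^sub>E {0..0} A. f 0 = x \<and> f 0 = y} = {}" by auto
  then show ?thesis using False unfolding chain_sum_def by (simp only: sum.empty if_False)
qed

lemma chain_sum_Suc: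
  assumes "\<And>i. finite (A i)" "y \<in> A (Suc m)"
  shows "chain_sum K A (Suc m) x y = (\<Sum>u\<in>A m. chain_sum K A m x u * K (Suc m) u y)"
proof -
  let ?F = "\<lambda>m x y. {f \<in> Pi\<^sub>E {0..m} A. f 0 = x \<and> f m = y}"
  have fin: "finite (?F m x u)" for m x u
    using assms(1) by (simp add: finite_PiE)
  have "(\<Sum>u\<in>A m. chain_sum K A m x u * K (Suc m) u y) =
     (\<Sum>(u, g)\<in>(SIGMA u:A m. ?F m x u). (\<Prod>i=1..m. K i (g (i - 1)) (g i)) * K (Suc m) u y)"
    unfolding chain_sum_def sum_distrib_right
    using assms(1) fin by (subst sum.Sigma) auto
  also have "\<dots> = chain_sum K A (Suc m) x y"
    unfolding chain_sum_def
  \<comment> \<open>Paths are extensional functions on {0..m}, so cutting off the last step means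
    resetting its value to \<open>undefined\<close>.\<close>
  proof (rule sum.reindex_bij_witness[where i = "\<lambda>f. (f m, f(Suc m := undefined))" and j = "\<lambda>(u, g). g(Suc m := y)"])
    fix a assume a: "a \<in> (SIGMA u:A m. ?F m x u)"
    then obtain u g where [simp]: "a = (u, g)" and g: "g \<in> Pi\<^sub>E {0..m} A" "g 0 = x" "g m = u" "u \<in> A m" by auto
    then have "g (Suc m) = undefined" by (simp add: PiE_def extensional_def)
    then have "g(Suc m := undefined) = g" by (simp add: fun_eq_iff)
    with g show "(((case a of (u, g) \<Rightarrow> g(Suc m := y)) m), (case a of (u, g) \<Rightarrow> g(Suc m := y))(Suc m := undefined)) = a"
      by simp
    show "(case a of (u, g) \<Rightarrow> g(Suc m := y)) \<in> ?F (Suc m) x y"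
      using g assms(2) by (auto simp: PiE_iff extensional_def le_Suc_eq)
    have "(\<Prod>i=1..m. K i ((g(Suc m := y)) (i - 1)) ((g(Suc m := y)) i)) = (\<Prod>i=1..m. K i (g (i - 1)) (g i))"
      by (intro prod.cong) auto
    then show "(\<Prod>i=1..Suc m. K i ((case a of (u, g) \<Rightarrow> g(Suc m := y)) (i - 1)) ((case a of (u, g) \<Rightarrow> g(Suc m := y)) i))
      = (case a of (u, g) \<Rightarrow> (\<Prod>i=1..m. K i (g (i - 1)) (g i)) * K (Suc m) u y)"
      using g by simp
  next
    fix f assume f: "f \<in> ?F (Suc m) x y"
    then show "(case (f m, f(Suc m := undefined)) of (u, g) \<Rightarrow> g(Suc m := y)) = f"
      by (auto simp: fun_eq_iff)
    show "(f m, f(Suc m := undefined)) \<in> (SIGMA u:A m. ?F m x u)"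
      using f by (auto simp: PiE_iff extensional_def)
  qed
  finally show ?thesis by simp
qed

lemma chain_sum_cong:
  assumes "\<And>i x y. i \<in> {1..m} \<Longrightarrow> K i x y = K' i x y"
  shows "chain_sum K A m x y = chain_sum K' A m x y"
  unfolding chain_sum_def using assms by (intro sum.cong prod.cong) auto

text \<open>Links the counts in \<open>dyn_shift\<close> with the sums of \<open>mu\<close> in the
  definition of the partition function.\<close>

lemma of_nat_count_list:
  "of_nat (count (mset xs) a) = (\<Sum>i<length xs. mu (xs ! i) a)"
  by (induction xs) (auto simp: mu_def sum.lessThan_Suc_shift simp del: sum.lessThan_Suc)

context vertex_model
begin

lemma row_chain_sum:
  assumes "a \<in> colours M" "c \<in> colours M" "length bs = length ws" "length es = length ws"
  shows "row M z ws \<Lambda> a bs c es = chain_sum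
    (\<lambda>s x y. weight \<tau> \<gamma> z (ws ! (s - 1)) (sh \<Lambda> (take (s - 1) es)) x (bs ! (s - 1)) y (es ! (s - 1)))
    (\<lambda>_. colours M) (length ws) a c"
  using assms
proof (induction ws arbitrary: bs c es rule: rev_induct)
  case Nil
  then show ?case by (simp add: chain_sum_0)
next
  case (snoc w ws)
  from snoc.prems obtain b bs' e es' where [simp]: "bs = bs' @ [b]" "es = es' @ [e]"
    and l: "length bs' = length ws" "length es' = length ws"
    by (metis length_append_singleton length_Suc_conv_rev)
  have "row M z (ws @ [w]) \<Lambda> a bs c es = (\<Sum>x\<in>colours M. row M z ws \<Lambda> a bs' x es' *
      row M z [w] (sh \<Lambda> es') x [b] c [e])"
    using snoc.prems l by (simp add: row_append del: row.simps)
  also have "\<dots> = (\<Sum>x\<in>colours M. row M z ws \<Lambda> a bs' x es' * weight \<tau> \<gamma> z w (sh \<Lambda> es') x b c e)"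
    using snoc.prems by (simp add: sum_mult_delta)
  also have "\<dots> = (\<Sum>x\<in>colours M. chain_sum (\<lambda>s x y. weight \<tau> \<gamma> z ((ws @ [w]) ! (s - 1)) (sh \<Lambda> (take (s - 1) es)) x (bs ! (s - 1)) y (es ! (s - 1)))
    (\<lambda>_. colours M) (length ws) a x * weight \<tau> \<gamma> z w (sh \<Lambda> es') x b c e)"
    using l snoc.prems
    by (intro sum.cong refl arg_cong2[of _ _ _ _ "(*)"], subst snoc.IH)
      (auto intro!: chain_sum_cong simp: nth_append)
  also have "\<dots> = chain_sum (\<lambda>s x y. weight \<tau> \<gamma> z ((ws @ [w]) ! (s - 1)) (sh \<Lambda> (take (s - 1) es)) x (bs ! (s - 1)) y (es ! (s - 1)))
    (\<lambda>_. colours M) (length (ws @ [w])) a c"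
    using l snoc.prems by (simp add: chain_sum_Suc nth_append)
  finally show ?case .
qed

text \<open>The path runs through the words on the successive levels of vertical edges from the top
  down, so it starts at \<open>es\<close> and ends at \<open>bs\<close>.\<close>

lemma grid_chain_sum:
  assumes "length as = length zs" "length cs = length zs" "bs \<in> words M (length ws)" "es \<in> words M (length ws)"
  shows "grid M zs ws \<Lambda> as bs cs es = chain_sum
    (\<lambda>r vs us. row M (zs ! (r - 1)) ws (sh \<Lambda> (take (r - 1) as)) (as ! (r - 1)) us (cs ! (r - 1)) vs)
    (\<lambda>_. words M (length ws)) (length zs) es bs"
  using assms
proof (induction zs arbitrary: bs as cs rule: rev_induct)
  case Nil
  then show ?case by (simp add: chain_sum_0)
next
  case (snoc z zs)
  from snoc.prems obtain a as' c cs' where [simp]: "as = as' @ [a]" "cs = cs' @ [c]"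
    and l: "length as' = length zs" "length cs' = length zs"
    by (metis length_append_singleton length_Suc_conv_rev)
  have "grid M (zs @ [z]) ws \<Lambda> as bs cs es = (\<Sum>us\<in>words M (length ws). grid M zs ws \<Lambda> as' us cs' es *
      grid M [z] ws (sh \<Lambda> as') [a] bs [c] us)"
    using snoc.prems l by (simp add: grid_append_rows del: grid.simps)
  also have "\<dots> = (\<Sum>us\<in>words M (length ws). grid M zs ws \<Lambda> as' us cs' es *
     row M z ws (sh \<Lambda> as') a bs c us)"
    using snoc.prems by (simp add: sum_mult_delta)
  also have "\<dots> = (\<Sum>us\<in>words M (length ws). chain_sum (\<lambda>r vs us. row M ((zs @ [z]) ! (r - 1)) ws (sh \<Lambda> (take (r - 1) as)) (as ! (r - 1)) us (cs ! (r - 1)) vs)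
    (\<lambda>_. words M (length ws)) (length zs) es us * row M z ws (sh \<Lambda> as') a bs c us)"
    using l snoc.prems
    by (intro sum.cong refl arg_cong2[of _ _ _ _ "(*)"], subst snoc.IH)
      (auto intro!: chain_sum_cong simp: nth_append)
  also have "\<dots> = chain_sum (\<lambda>r vs us. row M ((zs @ [z]) ! (r - 1)) ws (sh \<Lambda> (take (r - 1) as)) (as ! (r - 1)) us (cs ! (r - 1)) vs)
    (\<lambda>_. words M (length ws)) (length (zs @ [z])) es bs"
    using l snoc.prems by (simp add: chain_sum_Suc nth_append)
  finally show ?case .
qed

end

section \<open>Colour words on the boundary\<close>

definition colI :: "pf_data \<Rightarrow> (nat \<Rightarrow> nat set) \<Rightarrow> nat \<Rightarrow> nat list" where
  "colI d I p = map (\<lambda>s. colour d I (offsetI d p + s)) [1..<Suc (length (wIvars d p))]"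

definition colII :: "pf_data \<Rightarrow> (nat \<Rightarrow> nat set) \<Rightarrow> nat \<Rightarrow> nat list" where
  "colII d I p = map (\<lambda>s. colour d I (offsetII d p + s)) [1..<Suc (length (wIIvars d p))]"

definition colM :: "pf_data \<Rightarrow> (nat \<Rightarrow> nat set) \<Rightarrow> nat list" where
  "colM d I = map (\<lambda>s. colour d I (offsetI d (layers d) + s)) [1..<Suc (length (wMvars d))]"

definition top_word :: "pf_data \<Rightarrow> (nat \<Rightarrow> nat set) \<Rightarrow> nat \<Rightarrow> nat list \<Rightarrow> nat list" where
  "top_word d I p X = (if p < layers d then colI d I p @ X @ colII d I p else colM d I)"

lemma length_col [simp]:
  "length (colI d I p) = length (wIvars d p)" "length (colII d I p) = length (wIIvars d p)"
  "length (colM d I) = length (wMvars d)"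
  by (simp_all add: colI_def colII_def colM_def del: upt_Suc)

text \<open>The number of edges between layers \<open>p - 1\<close> and \<open>p\<close>; there are none above the top layer.\<close>

definition interface_size :: "pf_data \<Rightarrow> nat \<Rightarrow> nat" where
  "interface_size d p = (if p \<le> layers d then length (zvars d p) else 0)"

lemma colour_bounds:
  assumes "admissible d I" "p \<in> {1..layers d}" "c \<in> layer_coords d p"
  shows "colour d I c \<in> {1..p + 1}"
proof -
  obtain col where col: "colouring d col" "\<forall>j\<in>{1..layers d}. I j = tuple_of_colouring d col j"
    using assms(1) by (auto simp: admissible_def)
  show ?thesis
    using colour_tuple_of_colouring[OF col assms(2,3)] col(1) assms(2,3) by (simp add: colouring_def)
qed

lemma top_word_mem:
  assumes "admissible d I" "p \<in> {1..layers d}" "X \<in> words (layers d) (interface_size d (Suc p))"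
  shows "top_word d I p X \<in> words (layers d) (ncols d p)"
proof -
  have "colour d I c \<in> colours (layers d)" if "c \<in> layer_coords d p" for c
    using colour_bounds[OF assms(1,2) that] assms(2) by (auto simp: colours_def)
  then show ?thesis
    using assms(2,3)
    by (auto simp: top_word_def words_def ncols_def column_vars_def interface_size_def colI_def colII_def colM_def
        layer_coords_def coordsI_def coordsII_def coordsM_def simp del: upt_Suc split: if_splits)
qed

lemma upt_split3:
  "[1..<Suc (a + b + c)] = [1..<Suc a] @ map (\<lambda>r. a + r) [1..<Suc b] @ map (\<lambda>s. a + b + s) [1..<Suc c]"
proof -
  have "map (\<lambda>r. a + r) [1..<Suc b] = [Suc a..<Suc (a + b)]"
    by (rule nth_equalityI) (simp_all del: upt_Suc)
  moreover have "map (\<lambda>s. a + b + s) [1..<Suc c] = [Suc (a + b)..<Suc (a + b + c)]"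
    by (rule nth_equalityI) (simp_all del: upt_Suc)
  moreover have "[1..<Suc (a + b + c)] = ([1..<Suc a] @ [Suc a..<Suc (a + b)]) @ [Suc (a + b)..<Suc (a + b + c)]"
    using upt_add_eq_append[of 1 "Suc a" b] upt_add_eq_append[of 1 "Suc (a + b)" c] by (simp del: upt_Suc)
  ultimately show ?thesis by (simp only: append_assoc)
qed

text \<open>The conditions on the top edges and the gluing of consecutive layers become one equation
  between words for each layer: the left colours of layer p + 1 are inserted between the two blocks
  of w-colours. Since \<open>interface_size\<close> is 0 above the top layer, no separate case is
  needed there.\<close>

lemma boundary_conditions_top:
  assumes "layers d \<ge> 1"
  shows "boundary_conditions d I \<sigma> \<longleftrightarrow>
     (\<forall>p\<in>{1..layers d}. \<forall>r\<in>{1..nrows d p}. \<sigma> (Hor p r (ncols d p)) = p + 1) \<and>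
     (\<forall>p\<in>{1..layers d}. \<forall>s\<in>{1..ncols d p}. \<sigma> (Ver p (nrows d p) s) = p + 1) \<and>
     (\<forall>r\<in>{1..nrows d 1}. \<sigma> (Hor 1 r 0) = 1) \<and>
     (\<forall>p\<in>{1..layers d}. map (\<lambda>s. \<sigma> (Ver p 0 s)) [1..<Suc (ncols d p)] =
        top_word d I p (map (\<lambda>r. \<sigma> (Hor (Suc p) r 0)) [1..<Suc (interface_size d (Suc p))]))"
    (is "_ \<longleftrightarrow> ?a \<and> ?b \<and> ?c \<and> (\<forall>p\<in>_. ?L p = ?R p)")
proof -
  have M: "?L p = ?R p \<longleftrightarrow> (\<forall>s\<in>{1..length (wMvars d)}. \<sigma> (Ver (layers d) 0 s) = colour d I (offsetI d (layers d) + s))"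
    if "p = layers d" for p
    using that by (auto simp: top_word_def ncols_def column_vars_def colM_def)
  have lt: "?L p = ?R p \<longleftrightarrow>
      (\<forall>r\<in>{1..nrows d (p + 1)}. \<sigma> (Hor (p + 1) r 0) = \<sigma> (Ver p 0 (length (wIvars d p) + r))) \<and>
      (\<forall>s\<in>{1..length (wIvars d p)}. \<sigma> (Ver p 0 s) = colour d I (offsetI d p + s)) \<and>
      (\<forall>s\<in>{1..length (wIIvars d p)}.
        \<sigma> (Ver p 0 (length (wIvars d p) + nrows d (p + 1) + s)) = colour d I (offsetII d p + s))"
    if "p < layers d" for p
  proof -
    have "?L p = map (\<lambda>s. \<sigma> (Ver p 0 s)) [1..<Suc (length (wIvars d p))] @
       map (\<lambda>r. \<sigma> (Ver p 0 (length (wIvars d p) + r))) [1..<Suc (nrows d (p + 1))] @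
       map (\<lambda>s. \<sigma> (Ver p 0 (length (wIvars d p) + nrows d (p + 1) + s))) [1..<Suc (length (wIIvars d p))]"
      using that upt_split3[of "length (wIvars d p)" "nrows d (p + 1)" "length (wIIvars d p)"]
      by (simp add: ncols_def column_vars_def nrows_def o_def add.assoc del: upt_Suc)
    moreover have "?R p = colI d I p @ map (\<lambda>r. \<sigma> (Hor (Suc p) r 0)) [1..<Suc (nrows d (p + 1))] @ colII d I p"
      using that by (simp add: top_word_def interface_size_def nrows_def)
    ultimately show ?thesis
      by (auto simp: colI_def colII_def simp del: upt_Suc)
  qed
  have "{1..layers d} = insert (layers d) {1..<layers d}" using assms by auto
  then have "(\<forall>p\<in>{1..layers d}. ?L p = ?R p) \<longleftrightarrow> ?L (layers d) = ?R (layers d) \<and> (\<forall>p\<in>{1..<layers d}. ?L p = ?R p)"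
    by (simp only: ball_simps)
  also have "\<dots> \<longleftrightarrow>
     (\<forall>s\<in>{1..length (wMvars d)}. \<sigma> (Ver (layers d) 0 s) = colour d I (offsetI d (layers d) + s)) \<and>
     (\<forall>p\<in>{1..<layers d}. (\<forall>r\<in>{1..nrows d (p + 1)}. \<sigma> (Hor (p + 1) r 0) = \<sigma> (Ver p 0 (length (wIvars d p) + r))) \<and>
      (\<forall>s\<in>{1..length (wIvars d p)}. \<sigma> (Ver p 0 s) = colour d I (offsetI d p + s)) \<and>
      (\<forall>s\<in>{1..length (wIIvars d p)}.
        \<sigma> (Ver p 0 (length (wIvars d p) + nrows d (p + 1) + s)) = colour d I (offsetII d p + s)))"
    by (intro arg_cong2[of _ _ _ _ "(\<and>)"] ball_cong refl M lt) auto
  finally show ?thesis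
    unfolding boundary_conditions_def by (simp only: ball_conj_distrib conj_ac)
qed

section \<open>Layers as kernels\<close>

context vertex_model
begin

text \<open>\<open>Y\<close> is the word on the left edges of layer p, shared with layer p - 1;
  \<open>X\<close> is the word on those top edges that continue as left edges of layer p +
  1.\<close>

definition layer_kernel :: "pf_data \<Rightarrow> (nat \<Rightarrow> nat set) \<Rightarrow> (nat \<Rightarrow> complex) \<Rightarrow> nat \<Rightarrow> nat list \<Rightarrow> nat list \<Rightarrow> complex" where
  "layer_kernel d I lam p Y X = grid (layers d) (zvars d p) (column_vars d p) (shifted_lam \<gamma> d I lam p) Y
     (replicate (ncols d p) (p + 1)) (replicate (nrows d p) (p + 1)) (top_word d I p X)"

lemma replicate_mem_words [simp]: "replicate n x \<in> words M n \<longleftrightarrow> n = 0 \<or> x \<in> colours M"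
  by (auto simp: words_def)

lemma dyn_param_eq:
  assumes "r \<in> {1..nrows d p}" "s \<in> {1..ncols d p}"
  shows "dyn_param \<gamma> d I lam \<sigma> p r s =
     sh (sh (shifted_lam \<gamma> d I lam p) (take (r - 1) (map (\<lambda>r. \<sigma> (Hor p r 0)) [1..<Suc (nrows d p)])))
       (take (s - 1) (map (\<lambda>s. \<sigma> (Ver p (r - 1) s)) [1..<Suc (ncols d p)]))"
proof -
  have *: "of_nat (count (mset (take (m - 1) (map f [1..<Suc n]))) a) = (\<Sum>i=1..<m. mu (f i) a)"
    if "m \<in> {1..n}" for f :: "nat \<Rightarrow> nat" and m n a
  proof -
    have "of_nat (count (mset (take (m - 1) (map f [1..<Suc n]))) a) = (\<Sum>i<m - 1. mu (f (Suc i)) a)"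
      using that unfolding of_nat_count_list by (intro sum.cong) (auto simp del: upt_Suc)
    also have "\<dots> = (\<Sum>i=1..<m. mu (f i) a)"
      by (rule sum.reindex_bij_witness[of _ "\<lambda>i. i - 1" Suc]) auto
    finally show ?thesis .
  qed
  show ?thesis
    unfolding fun_eq_iff dyn_param_def dyn_shift_def by (simp only: *[OF assms(1)] *[OF assms(2)]) simp
qed

text \<open>Expanding the kernels into sums over paths, first by levels and then along each row, and
  distributing products over sums gives a sum over triples (T, V, H): interface words, words on the
  levels of vertical edges, and horizontal paths. Such triples correspond bijectively to the
  states.\<close>

lemma psi_eq_chain_sum:
  assumes adm: "admissible d I" and M: "layers d \<ge> 1"
  shows "psi \<tau> \<gamma> d I lam = chain_sum (layer_kernel d I lam) (\<lambda>p. words (layers d) (interface_size d (Suc p)))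
     (layers d) (replicate (length (zvars d 1)) 1) []"
proof -
  let ?M = "layers d" and ?N = "ncols d" and ?k = "nrows d"
  let ?lam = "shifted_lam \<gamma> d I lam"
  define TT where "TT = {T \<in> Pi\<^sub>E {0..?M} (\<lambda>p. words ?M (interface_size d (Suc p))).
     T 0 = replicate (length (zvars d 1)) 1 \<and> T ?M = []}"
  \<comment> \<open>Some edges are recorded twice: left edges in \<open>T\<close> and in
    \<open>H\<close>, edges on an interface also in the top level of \<open>V\<close>. The
    prescribed ends of the paths in \<open>VV\<close> and \<open>HH\<close> keep these records
    consistent.\<close>
  define VV where "VV T p = {v \<in> Pi\<^sub>E {0..?k p} (\<lambda>_. words ?M (?N p)). v 0 = top_word d I p (T p) \<and> v (?k p) = replicate (?N p) (p + 1)}"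
    for T :: "nat \<Rightarrow> nat list" and p
  define HH where "HH T p r = {h \<in> Pi\<^sub>E {0..?N p} (\<lambda>_. colours ?M). h 0 = T (p - 1) ! (r - 1) \<and> h (?N p) = p + 1}"
    for T :: "nat \<Rightarrow> nat list" and p r
  let ?w = "\<lambda>T V H p r s. weight \<tau> \<gamma> (zvars d p ! (r - 1)) (column_vars d p ! (s - 1))
     (sh (sh (?lam p) (take (r - 1) (T (p - 1)))) (take (s - 1) (V p (r - 1))))
     (H p r (s - 1)) (V p r ! (s - 1)) (H p r s) (V p (r - 1) ! (s - 1))"
  have fin: "finite TT" "finite (VV T p)" "finite (HH T p r)" for T p r
    unfolding TT_def VV_def HH_def by (auto simp: finite_PiE)
  have len: "length (T (p - 1)) = ?k p" if "T \<in> TT" "p \<in> {1..?M}" for T p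
    using that by (auto simp: TT_def PiE_iff words_def interface_size_def nrows_def)
  have kernel: "layer_kernel d I lam p (T (p - 1)) (T p) =
      (\<Sum>v\<in>VV T p. \<Sum>h\<in>Pi\<^sub>E {1..?k p} (HH T p). \<Prod>r=1..?k p. \<Prod>s=1..?N p. ?w T (\<lambda>_. v) (\<lambda>_. h) p r s)"
    if T: "T \<in> TT" and p: "p \<in> {1..?M}" for T p
  proof -
    have c: "p + 1 \<in> colours ?M" using p by (auto simp: colours_def)
    have tw: "top_word d I p (T p) \<in> words ?M (?N p)"
      using T p by (intro top_word_mem[OF adm]) (auto simp: TT_def PiE_iff)
    have "layer_kernel d I lam p (T (p - 1)) (T p) =
      (\<Sum>v\<in>VV T p. \<Prod>r=1..?k p. row ?M (zvars d p ! (r - 1)) (column_vars d p) (sh (?lam p) (take (r - 1) (T (p - 1)))) (T (p - 1) ! (r - 1)) (v r) (replicate (?k p) (p + 1) ! (r - 1)) (v (r - 1)))"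
      unfolding layer_kernel_def using len[OF T p] tw c
      by (subst grid_chain_sum) (auto simp: nrows_def ncols_def chain_sum_def VV_def)
    also have "\<dots> = (\<Sum>v\<in>VV T p. \<Prod>r=1..?k p. \<Sum>h\<in>HH T p r. \<Prod>s=1..?N p. ?w T (\<lambda>_. v) (\<lambda>_ _. h) p r s)"
    proof (intro sum.cong prod.cong refl)
      fix v r assume v: "v \<in> VV T p" and r: "r \<in> {1..?k p}"
      have "T \<in> Pi\<^sub>E {0..?M} (\<lambda>p. words ?M (interface_size d (Suc p)))"
        using T by (simp add: TT_def)
      from PiE_mem[OF this, of "p - 1"] p have "T (p - 1) \<in> words ?M (?k p)"
        by (simp add: interface_size_def nrows_def) (use p in linarith)
      then have a: "T (p - 1) ! (r - 1) \<in> colours ?M"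
        using r by (auto simp: words_def subset_iff)
      have "r - 1 \<in> {0..?k p}" using r by auto
      then have vl: "length (v r) = ?N p" "length (v (r - 1)) = ?N p"
        using v r by (auto simp: VV_def PiE_iff words_def)
      show "row ?M (zvars d p ! (r - 1)) (column_vars d p) (sh (?lam p) (take (r - 1) (T (p - 1)))) (T (p - 1) ! (r - 1)) (v r) (replicate (?k p) (p + 1) ! (r - 1)) (v (r - 1))
        = (\<Sum>h\<in>HH T p r. \<Prod>s=1..?N p. ?w T (\<lambda>_. v) (\<lambda>_ _. h) p r s)"
        using a c vl r by (subst row_chain_sum) (auto simp: ncols_def chain_sum_def HH_def)
    qed
    also have "\<dots> = (\<Sum>v\<in>VV T p. \<Sum>h\<in>Pi\<^sub>E {1..?k p} (HH T p). \<Prod>r=1..?k p. \<Prod>s=1..?N p. ?w T (\<lambda>_. v) (\<lambda>_. h) p r s)"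
      using fin by (intro sum.cong refl, subst prod_sum_PiE) auto
    finally show ?thesis .
  qed
  let ?S = "SIGMA T:TT. SIGMA V:Pi\<^sub>E {1..?M} (VV T). Pi\<^sub>E {1..?M} (\<lambda>p. Pi\<^sub>E {1..?k p} (HH T p))"
  have "chain_sum (layer_kernel d I lam) (\<lambda>p. words ?M (interface_size d (Suc p)))
     ?M (replicate (length (zvars d 1)) 1) [] = (\<Sum>T\<in>TT. \<Prod>p=1..?M. layer_kernel d I lam p (T (p - 1)) (T p))"
    by (simp add: chain_sum_def TT_def)
  also have "\<dots> = (\<Sum>T\<in>TT. \<Prod>p=1..?M. \<Sum>v\<in>VV T p. \<Sum>h\<in>Pi\<^sub>E {1..?k p} (HH T p). \<Prod>r=1..?k p. \<Prod>s=1..?N p. ?w T (\<lambda>_. v) (\<lambda>_. h) p r s)"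
    by (intro sum.cong prod.cong refl kernel)
  also have "\<dots> = (\<Sum>T\<in>TT. \<Sum>V\<in>Pi\<^sub>E {1..?M} (VV T). \<Sum>H\<in>Pi\<^sub>E {1..?M} (\<lambda>p. Pi\<^sub>E {1..?k p} (HH T p)).
      \<Prod>p=1..?M. \<Prod>r=1..?k p. \<Prod>s=1..?N p. ?w T V H p r s)"
    using fin by (intro sum.cong refl) (simp add: prod_sum_PiE finite_PiE)
  also have "\<dots> = (\<Sum>(T, V, H)\<in>?S. \<Prod>p=1..?M. \<Prod>r=1..?k p. \<Prod>s=1..?N p. ?w T V H p r s)"
    using fin by (simp add: sum.Sigma finite_PiE finite_SigmaI)
  finally have eq: "chain_sum (layer_kernel d I lam) (\<lambda>p. words ?M (interface_size d (Suc p)))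
     ?M (replicate (length (zvars d 1)) 1) [] = (\<Sum>(T, V, H)\<in>?S. \<Prod>p=1..?M. \<Prod>r=1..?k p. \<Prod>s=1..?N p. ?w T V H p r s)" .
  \<comment> \<open>The three readings of a state and, as \<open>state_of\<close>, their common
    inverse. Everything is restricted to its index set, so that the round trips are equalities of
    functions and not merely equalities on the index sets.\<close>
  define tT where "tT \<sigma> = (\<lambda>p\<in>{0..?M}. map (\<lambda>r. \<sigma> (Hor (Suc p) r 0)) [1..<Suc (interface_size d (Suc p))])" for \<sigma> :: "edge \<Rightarrow> nat"
  define tV where "tV \<sigma> = (\<lambda>p\<in>{1..?M}. \<lambda>r\<in>{0..?k p}. map (\<lambda>s. \<sigma> (Ver p r s)) [1..<Suc (?N p)])" for \<sigma> :: "edge \<Rightarrow> nat"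
  define tH where "tH \<sigma> = (\<lambda>p\<in>{1..?M}. \<lambda>r\<in>{1..?k p}. \<lambda>s\<in>{0..?N p}. \<sigma> (Hor p r s))" for \<sigma> :: "edge \<Rightarrow> nat"
  define state_of where "state_of x = (\<lambda>e\<in>edges d. case e of Hor p r s \<Rightarrow> snd (snd x) p r s | Ver p r s \<Rightarrow> fst (snd x) p r ! (s - 1))"
    for x :: "(nat \<Rightarrow> nat list) \<times> (nat \<Rightarrow> nat \<Rightarrow> nat list) \<times> (nat \<Rightarrow> nat \<Rightarrow> nat \<Rightarrow> nat)"
  have tTp: "tT \<sigma> (p - 1) = map (\<lambda>r. \<sigma> (Hor p r 0)) [1..<Suc (?k p)]" if "p \<in> {1..?M}" for p \<sigma>
    using that by (auto simp: tT_def interface_size_def nrows_def simp del: upt_Suc)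
  show ?thesis
    unfolding eq psi_def
  proof (rule sum.reindex_bij_witness[where i = state_of and j = "\<lambda>\<sigma>. (tT \<sigma>, tV \<sigma>, tH \<sigma>)"])
    fix \<sigma> assume "\<sigma> \<in> states d I"
    then have \<sigma>: "\<sigma> \<in> edges d \<rightarrow>\<^sub>E {1..?M + 1}" and bc: "boundary_conditions d I \<sigma>" by (auto simp: states_def)
    have bc_right: "\<sigma> (Hor p r (?N p)) = p + 1" if "p \<in> {1..?M}" "r \<in> {1..?k p}" for p r
      using bc that unfolding boundary_conditions_def by blast
    have bc_bottom: "\<sigma> (Ver p (?k p) s) = p + 1" if "p \<in> {1..?M}" "s \<in> {1..?N p}" for p s
      using bc that unfolding boundary_conditions_def by blast
    have bc_left: "\<sigma> (Hor 1 r 0) = 1" if "r \<in> {1..?k 1}" for r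
      using bc that unfolding boundary_conditions_def by blast
    have bc_top: "map (\<lambda>s. \<sigma> (Ver p 0 s)) [1..<Suc (?N p)] =
        top_word d I p (map (\<lambda>r. \<sigma> (Hor (Suc p) r 0)) [1..<Suc (interface_size d (Suc p))])" if "p \<in> {1..?M}" for p
      using bc that unfolding boundary_conditions_top[OF M] by blast
    have hor: "\<sigma> (Hor p r s) \<in> colours ?M" if "p \<in> {1..?M}" "r \<in> {1..?k p}" "s \<in> {0..?N p}" for p r s
      using \<sigma> that by (auto simp: edges_def colours_def PiE_iff)
    have ver: "\<sigma> (Ver p r s) \<in> colours ?M" if "p \<in> {1..?M}" "r \<in> {0..?k p}" "s \<in> {1..?N p}" for p r s
      using \<sigma> that by (auto simp: edges_def colours_def PiE_iff)
    show "state_of (tT \<sigma>, tV \<sigma>, tH \<sigma>) = \<sigma>"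
    proof
      fix e
      show "state_of (tT \<sigma>, tV \<sigma>, tH \<sigma>) e = \<sigma> e"
      proof (cases "e \<in> edges d")
        case True
        then show ?thesis
          by (cases e) (auto simp: state_of_def tV_def tH_def edges_def simp del: upt_Suc)
      next
        case False
        then show ?thesis using \<sigma> by (auto simp: state_of_def PiE_iff extensional_def)
      qed
    qed
    have "tT \<sigma> \<in> TT"
    proof -
      have "tT \<sigma> 0 = replicate (length (zvars d 1)) 1"
        using tTp[of 1 \<sigma>] M bc_left by (intro nth_equalityI) (simp_all add: nrows_def del: upt_Suc)
      moreover have "tT \<sigma> ?M = []" by (simp add: tT_def interface_size_def)
      moreover have "tT \<sigma> p \<in> words ?M (interface_size d (Suc p))" if "p \<le> ?M" for p
        using that hor[of "Suc p"] by (auto simp: tT_def words_def interface_size_def nrows_def simp del: upt_Suc split: if_splits)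
      ultimately show ?thesis by (auto simp: TT_def tT_def)
    qed
    moreover have "tV \<sigma> \<in> Pi\<^sub>E {1..?M} (VV (tT \<sigma>))"
    proof (rule PiE_I)
      fix p assume p: "p \<in> {1..?M}"
      have "tV \<sigma> p 0 = top_word d I p (tT \<sigma> p)"
        using bc_top[OF p] p by (simp add: tV_def tT_def del: upt_Suc)
      moreover have "tV \<sigma> p (?k p) = replicate (?N p) (p + 1)"
        using bc_bottom[OF p] p by (intro nth_equalityI) (simp_all add: tV_def del: upt_Suc)
      moreover have "tV \<sigma> p r \<in> words ?M (?N p)" if "r \<le> ?k p" for r
        using p that ver[of p r] by (auto simp: tV_def words_def simp del: upt_Suc)
      ultimately show "tV \<sigma> p \<in> VV (tT \<sigma>) p" using p by (auto simp: VV_def tV_def)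
    qed (auto simp: tV_def)
    moreover have "tH \<sigma> \<in> Pi\<^sub>E {1..?M} (\<lambda>p. Pi\<^sub>E {1..?k p} (HH (tT \<sigma>) p))"
    proof (intro PiE_I)
      fix p r assume p: "p \<in> {1..?M}" and r: "r \<in> {1..?k p}"
      have "tH \<sigma> p r 0 = tT \<sigma> (p - 1) ! (r - 1)"
        using p r by (subst tTp) (auto simp: tH_def simp del: upt_Suc)
      moreover have "tH \<sigma> p r (?N p) = p + 1"
        using bc_right[OF p r] p r by (simp add: tH_def)
      ultimately show "tH \<sigma> p r \<in> HH (tT \<sigma>) p r"
        using p r hor[OF p r] by (auto simp: HH_def tH_def)
    qed (auto simp: tH_def)
    ultimately show "(tT \<sigma>, tV \<sigma>, tH \<sigma>) \<in> ?S" by blast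
    show "(case (tT \<sigma>, tV \<sigma>, tH \<sigma>) of (T, V, H) \<Rightarrow> \<Prod>p=1..?M. \<Prod>r=1..?k p. \<Prod>s=1..?N p. ?w T V H p r s) =
      (\<Prod>p = 1..layers d. \<Prod>r = 1..nrows d p. \<Prod>s = 1..ncols d p.
            weight \<tau> \<gamma> (entry (zvars d p) r) (entry (column_vars d p) s)
              (dyn_param \<gamma> d I lam \<sigma> p r s) (\<sigma> (Hor p r (s - 1))) (\<sigma> (Ver p r s))
              (\<sigma> (Hor p r s)) (\<sigma> (Ver p (r - 1) s)))"
      unfolding prod.case
    proof (intro prod.cong refl)
      fix p r s assume p: "p \<in> {1..?M}" and r: "r \<in> {1..?k p}" and s: "s \<in> {1..?N p}"
      have r1: "r - 1 \<in> {0..?k p}" "r \<in> {0..?k p}" and s1: "s - 1 \<in> {0..?N p}" "s \<in> {0..?N p}" using r s by auto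
      have V: "tV \<sigma> p r = map (\<lambda>s. \<sigma> (Ver p r s)) [1..<Suc (?N p)]" "tV \<sigma> p (r - 1) = map (\<lambda>s. \<sigma> (Ver p (r - 1) s)) [1..<Suc (?N p)]"
        using p r1 by (simp_all add: tV_def del: upt_Suc)
      have V': "tV \<sigma> p r ! (s - 1) = \<sigma> (Ver p r s)" "tV \<sigma> p (r - 1) ! (s - 1) = \<sigma> (Ver p (r - 1) s)"
        unfolding V using s by (auto simp del: upt_Suc)
      have H: "tH \<sigma> p r (s - 1) = \<sigma> (Hor p r (s - 1))" "tH \<sigma> p r s = \<sigma> (Hor p r s)"
        using p r s1 by (simp_all add: tH_def)
      show "?w (tT \<sigma>) (tV \<sigma>) (tH \<sigma>) p r s = weight \<tau> \<gamma> (entry (zvars d p) r) (entry (column_vars d p) s)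
              (dyn_param \<gamma> d I lam \<sigma> p r s) (\<sigma> (Hor p r (s - 1))) (\<sigma> (Ver p r s))
              (\<sigma> (Hor p r s)) (\<sigma> (Ver p (r - 1) s))"
        unfolding V' H unfolding dyn_param_eq[OF r s] V(2) tTp[OF p] entry_def ..
    qed
  next
    fix x assume x: "x \<in> ?S"
    then obtain T V H where [simp]: "x = (T, V, H)" and T: "T \<in> TT" and V: "V \<in> Pi\<^sub>E {1..?M} (VV T)"
      and H: "H \<in> Pi\<^sub>E {1..?M} (\<lambda>p. Pi\<^sub>E {1..?k p} (HH T p))"
      by blast
    let ?\<sigma> = "state_of x"
    have Hh: "H p r \<in> HH T p r" if "p \<in> {1..?M}" "r \<in> {1..?k p}" for p r
      using H that by (auto simp: PiE_iff)
    have Vv: "V p \<in> VV T p" if "p \<in> {1..?M}" for p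
      using V that by (auto simp: PiE_iff)
    have Vw: "V p r \<in> words ?M (?N p)" if "p \<in> {1..?M}" "r \<in> {0..?k p}" for p r
      using Vv[OF that(1)] that(2) by (auto simp: VV_def PiE_iff)
    have hor: "?\<sigma> (Hor p r s) = H p r s" if "p \<in> {1..?M}" "r \<in> {1..?k p}" "s \<in> {0..?N p}" for p r s
      using that by (auto simp: state_of_def edges_def)
    have ver: "?\<sigma> (Ver p r s) = V p r ! (s - 1)" if "p \<in> {1..?M}" "r \<in> {0..?k p}" "s \<in> {1..?N p}" for p r s
      using that by (auto simp: state_of_def edges_def)
    have H0: "H p r 0 = T (p - 1) ! (r - 1)" if "p \<in> {1..?M}" "r \<in> {1..?k p}" for p r
      using Hh[OF that] by (simp add: HH_def)
    have Tlen: "length (T p) = interface_size d (Suc p)" if "p \<le> ?M" for p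
      using T that by (auto simp: TT_def PiE_iff words_def)
    have tT: "tT ?\<sigma> = T"
    proof
      fix p
      show "tT ?\<sigma> p = T p"
      proof (cases "p \<le> ?M")
        case True
        then have "map (\<lambda>r. ?\<sigma> (Hor (Suc p) r 0)) [1..<Suc (interface_size d (Suc p))] = T p"
          using Tlen[of p] hor[of "Suc p" _ 0] H0[of "Suc p"]
          by (intro nth_equalityI) (auto simp: interface_size_def nrows_def simp del: upt_Suc split: if_splits)
        then show ?thesis using True by (simp add: tT_def del: upt_Suc)
      next
        case False
        then show ?thesis using T by (auto simp: tT_def TT_def PiE_iff extensional_def)
      qed
    qed
    have tV: "tV ?\<sigma> = V"
    proof (intro ext)
      fix p r
      show "tV ?\<sigma> p r = V p r"
      proof (cases "p \<in> {1..?M}")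
        case p: True
        show ?thesis
        proof (cases "r \<in> {0..?k p}")
          case True
          then show ?thesis using p Vw[OF p True] ver[OF p True]
            by (intro nth_equalityI) (auto simp: tV_def words_def simp del: upt_Suc)
        next
          case False
          then show ?thesis using p Vv[OF p] by (auto simp: tV_def VV_def PiE_iff extensional_def)
        qed
      next
        case False
        then have "tV ?\<sigma> p = undefined" "V p = undefined" using V by (auto simp: tV_def PiE_iff extensional_def)
        then show ?thesis by simp
      qed
    qed
    have tH: "tH ?\<sigma> = H"
    proof (intro ext)
      fix p r s
      show "tH ?\<sigma> p r s = H p r s"
      proof (cases "p \<in> {1..?M}")
        case p: True
        show ?thesis
        proof (cases "r \<in> {1..?k p}")
          case r: True
          show ?thesis
          proof (cases "s \<in> {0..?N p}")
            case True
            then show ?thesis using p r hor by (auto simp: tH_def)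
          next
            case False
            then show ?thesis using p r Hh[OF p r] by (auto simp: tH_def HH_def PiE_iff extensional_def)
          qed
        next
          case False
          moreover have "H p \<in> Pi\<^sub>E {1..?k p} (HH T p)" using H p by (auto simp: PiE_iff)
          ultimately have "tH ?\<sigma> p r = undefined" "H p r = undefined" using p by (auto simp: tH_def PiE_iff extensional_def)
          then show ?thesis by simp
        qed
      next
        case False
        then have "tH ?\<sigma> p = undefined" "H p = undefined" using H by (auto simp: tH_def PiE_iff extensional_def)
        then show ?thesis by simp
      qed
    qed
    show "(tT ?\<sigma>, tV ?\<sigma>, tH ?\<sigma>) = x" using tT tV tH by simp
    have "?\<sigma> \<in> edges d \<rightarrow>\<^sub>E {1..?M + 1}"
    proof (rule PiE_I)
      fix e assume e: "e \<in> edges d"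
      then show "?\<sigma> e \<in> {1..?M + 1}"
      proof (cases e)
        case (Hor p r s)
        then have "p \<in> {1..?M}" "r \<in> {1..?k p}" "s \<in> {0..?N p}" using e by (auto simp: edges_def)
        then show ?thesis using Hor Hh[of p r] hor[of p r s] by (auto simp: HH_def PiE_iff colours_def)
      next
        case (Ver p r s)
        then have ps: "p \<in> {1..?M}" "r \<in> {0..?k p}" "s \<in> {1..?N p}" using e by (auto simp: edges_def)
        then have "V p r ! (s - 1) \<in> set (V p r)" using Vw[OF ps(1,2)] by (auto simp: words_def)
        then show ?thesis using Ver Vw[OF ps(1,2)] ver[OF ps] by (auto simp: words_def colours_def)
      qed
    qed (simp add: state_of_def)
    moreover have "boundary_conditions d I ?\<sigma>"
      unfolding boundary_conditions_top[OF M]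
    proof (intro conjI ballI)
      fix p r assume "p \<in> {1..?M}" "r \<in> {1..?k p}"
      then show "?\<sigma> (Hor p r (?N p)) = p + 1" using hor[of p r "?N p"] Hh[of p r] by (auto simp: HH_def)
    next
      fix p s assume ps: "p \<in> {1..?M}" "s \<in> {1..?N p}"
      then show "?\<sigma> (Ver p (?k p) s) = p + 1" using ver[of p "?k p" s] Vv[of p] by (auto simp: VV_def)
    next
      fix r assume r: "r \<in> {1..?k 1}"
      then show "?\<sigma> (Hor 1 r 0) = 1" using hor[of 1 r 0] H0[of 1 r] M T by (auto simp: TT_def nrows_def)
    next
      fix p assume p: "p \<in> {1..?M}"
      have "map (\<lambda>s. ?\<sigma> (Ver p 0 s)) [1..<Suc (?N p)] = V p 0"
        using fun_cong[OF fun_cong[OF tV, of p], of 0] p by (simp add: tV_def del: upt_Suc)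
      also have "\<dots> = top_word d I p (T p)" using Vv[OF p] by (simp add: VV_def)
      also have "T p = map (\<lambda>r. ?\<sigma> (Hor (Suc p) r 0)) [1..<Suc (interface_size d (Suc p))]"
        using fun_cong[OF tT, of p] p by (simp add: tT_def del: upt_Suc)
      finally show "map (\<lambda>s. ?\<sigma> (Ver p 0 s)) [1..<Suc (?N p)] =
        top_word d I p (map (\<lambda>r. ?\<sigma> (Hor (Suc p) r 0)) [1..<Suc (interface_size d (Suc p))])" .
    qed
    ultimately show "?\<sigma> \<in> states d I" by (simp add: states_def)
  qed
qed

end

section \<open>Invariance under permutations\<close>

lemma mset_eq_imp_invariant:
  assumes swap: "\<And>A x y B. F (A @ [x, y] @ B) = F (A @ [y, x] @ B)" and "mset xs = mset ys"
  shows "F xs = F ys"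
proof -
  \<comment> \<open>Adjacent swaps carry one entry to the front. The arbitrary prefix
    \<open>C\<close> is what allows the subsequent induction on the list to treat entries already
    placed as fixed.\<close>
  have move: "F (C @ A @ [x] @ B) = F (C @ [x] @ A @ B)" for A B C x
  proof (induction A arbitrary: C)
    case (Cons a A)
    have "F (C @ (a # A) @ [x] @ B) = F ((C @ [a]) @ A @ [x] @ B)" by simp
    also have "\<dots> = F (C @ [a, x] @ A @ B)" using Cons[of "C @ [a]"] by simp
    also have "\<dots> = F (C @ [x, a] @ A @ B)" by (rule swap)
    finally show ?case by simp
  qed simp
  have "F (C @ xs) = F (C @ ys)" if "mset xs = mset ys" for C ys
    using that
  proof (induction xs arbitrary: C ys)
    case (Cons x xs)
    then have "x \<in> set ys" by (metis list.set_intros(1) mset_eq_setD)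
    then obtain A B where ys: "ys = A @ x # B" by (meson split_list)
    have "F (C @ x # xs) = F ((C @ [x]) @ (A @ B))"
      using Cons.IH[of "A @ B" "C @ [x]"] Cons.prems ys by simp
    also have "\<dots> = F (C @ ys)" using move[of C A x B] ys by simp
    finally show ?case .
  qed simp
  from this[OF assms(2), of "[]"] show ?thesis by simp
qed

section \<open>Changing the z-variables; the shifted dynamical variables\<close>

lemma colour_update [simp]:
  "colour (d\<lparr>zvars := z\<rparr>) I = colour d I"
  "offsetI (d\<lparr>zvars := z\<rparr>) = offsetI d" "offsetII (d\<lparr>zvars := z\<rparr>) = offsetII d"
  "Ihat (d\<lparr>zvars := z\<rparr>) = Ihat d"
  "layer_coords (d\<lparr>zvars := z\<rparr>) = layer_coords d"
  "coordsI (d\<lparr>zvars := z\<rparr>) = coordsI d"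
  by (simp_all add: fun_eq_iff colour_def Ihat_def layer_coords_def coordsI_def coordsII_def coordsM_def offsetI_def offsetII_def)

lemma col_update [simp]:
  "colI (d\<lparr>zvars := z\<rparr>) I = colI d I" "colII (d\<lparr>zvars := z\<rparr>) I = colII d I" "colM (d\<lparr>zvars := z\<rparr>) I = colM d I"
  "top_word (d\<lparr>zvars := z\<rparr>) I = top_word d I"
  by (simp_all add: fun_eq_iff colI_def colII_def colM_def top_word_def del: upt_Suc)

lemma shifted_lam_update [simp]: "shifted_lam \<gamma> (d\<lparr>zvars := z\<rparr>) I lam = shifted_lam \<gamma> d I lam"
  by (simp add: fun_eq_iff shifted_lam_def)

lemma admissible_update_zvars:
  assumes "admissible d I" "\<And>p. p \<in> {1..layers d} \<Longrightarrow> length (z p) = length (zvars d p)"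
  shows "admissible (d\<lparr>zvars := z\<rparr>) I"
  using assms by (auto simp: admissible_def colouring_def tuple_of_colouring_def)

lemma shifted_lam_top: "shifted_lam \<gamma> d I lam (layers d) = lam"
  by (simp add: shifted_lam_def fun_eq_iff)

lemma count_colI: "of_nat (count (mset (colI d I p)) a) = (\<Sum>c\<in>coordsI d p. mu (colour d I c) a)"
proof -
  have "of_nat (count (mset (colI d I p)) a) = (\<Sum>i<length (wIvars d p). mu (colour d I (offsetI d p + Suc i)) a)"
    unfolding of_nat_count_list by (intro sum.cong) (simp_all add: colI_def del: upt_Suc)
  also have "\<dots> = (\<Sum>c\<in>coordsI d p. mu (colour d I c) a)"
    by (rule sum.reindex_bij_witness[of _ "\<lambda>c. c - Suc (offsetI d p)" "\<lambda>i. offsetI d p + Suc i"]) (auto simp: coordsI_def)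
  finally show ?thesis .
qed

text \<open>This is the reason for the shift in \<lambda>^[p]: behind the first block of w-columns
  of layer p the parameter is the one at the upper left corner of layer p + 1, so a crossing sees
  the same parameter from both layers.\<close>

lemma dyn_shift_colI:
  assumes "p \<in> {1..<layers d}"
  shows "dyn_shift \<gamma> (shifted_lam \<gamma> d I lam p) (colI d I p) = shifted_lam \<gamma> d I lam (Suc p)"
proof -
  have "(\<Union>q\<in>{p..<layers d}. coordsI d q) = coordsI d p \<union> (\<Union>q\<in>{Suc p..<layers d}. coordsI d q)"
    using assms by (auto simp: atLeastLessThan_def atLeast_Suc_greaterThan le_less)
  moreover have "coordsI d p \<inter> (\<Union>q\<in>{Suc p..<layers d}. coordsI d q) = {}"
  proof -
    have "coordsI d p \<inter> coordsI d q = {}" if "q \<in> {Suc p..<layers d}" for q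
      using that offsetI_less[of p q d] assms by (auto simp: coordsI_def)
    then show ?thesis by blast
  qed
  moreover have "finite (coordsI d q)" for q by (simp add: coordsI_def)
  ultimately have "(\<Sum>c\<in>(\<Union>q\<in>{p..<layers d}. coordsI d q). mu (colour d I c) a) =
     (\<Sum>c\<in>coordsI d p. mu (colour d I c) a) + (\<Sum>c\<in>(\<Union>q\<in>{Suc p..<layers d}. coordsI d q). mu (colour d I c) a)" for a
    by (simp only:) (rule sum.union_disjoint, simp_all)
  then show ?thesis
    by (simp add: fun_eq_iff dyn_shift_def shifted_lam_def count_colI algebra_simps)
qed

lemma generic_shifted_lam:
  "generic \<tau> \<gamma> M lam \<Longrightarrow> generic \<tau> \<gamma> M (shifted_lam \<gamma> d I lam p)"
proof (erule generic_integer_shift)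
  fix a
  show "shifted_lam \<gamma> d I lam p a = lam a + of_int (int (card {c\<in>(\<Union>q\<in>{p..<layers d}. coordsI d q). a = colour d I c})) * \<gamma>"
    by (simp add: shifted_lam_def mu_def coordsI_def sum.If_cases Int_def)
qed

section \<open>Recursion over the layers\<close>

context vertex_model
begin

text \<open>The sum over all layers up to p for a given word \<open>X\<close> on the interface
  above; at p = 0 it is the left boundary condition of layer 1. Sizes and kernels are arguments so
  that different data can be compared by \<open>lay_cong\<close>.\<close>

primrec lay :: "nat \<Rightarrow> (nat \<Rightarrow> nat) \<Rightarrow> (nat \<Rightarrow> nat list \<Rightarrow> nat list \<Rightarrow> complex) \<Rightarrow> nat \<Rightarrow> nat list \<Rightarrow> complex" where
  "lay M k K 0 X = (if X = replicate (k 1) 1 then 1 else 0)"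
| "lay M k K (Suc p) X = (\<Sum>Y\<in>words M (k (Suc p)). lay M k K p Y * K (Suc p) Y X)"

definition layers_sum :: "pf_data \<Rightarrow> (nat \<Rightarrow> nat set) \<Rightarrow> (nat \<Rightarrow> complex) \<Rightarrow> nat \<Rightarrow> nat list \<Rightarrow> complex" where
  "layers_sum d I lam = lay (layers d) (\<lambda>p. length (zvars d p)) (layer_kernel d I lam)"

lemma lay_cong:
  assumes "\<And>q Y X. q \<in> {1..p} \<Longrightarrow> K q Y X = K' q Y X" "\<And>q. q \<in> {1..p} \<Longrightarrow> k q = k' q" "k 1 = k' 1"
  shows "lay M k K p X = lay M k' K' p X"
  using assms by (induction p arbitrary: X) (auto intro!: sum.cong)

lemma chain_sum_layers:
  assumes "p < layers d" "X \<in> words (layers d) (interface_size d (Suc p))"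
  shows "chain_sum (layer_kernel d I lam) (\<lambda>p. words (layers d) (interface_size d (Suc p)))
     p (replicate (length (zvars d 1)) 1) X = layers_sum d I lam p X"
  using assms
proof (induction p arbitrary: X)
  case 0
  then show ?case
    by (subst chain_sum_0) (auto simp: interface_size_def layers_sum_def colours_def)
next
  case (Suc p)
  have "chain_sum (layer_kernel d I lam) (\<lambda>p. words (layers d) (interface_size d (Suc p)))
     (Suc p) (replicate (length (zvars d 1)) 1) X =
    (\<Sum>Y\<in>words (layers d) (length (zvars d (Suc p))). layers_sum d I lam p Y * layer_kernel d I lam (Suc p) Y X)"
    using Suc by (subst chain_sum_Suc) (auto simp: interface_size_def intro!: sum.cong)
  then show ?case by (simp add: layers_sum_def)
qed

text \<open>The top grid alone contains the variables w^(M), and the parameter at its corner is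
  unshifted. All properties are read off from this splitting.\<close>

lemma psi_layers:
  assumes "admissible d I" "layers d \<ge> 1"
  shows "psi \<tau> \<gamma> d I lam = (\<Sum>Y\<in>words (layers d) (length (zvars d (layers d))).
     layers_sum d I lam (layers d - 1) Y * grid (layers d) (zvars d (layers d)) (wMvars d) lam Y
       (replicate (length (wMvars d)) (layers d + 1)) (replicate (length (zvars d (layers d))) (layers d + 1)) (colM d I))"
proof -
  obtain m where m: "layers d = Suc m" using assms(2) by (cases "layers d") auto
  have "psi \<tau> \<gamma> d I lam = chain_sum (layer_kernel d I lam) (\<lambda>p. words (layers d) (interface_size d (Suc p)))
     (Suc m) (replicate (length (zvars d 1)) 1) []"
    using psi_eq_chain_sum[OF assms] m by simp
  also have "\<dots> = (\<Sum>Y\<in>words (layers d) (length (zvars d (layers d))).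
     layers_sum d I lam m Y * layer_kernel d I lam (Suc m) Y [])"
    using m chain_sum_layers[of m d _ I lam]
    by (subst chain_sum_Suc) (auto simp: interface_size_def intro!: sum.cong)
  finally show ?thesis
    using m shifted_lam_top[of \<gamma> d I lam]
    by (simp add: layer_kernel_def top_word_def column_vars_def ncols_def nrows_def)
qed

section \<open>Continuity and cancellation of a theta factor\<close>

lemma theta_continuous [continuous_intros]:
  assumes "continuous_on S f"
  shows "continuous_on S (\<lambda>x. theta \<tau> (f x))"
  using continuous_on_compose2[OF holomorphic_on_imp_continuous_on[OF theta_holomorphic[OF Im_tau]] assms] by simp

lemma weight_continuous:
  assumes "continuous_on S f" "continuous_on S g"
  shows "continuous_on S (\<lambda>x. weight \<tau> \<gamma> (f x) (g x) \<Lambda> a b c e)"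
proof -
  have if_const: "continuous_on S (\<lambda>x. if P then f x else g x)"
    if "continuous_on S f" "continuous_on S g" for P and f g :: "'a \<Rightarrow> complex"
    using that by (cases P) auto
  show ?thesis
    unfolding weight_def alpha_def beta_def divide_inverse by (intro if_const continuous_intros assms)
qed

text \<open>The zeros of a holomorphic function that does not vanish identically are isolated, so f
  and g agree on a punctured neighbourhood of x, and by continuity at x itself. The point x0
  witnesses that theta is not identically zero.\<close>

lemma theta_cancel:
  assumes "theta \<tau> x0 \<noteq> 0" "continuous_on UNIV f" "continuous_on UNIV g"
    and "\<And>x. theta \<tau> (x - c) * f x = theta \<tau> (x - c) * (g x :: complex)"
  shows "f x = g x"
proof (cases "theta \<tau> (x - c) = 0")
  case True
  have "(\<lambda>x. theta \<tau> (x - c)) holomorphic_on UNIV"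
  proof -
    have "(\<lambda>x. x - c) holomorphic_on UNIV" by (intro holomorphic_intros)
    from holomorphic_on_compose[OF this holomorphic_on_subset[OF theta_holomorphic[OF Im_tau]]]
    show ?thesis by (simp add: o_def)
  qed
  then obtain r where r: "r > 0" "\<And>y. y \<in> ball x r - {x} \<Longrightarrow> theta \<tau> (y - c) \<noteq> 0"
    using isolated_zeros[of "\<lambda>x. theta \<tau> (x - c)" UNIV x "x0 + c"] True assms(1) by auto
  have "f y = g y" if "y \<in> ball x r - {x}" for y
    using assms(4)[of y] r(2)[OF that] by simp
  then have "\<forall>\<^sub>F y in at x. f y = g y"
    using r(1) by (auto simp: eventually_at dist_commute intro!: exI[of _ r])
  moreover have "(f \<longlongrightarrow> f x) (at x)" "(g \<longlongrightarrow> g x) (at x)"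
    using assms(2,3) by (auto simp: continuous_on_eq_continuous_at isCont_def)
  ultimately show ?thesis
    by (metis tendsto_cong tendsto_unique trivial_limit_at)
next
  case False
  then show ?thesis using assms(4)[of x] by simp
qed

text \<open>States and dynamical parameters depend on the lengths of the lists only. The list
  \<open>zs x\<close> enters the weights as row variables of layer m and as column variables of
  layer m - 1.\<close>

lemma psi_continuous:
  assumes "\<And>x. length (zs x) = n" "\<And>i. i < n \<Longrightarrow> continuous_on UNIV (\<lambda>x. zs x ! i)"
  shows "continuous_on UNIV (\<lambda>x :: complex. psi \<tau> \<gamma> (d\<lparr>zvars := (zvars d)(m := zs x)\<rparr>) I lam)"
proof -
  let ?d = "\<lambda>x. d\<lparr>zvars := (zvars d)(m := zs x)\<rparr>"
  have nr: "nrows (?d x) = nrows (?d 0)" for x by (auto simp: nrows_def assms(1) fun_eq_iff)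
  have nc: "ncols (?d x) = ncols (?d 0)" for x by (auto simp: ncols_def column_vars_def assms(1) fun_eq_iff)
  have st: "states (?d x) I = states (?d 0) I" for x
  proof -
    have e: "edges (?d x) = edges (?d 0)"
      unfolding edges_def nr[of x] nc[of x] by simp
    have b: "boundary_conditions (?d x) I = boundary_conditions (?d 0) I"
      unfolding boundary_conditions_def[abs_def] nr[of x] nc[of x] by simp
    show ?thesis unfolding states_def e b by simp
  qed
  have fin: "finite (states (?d 0) I)"
  proof -
    have "edges (?d 0) \<subseteq> (\<lambda>(p, r, s). Hor p r s) ` (SIGMA p:{1..layers d}. SIGMA r:{1..nrows (?d 0) p}. {0..ncols (?d 0) p}) \<union>
       (\<lambda>(p, r, s). Ver p r s) ` (SIGMA p:{1..layers d}. SIGMA r:{0..nrows (?d 0) p}. {1..ncols (?d 0) p})"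
      by (auto simp: edges_def image_iff)
    then have "finite (edges (?d 0))"
      by (rule finite_subset) auto
    then show ?thesis by (simp add: states_def finite_PiE)
  qed
  have z: "continuous_on UNIV (\<lambda>x. entry (zvars (?d x) p) r)" if "r \<in> {1..nrows (?d 0) p}" for p r
  proof (cases "p = m")
    case True
    then show ?thesis using that assms(2)[of "r - 1"] by (auto simp: entry_def nrows_def assms(1))
  next
    case False
    then show ?thesis by (simp add: entry_def)
  qed
  have w: "continuous_on UNIV (\<lambda>x. entry (column_vars (?d x) p) s)" if "s \<in> {1..ncols (?d 0) p}" for p s
  proof (cases "p < layers d \<and> p + 1 = m")
    case True
    have "s - 1 - length (wIvars d p) < n \<Longrightarrow> continuous_on UNIV (\<lambda>x. zs x ! (s - 1 - length (wIvars d p)))"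
      by (rule assms(2))
    with True show ?thesis
      by (cases "s - 1 < length (wIvars d p)"; cases "s - 1 - length (wIvars d p) < n")
        (auto simp: entry_def column_vars_def nth_append assms(1))
  next
    case False
    then show ?thesis by (cases "p < layers d") (auto simp: entry_def column_vars_def)
  qed
  have dp: "dyn_param \<gamma> (?d x) I lam \<sigma> p r s = dyn_param \<gamma> (?d 0) I lam \<sigma> p r s" for x \<sigma> p r s
    by (simp add: dyn_param_def fun_eq_iff)
  have ly: "layers (?d x) = layers d" for x by simp
  have "psi \<tau> \<gamma> (?d x) I lam = (\<Sum>\<sigma>\<in>states (?d 0) I. \<Prod>p=1..layers d. \<Prod>r=1..nrows (?d 0) p. \<Prod>s=1..ncols (?d 0) p.
     weight \<tau> \<gamma> (entry (zvars (?d x) p) r) (entry (column_vars (?d x) p) s) (dyn_param \<gamma> (?d 0) I lam \<sigma> p r s)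
       (\<sigma> (Hor p r (s - 1))) (\<sigma> (Ver p r s)) (\<sigma> (Hor p r s)) (\<sigma> (Ver p (r - 1) s)))" for x
    unfolding psi_def st[of x] dp[of x] nr[of x] nc[of x] ly[of x] ..
  then show ?thesis
    by (simp only:) (intro continuous_on_sum continuous_on_prod weight_continuous z w)
qed

section \<open>Symmetry in the z-variables of the top layer\<close>

lemma colI_colII_colM_words:
  assumes "admissible d I" "p \<in> {1..layers d}"
  shows "p < layers d \<Longrightarrow> colI d I p \<in> words (layers d) (length (wIvars d p))"
    and "p < layers d \<Longrightarrow> colII d I p \<in> words (layers d) (length (wIIvars d p))"
    and "colM d I \<in> words (layers d) (length (wMvars d))"
proof -
  have c: "colour d I c \<in> colours (layers d)" if "q \<in> {1..layers d}" "c \<in> layer_coords d q" for c q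
    using colour_bounds[OF assms(1) that] that by (auto simp: colours_def)
  show "p < layers d \<Longrightarrow> colI d I p \<in> words (layers d) (length (wIvars d p))"
    using c[OF assms(2)] by (auto simp: words_def colI_def layer_coords_def coordsI_def simp del: upt_Suc)
  show "p < layers d \<Longrightarrow> colII d I p \<in> words (layers d) (length (wIIvars d p))"
    using c[OF assms(2)] by (auto simp: words_def colII_def layer_coords_def coordsII_def simp del: upt_Suc)
  have "layers d \<in> {1..layers d}" using assms(2) by auto
  from c[OF this] show "colM d I \<in> words (layers d) (length (wMvars d))"
    by (auto simp: words_def colM_def layer_coords_def coordsM_def simp del: upt_Suc)
qed

lemma replicate_eq_append_iff:
  assumes "length Y1 = a" "length xs = 2" "length Y3 = b"
  shows "replicate (a + (2 + b)) x = Y1 @ xs @ Y3 \<longleftrightarrow> Y1 = replicate a x \<and> xs = [x, x] \<and> Y3 = replicate b x"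
proof -
  have "replicate (a + (2 + b)) x = replicate a x @ [x, x] @ replicate b x"
    using replicate_add[of a "2 + b" x] replicate_add[of 2 b x] by (simp add: numeral_2_eq_2)
  moreover obtain p q where "xs = [p, q]"
    using assms(2) by (auto simp: length_Suc_conv numeral_2_eq_2)
  ultimately show ?thesis using assms by auto
qed

text \<open>To the layers below M, a crossing at the left edge of the top grid sits on two adjacent
  top edges of layer M - 1, from where it is pulled to the bottom boundary. If M = 1, it meets the
  left boundary, all of whose colours are 1, and is a scalar at once.\<close>

lemma layers_sum_swap:
  fixes d u v
  defines "M \<equiv> layers d"
  assumes adm: "admissible d I" and M: "M \<ge> 1" and gen: "generic \<tau> \<gamma> M lam"
    and len: "length (zvars d M) = length A + (2 + length B)"
    and Y: "length Y1 = length A" "length Y3 = length B" "xs \<in> words M 2"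
  defines "d1 \<equiv> d\<lparr>zvars := (zvars d)(M := A @ [u, v] @ B)\<rparr>"
    and "d2 \<equiv> d\<lparr>zvars := (zvars d)(M := A @ [v, u] @ B)\<rparr>"
  shows "(\<Sum>is\<in>words M 2. layers_sum d1 I lam (M - 1) (Y1 @ is @ Y3) * rmat u v (sh lam Y1) is xs)
     = theta \<tau> (u - v - \<gamma>) * layers_sum d2 I lam (M - 1) (Y1 @ xs @ Y3)"
proof (cases "M = 1")
  case True
  have 1: "(1::nat) \<in> colours M" by (simp add: colours_def)
  have 11: "[1, 1] \<in> words M 2" using 1 by (simp add: words_def)
  have l: "layers_sum d' I lam (M - 1) (Y1 @ is @ Y3) = (if is = [1, 1] then if Y1 = replicate (length A) 1 \<and> Y3 = replicate (length B) 1 then 1 else 0 else 0)"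
    if "d' = d1 \<or> d' = d2" "is \<in> words M 2" for d' "is"
  proof -
    have "layers_sum d' I lam (M - 1) X = (if replicate (length A + (2 + length B)) 1 = X then 1 else 0)" for X
      using that(1) True by (auto simp: layers_sum_def d1_def d2_def M_def)
    then show ?thesis
      using replicate_eq_append_iff[of Y1 "length A" "is" Y3 "length B" 1] Y that(2)
      by (simp only: length_words) simp
  qed
  have "(\<Sum>is\<in>words M 2. layers_sum d1 I lam (M - 1) (Y1 @ is @ Y3) * rmat u v (sh lam Y1) is xs)
    = (\<Sum>is\<in>words M 2. ((if Y1 = replicate (length A) 1 \<and> Y3 = replicate (length B) 1 then 1 else 0) * rmat u v (sh lam Y1) [1, 1] xs) * (if is = [1, 1] then 1 else 0))"
    by (intro sum.cong refl) (subst l, auto)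
  also have "\<dots> = (if Y1 = replicate (length A) 1 \<and> Y3 = replicate (length B) 1 then 1 else 0) * rmat u v (sh lam Y1) [1, 1] xs"
    using 11 by (simp add: sum_mult_delta)
  also have "\<dots> = theta \<tau> (u - v - \<gamma>) * layers_sum d2 I lam (M - 1) (Y1 @ xs @ Y3)"
    using Y(3) by (subst l) (auto simp: rmat_diag_left)
  finally show ?thesis .
next
  case False
  then obtain q where q: "M = Suc (Suc q)" using M by (metis One_nat_def not0_implies_Suc not_one_le_zero)
  let ?p = "Suc q"
  have p: "?p \<in> {1..layers d}" "?p < layers d" "?p \<in> {1..<layers d}" using q by (auto simp: M_def)
  let ?W = "words M (length (zvars d ?p))"
  let ?Lp = "shifted_lam \<gamma> d I lam ?p"
  let ?cI = "colI d I ?p" and ?cII = "colII d I ?p"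
  let ?n = "length ((wIvars d ?p @ A) @ [u, v] @ (B @ wIIvars d ?p))"
  have kern: "layer_kernel d1 I lam ?p Z (Y1 @ is @ Y3) =
      grid M (zvars d ?p) ((wIvars d ?p @ A) @ [u, v] @ (B @ wIIvars d ?p)) ?Lp Z
        (replicate ?n (?p + 1)) (replicate (length (zvars d ?p)) (?p + 1)) ((?cI @ Y1) @ is @ (Y3 @ ?cII))"
    "layer_kernel d2 I lam ?p Z (Y1 @ is @ Y3) =
      grid M (zvars d ?p) ((wIvars d ?p @ A) @ [v, u] @ (B @ wIIvars d ?p)) ?Lp Z
        (replicate ?n (?p + 1)) (replicate (length (zvars d ?p)) (?p + 1)) ((?cI @ Y1) @ is @ (Y3 @ ?cII))" for Z "is"
    using p q by (simp_all add: layer_kernel_def d1_def d2_def M_def top_word_def column_vars_def ncols_def nrows_def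
        del: replicate_Suc)
  \<comment> \<open>The lines of z^(M) reach down to layer M - 1 only, so the layers up to q = M - 2
    are the same for both orders.\<close>
  have below: "lay M (\<lambda>p. length (zvars d2 p)) (layer_kernel d2 I lam) q Z = lay M (\<lambda>p. length (zvars d1 p)) (layer_kernel d1 I lam) q Z" for Z
    using q by (intro lay_cong) (auto simp: layer_kernel_def d1_def d2_def M_def column_vars_def ncols_def nrows_def)
  have gLp: "generic \<tau> \<gamma> M ?Lp" by (rule generic_shifted_lam[OF gen])
  \<comment> \<open>The parameter at the crossing as seen from layer M - 1, behind its first
    w-columns and the lines in \<open>A\<close>, is the one seen from the left edge of layer
    M.\<close>
  have shL: "sh ?Lp (?cI @ Y1) = sh lam Y1"
    using dyn_shift_colI[OF p(3), of \<gamma> I lam] shifted_lam_top[of \<gamma> d I lam] q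
    by (simp add: dyn_shift_dyn_shift[symmetric] M_def)
  have cc: "replicate (length (zvars d ?p)) (?p + 1) \<in> ?W" "?p + 1 \<in> colours M"
    using p by (auto simp: M_def colours_def)
  have "(\<Sum>is\<in>words M 2. layers_sum d1 I lam (M - 1) (Y1 @ is @ Y3) * rmat u v (sh lam Y1) is xs)
    = (\<Sum>is\<in>words M 2. \<Sum>Z\<in>?W. lay M (\<lambda>p. length (zvars d1 p)) (layer_kernel d1 I lam) q Z * (layer_kernel d1 I lam ?p Z (Y1 @ is @ Y3) * rmat u v (sh lam Y1) is xs))"
    using q by (simp add: layers_sum_def sum_distrib_right mult.assoc) (simp add: d1_def M_def)
  also have "\<dots> = (\<Sum>Z\<in>?W. lay M (\<lambda>p. length (zvars d1 p)) (layer_kernel d1 I lam) q Z * (\<Sum>is\<in>words M 2. layer_kernel d1 I lam ?p Z (Y1 @ is @ Y3) * rmat u v (sh lam Y1) is xs))"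
    unfolding sum_distrib_left by (rule sum.swap)
  also have "\<dots> = (\<Sum>Z\<in>?W. lay M (\<lambda>p. length (zvars d1 p)) (layer_kernel d1 I lam) q Z * (theta \<tau> (u - v - \<gamma>) * layer_kernel d2 I lam ?p Z (Y1 @ xs @ Y3)))"
  proof (intro sum.cong refl arg_cong2[of _ _ _ _ "(*)"])
    fix Z assume Z: "Z \<in> ?W"
    show "(\<Sum>is\<in>words M 2. layer_kernel d1 I lam ?p Z (Y1 @ is @ Y3) * rmat u v (sh lam Y1) is xs) =
       theta \<tau> (u - v - \<gamma>) * layer_kernel d2 I lam ?p Z (Y1 @ xs @ Y3)"
      unfolding kern shL[symmetric]
      by (rule grid_swap_cols[OF gLp Y(3)]) (use cc Z Y in auto)
  qed
  also have "\<dots> = theta \<tau> (u - v - \<gamma>) * layers_sum d2 I lam (M - 1) (Y1 @ xs @ Y3)"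
  proof -
    have "layers d2 = M" "M - 1 = ?p" "zvars d2 ?p = zvars d ?p"
      using q by (simp_all add: d2_def M_def)
    then show ?thesis
      by (simp only: layers_sum_def lay.simps below sum_distrib_left mult.left_commute)
  qed
  finally show ?thesis .
qed

text \<open>The factor on the left creates the crossing at the right boundary of the top grid
  (\<open>grid_swap_rows\<close>). It then sits on the interface, and the sum over the interface
  colours \<open>is\<close> hands it to \<open>layers_sum_swap\<close>, which releases it as the
  factor on the right.\<close>

lemma theta_mult_psi_swap:
  fixes d
  defines "M \<equiv> layers d"
  assumes adm: "admissible d I" and M: "M \<ge> 1" and gen: "generic \<tau> \<gamma> M lam"
    and len: "length (zvars d M) = length A + (2 + length B)"
  shows "theta \<tau> (u - v - \<gamma>) * psi \<tau> \<gamma> (d\<lparr>zvars := (zvars d)(M := A @ [u, v] @ B)\<rparr>) I lam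
     = theta \<tau> (u - v - \<gamma>) * psi \<tau> \<gamma> (d\<lparr>zvars := (zvars d)(M := A @ [v, u] @ B)\<rparr>) I lam"
proof -
  define d1 where "d1 = d\<lparr>zvars := (zvars d)(M := A @ [u, v] @ B)\<rparr>"
  define d2 where "d2 = d\<lparr>zvars := (zvars d)(M := A @ [v, u] @ B)\<rparr>"
  have adm12: "admissible d1 I" "admissible d2 I"
    unfolding d1_def d2_def using len by (auto intro!: admissible_update_zvars[OF adm])
  let ?a = "length A" and ?b = "length B" and ?L = "length (wMvars d)"
  let ?G = "\<lambda>z. grid M z (wMvars d) lam"
  let ?bs = "replicate ?L (M + 1)" and ?cs = "replicate (?a + (2 + ?b)) (M + 1)"
  let ?\<theta> = "theta \<tau> (u - v - \<gamma>)"
  have psi: "psi \<tau> \<gamma> d1 I lam = (\<Sum>Y1\<in>words M ?a. \<Sum>is\<in>words M 2. \<Sum>Y3\<in>words M ?b.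
      layers_sum d1 I lam (M - 1) (Y1 @ is @ Y3) * ?G (A @ [u, v] @ B) (Y1 @ is @ Y3) ?bs ?cs (colM d I))"
    "psi \<tau> \<gamma> d2 I lam = (\<Sum>Y1\<in>words M ?a. \<Sum>is\<in>words M 2. \<Sum>Y3\<in>words M ?b.
      layers_sum d2 I lam (M - 1) (Y1 @ is @ Y3) * ?G (A @ [v, u] @ B) (Y1 @ is @ Y3) ?bs ?cs (colM d I))"
  proof -
    have "psi \<tau> \<gamma> d1 I lam = (\<Sum>Y\<in>words M (?a + (2 + ?b)).
        layers_sum d1 I lam (M - 1) Y * ?G (A @ [u, v] @ B) Y ?bs ?cs (colM d I))"
      "psi \<tau> \<gamma> d2 I lam = (\<Sum>Y\<in>words M (?a + (2 + ?b)).
        layers_sum d2 I lam (M - 1) Y * ?G (A @ [v, u] @ B) Y ?bs ?cs (colM d I))"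
      using psi_layers[OF adm12(1), of lam] psi_layers[OF adm12(2), of lam] M
      by (simp_all add: d1_def d2_def M_def)
    then show "psi \<tau> \<gamma> d1 I lam = (\<Sum>Y1\<in>words M ?a. \<Sum>is\<in>words M 2. \<Sum>Y3\<in>words M ?b.
      layers_sum d1 I lam (M - 1) (Y1 @ is @ Y3) * ?G (A @ [u, v] @ B) (Y1 @ is @ Y3) ?bs ?cs (colM d I))"
      "psi \<tau> \<gamma> d2 I lam = (\<Sum>Y1\<in>words M ?a. \<Sum>is\<in>words M 2. \<Sum>Y3\<in>words M ?b.
      layers_sum d2 I lam (M - 1) (Y1 @ is @ Y3) * ?G (A @ [v, u] @ B) (Y1 @ is @ Y3) ?bs ?cs (colM d I))"
      by (simp_all only: sum_words_append)
  qed
  have colM: "colM d I \<in> words M ?L"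
    using colI_colII_colM_words(3)[OF adm, of M] M by (simp add: M_def)
  have bs: "?bs \<in> words M ?L" "M + 1 \<in> colours M" by (auto simp: colours_def)
  have "?\<theta> * psi \<tau> \<gamma> d1 I lam = (\<Sum>Y1\<in>words M ?a. \<Sum>is\<in>words M 2. \<Sum>Y3\<in>words M ?b.
      layers_sum d1 I lam (M - 1) (Y1 @ is @ Y3) * (?\<theta> * ?G (A @ [u, v] @ B) (Y1 @ is @ Y3) ?bs ?cs (colM d I)))"
    unfolding psi sum_distrib_left by (simp only: mult.left_commute)
  also have "\<dots> = (\<Sum>Y1\<in>words M ?a. \<Sum>is\<in>words M 2. \<Sum>Y3\<in>words M ?b. \<Sum>xs\<in>words M 2.
      (layers_sum d1 I lam (M - 1) (Y1 @ is @ Y3) * rmat u v (sh lam Y1) is xs) * ?G (A @ [v, u] @ B) (Y1 @ xs @ Y3) ?bs ?cs (colM d I))"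
  proof (intro sum.cong refl)
    fix Y1 "is" Y3 assume Y: "Y1 \<in> words M ?a" "is \<in> words M 2" "Y3 \<in> words M ?b"
    have "?\<theta> * ?G (A @ [u, v] @ B) (Y1 @ is @ Y3) ?bs ?cs (colM d I) =
      (\<Sum>xs\<in>words M 2. rmat u v (sh lam Y1) is xs * ?G (A @ [v, u] @ B) (Y1 @ xs @ Y3) ?bs ?cs (colM d I))"
      by (rule grid_swap_rows[OF gen Y(2) bs(2) _ _ colM bs(1)]) (use Y in \<open>auto simp: length_words\<close>)
    then show "layers_sum d1 I lam (M - 1) (Y1 @ is @ Y3) * (?\<theta> * ?G (A @ [u, v] @ B) (Y1 @ is @ Y3) ?bs ?cs (colM d I))
      = (\<Sum>xs\<in>words M 2. (layers_sum d1 I lam (M - 1) (Y1 @ is @ Y3) * rmat u v (sh lam Y1) is xs) * ?G (A @ [v, u] @ B) (Y1 @ xs @ Y3) ?bs ?cs (colM d I))"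
      by (simp only: sum_distrib_left mult.assoc)
  qed
  also have "\<dots> = (\<Sum>Y1\<in>words M ?a. \<Sum>Y3\<in>words M ?b. \<Sum>xs\<in>words M 2. \<Sum>is\<in>words M 2.
      (layers_sum d1 I lam (M - 1) (Y1 @ is @ Y3) * rmat u v (sh lam Y1) is xs) * ?G (A @ [v, u] @ B) (Y1 @ xs @ Y3) ?bs ?cs (colM d I))"
    by (rule sum.cong[OF refl], subst sum.swap, rule sum.cong[OF refl], rule sum.swap)
  also have "\<dots> = (\<Sum>Y1\<in>words M ?a. \<Sum>Y3\<in>words M ?b. \<Sum>xs\<in>words M 2.
      (?\<theta> * layers_sum d2 I lam (M - 1) (Y1 @ xs @ Y3)) * ?G (A @ [v, u] @ B) (Y1 @ xs @ Y3) ?bs ?cs (colM d I))"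
  proof (intro sum.cong refl)
    fix Y1 Y3 xs assume Y: "Y1 \<in> words M ?a" "Y3 \<in> words M ?b" "xs \<in> words M 2"
    have "(\<Sum>is\<in>words M 2. layers_sum d1 I lam (M - 1) (Y1 @ is @ Y3) * rmat u v (sh lam Y1) is xs)
      = ?\<theta> * layers_sum d2 I lam (M - 1) (Y1 @ xs @ Y3)"
      unfolding d1_def d2_def M_def
      by (rule layers_sum_swap) (use adm M gen len Y in \<open>auto simp: M_def length_words\<close>)
    then show "(\<Sum>is\<in>words M 2. (layers_sum d1 I lam (M - 1) (Y1 @ is @ Y3) * rmat u v (sh lam Y1) is xs) * ?G (A @ [v, u] @ B) (Y1 @ xs @ Y3) ?bs ?cs (colM d I))
      = (?\<theta> * layers_sum d2 I lam (M - 1) (Y1 @ xs @ Y3)) * ?G (A @ [v, u] @ B) (Y1 @ xs @ Y3) ?bs ?cs (colM d I)"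
      by (simp only: sum_distrib_right[symmetric])
  qed
  also have "\<dots> = (\<Sum>Y1\<in>words M ?a. \<Sum>xs\<in>words M 2. \<Sum>Y3\<in>words M ?b.
      (?\<theta> * layers_sum d2 I lam (M - 1) (Y1 @ xs @ Y3)) * ?G (A @ [v, u] @ B) (Y1 @ xs @ Y3) ?bs ?cs (colM d I))"
    by (rule sum.cong[OF refl], rule sum.swap)
  also have "\<dots> = ?\<theta> * psi \<tau> \<gamma> d2 I lam"
    unfolding psi sum_distrib_left by (simp only: mult.assoc)
  finally show ?thesis by (simp only: d1_def d2_def)
qed

lemma continuous_on_append_nth:
  assumes "continuous_on S f" "continuous_on S g"
  shows "continuous_on S (\<lambda>x :: complex. (A @ f x # g x # B) ! i :: complex)"
proof -
  show ?thesis
  proof (cases "i < length A")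
    case True
    then show ?thesis by (simp add: nth_append)
  next
    case False
    then obtain j where j: "i = length A + j" using le_Suc_ex[of "length A" i] by auto
    consider "j = 0" | "j = Suc 0" | j' where "j = Suc (Suc j')" by (metis not0_implies_Suc)
    then show ?thesis by cases (simp_all add: j nth_append assms)
  qed
qed

lemma psi_symmetric:
  assumes "admissible d I" "layers d \<ge> 1" "generic \<tau> \<gamma> (layers d) lam"
    and "mset zs = mset (zvars d (layers d))"
  shows "psi \<tau> \<gamma> (d\<lparr>zvars := (zvars d)(layers d := zs)\<rparr>) I lam = psi \<tau> \<gamma> d I lam"
proof -
  let ?M = "layers d" and ?k = "length (zvars d (layers d))"
  let ?P = "\<lambda>zs. psi \<tau> \<gamma> (d\<lparr>zvars := (zvars d)(layers d := zs)\<rparr>) I lam"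
  \<comment> \<open>The value 0 at lists of other lengths makes swap invariance a statement about
    all lists, as the reduction to adjacent transpositions requires.\<close>
  define F where "F zs = (if length zs = ?k then ?P zs else 0)" for zs
  \<comment> \<open>Since M \<ge> 1 there are two colours, and genericity gives a point where theta
    does not vanish.\<close>
  have nz: "theta \<tau> (lam 1 - lam 2) \<noteq> 0"
  proof -
    have "theta \<tau> (lam 1 - lam 2 + of_int 0 * \<gamma>) \<noteq> 0"
      using assms(2,3) unfolding generic_def by (intro assms(3)[unfolded generic_def, rule_format]) auto
    then show ?thesis by simp
  qed
  have swap: "F (A @ [u, v] @ B) = F (A @ [v, u] @ B)" for A B u v
  proof (cases "length A + (2 + length B) = ?k")
    case True
    have cont: "continuous_on UNIV (\<lambda>x. ?P (A @ [x, v] @ B))" "continuous_on UNIV (\<lambda>x. ?P (A @ [v, x] @ B))"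
      by (rule psi_continuous[where n = ?k]; use True in \<open>auto intro!: continuous_on_append_nth continuous_intros\<close>)+
    have "?P (A @ [u, v] @ B) = ?P (A @ [v, u] @ B)"
    \<comment> \<open>The factor [x - v - \<gamma>] may vanish at x = u; it is cancelled by letting
      the first of the two variables vary.\<close>
    proof (rule theta_cancel[OF nz cont, where c = "v + \<gamma>"])
      show "theta \<tau> (x - (v + \<gamma>)) * ?P (A @ [x, v] @ B) = theta \<tau> (x - (v + \<gamma>)) * ?P (A @ [v, x] @ B)" for x
        using theta_mult_psi_swap[OF assms(1-3), of A B x v] True by (simp add: algebra_simps)
    qed
    then show ?thesis by (simp add: F_def)
  next
    case False
    then show ?thesis by (auto simp: F_def)
  qed
  have "F zs = F (zvars d (layers d))"
    by (rule mset_eq_imp_invariant[where F = F, OF _ assms(4)]) (rule swap)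
  moreover have "length zs = ?k" using assms(4) by (metis size_mset)
  ultimately show ?thesis by (simp add: F_def)
qed

section \<open>Quasi-periodic functions\<close>

definition quasi_periodic :: "nat \<Rightarrow> complex \<Rightarrow> (complex \<Rightarrow> complex) \<Rightarrow> bool" where
  "quasi_periodic k S \<phi> \<longleftrightarrow> \<phi> holomorphic_on UNIV \<and> (\<forall>x. \<phi> (x + 1) = (-1) ^ k * \<phi> x) \<and>
     (\<forall>x. \<phi> (x + \<tau>) = (-1) ^ k * exp (- 2 * pi * \<i> * (of_nat k * x - S) - pi * \<i> * of_nat k * \<tau>) * \<phi> x)"

lemma quasi_periodic_theta: "quasi_periodic 1 c (\<lambda>x. theta \<tau> (c - x))"
proof -
  have "(\<lambda>x. c - x) holomorphic_on UNIV" by (intro holomorphic_intros)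
  from holomorphic_on_compose[OF this holomorphic_on_subset[OF theta_holomorphic[OF Im_tau]]]
  have "(\<lambda>x. theta \<tau> (c - x)) holomorphic_on UNIV" by (simp add: o_def)
  moreover have "theta \<tau> (c - (x + 1)) = - theta \<tau> (c - x)" for x
    using theta_plus_1[of \<tau> "c - (x + 1)"] by (simp add: algebra_simps)
  moreover have "theta \<tau> (c - (x + \<tau>)) = - exp (- 2 * pi * \<i> * (x - c) - pi * \<i> * \<tau>) * theta \<tau> (c - x)" for x
  proof -
    have "theta \<tau> (c - x) = - exp (- \<i> * pi * \<tau> - 2 * pi * \<i> * (c - (x + \<tau>))) * theta \<tau> (c - (x + \<tau>))"
      using theta_plus_tau[of \<tau> "c - (x + \<tau>)"] by (simp add: algebra_simps)
    moreover have "exp (- 2 * pi * \<i> * (x - c) - pi * \<i> * \<tau>) * exp (- \<i> * pi * \<tau> - 2 * pi * \<i> * (c - (x + \<tau>))) = 1"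
      unfolding exp_add[symmetric] by (simp add: algebra_simps)
    ultimately show ?thesis by simp
  qed
  ultimately show ?thesis by (simp add: quasi_periodic_def)
qed

lemma quasi_periodic_mult:
  assumes "quasi_periodic k S f" "quasi_periodic l T g"
  shows "quasi_periodic (k + l) (S + T) (\<lambda>x. f x * g x)"
proof -
  have "exp (- 2 * pi * \<i> * (of_nat (k + l) * x - (S + T)) - pi * \<i> * of_nat (k + l) * \<tau>) =
    exp (- 2 * pi * \<i> * (of_nat k * x - S) - pi * \<i> * of_nat k * \<tau>) * exp (- 2 * pi * \<i> * (of_nat l * x - T) - pi * \<i> * of_nat l * \<tau>)" for x
    unfolding exp_add[symmetric] by (simp add: algebra_simps)
  then show ?thesis
    using assms by (auto simp: quasi_periodic_def power_add intro!: holomorphic_intros)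
qed

lemma quasi_periodic_cmult: "quasi_periodic k S f \<Longrightarrow> quasi_periodic k S (\<lambda>x. c * f x)"
  by (auto simp: quasi_periodic_def intro!: holomorphic_intros)

lemma quasi_periodic_0: "quasi_periodic k S (\<lambda>x. 0)"
  by (simp add: quasi_periodic_def)

text \<open>Under products the degrees \<open>k\<close> and the parameters \<open>S\<close> add up,
  but sums require them to agree. So below every term of a partition function has to be shown to
  have the same \<open>S\<close>.\<close>

lemma quasi_periodic_sum:
  assumes "\<And>a. a \<in> A \<Longrightarrow> quasi_periodic k S (f a)"
  shows "quasi_periodic k S (\<lambda>x. \<Sum>a\<in>A. f a x)"
  using assms by (auto simp: quasi_periodic_def sum_distrib_left intro!: holomorphic_intros)

lemma quasi_periodic_prod_list:
  "quasi_periodic (length zs) (\<Sum>z\<leftarrow>zs. z - \<gamma>) (\<lambda>x. \<Prod>z\<leftarrow>zs. theta \<tau> (z - x - \<gamma>))"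
proof (induction zs)
  case Nil
  then show ?case by (simp add: quasi_periodic_def)
next
  case (Cons z zs)
  from quasi_periodic_mult[OF quasi_periodic_theta[of "z - \<gamma>"] Cons]
  show ?case by (simp add: algebra_simps)
qed

section \<open>The last column of the top grid\<close>

lemma grid_one_col_Cons:
  assumes "c \<in> colours M"
  shows "grid M (z # zs) [w] \<Lambda> (m # ms) bs (c # cs) [e] =
    (\<Sum>v\<in>colours M. weight \<tau> \<gamma> z w \<Lambda> m v c e * grid M zs [w] (sh \<Lambda> [m]) ms bs cs [v])"
  using assms by (simp add: sum_words_Suc sum_mult_delta)

lemma top_colour_mem [simp]: "M + 1 \<in> colours M" "Suc M \<in> colours M"
  by (simp_all add: colours_def)

text \<open>The ice rule freezes the vertices from the top down: if the right and top colours are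
  both M + 1, so are the left and bottom ones.\<close>

lemma grid_one_col_max:
  assumes "ms \<in> words M (length zs)"
  shows "grid M zs [w] \<Lambda> ms [M + 1] (replicate (length zs) (M + 1)) [M + 1] =
    (if ms = replicate (length zs) (M + 1) then \<Prod>z\<leftarrow>zs. theta \<tau> (z - w - \<gamma>) else 0)"
  using assms
proof (induction zs arbitrary: \<Lambda> ms)
  case Nil
  then show ?case by simp
next
  case (Cons z zs)
  from Cons.prems obtain m ms' where [simp]: "ms = m # ms'" "m \<in> colours M" "ms' \<in> words M (length zs)"
    by (metis Cons_mem_words length_Cons length_Suc_conv length_words)
  have "weight \<tau> \<gamma> z w \<Lambda> m v (M + 1) (M + 1) = (if m = M + 1 then theta \<tau> (z - w - \<gamma>) else 0) * (if v = M + 1 then 1 else 0)" for v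
    by (auto simp: weight_def)
  then have "grid M (z # zs) [w] \<Lambda> ms [M + 1] (replicate (length (z # zs)) (M + 1)) [M + 1]
    = (\<Sum>v\<in>colours M. ((if m = M + 1 then theta \<tau> (z - w - \<gamma>) else 0) * grid M zs [w] (sh \<Lambda> [m]) ms' [M + 1] (replicate (length zs) (M + 1)) [v]) * (if v = M + 1 then 1 else 0))"
    by (simp only: list.size replicate_Suc \<open>ms = m # ms'\<close> grid_one_col_Cons top_colour_mem add_Suc_right add_0_right Suc_eq_plus1[symmetric] mult_ac)
  then show ?case
    using Cons.IH[of ms' "sh \<Lambda> [m]"] by (simp add: sum_mult_delta del: grid.simps)
qed

text \<open>The colour i entering at the top must leave on the left, since the right and bottom
  boundaries carry M + 1. At the first vertex it either goes straight down (\<open>alpha\<close>) or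
  turns (\<open>beta\<close>); after the turn the rest of the column is frozen.\<close>

lemma grid_one_col_step:
  assumes "i \<in> colours M" "i \<noteq> M + 1" "ms \<in> words M (length zs)"
  shows "grid M (z # zs) [w] \<Lambda> (m # ms) [M + 1] (replicate (Suc (length zs)) (M + 1)) [i] =
    (if m = M + 1 then alpha \<tau> \<gamma> (z - w) (\<Lambda> (M + 1) - \<Lambda> i) * grid M zs [w] (sh \<Lambda> [M + 1]) ms [M + 1] (replicate (length zs) (M + 1)) [i]
     else if m = i \<and> ms = replicate (length zs) (M + 1)
       then beta \<tau> \<gamma> (z - w) (\<Lambda> (M + 1) - \<Lambda> i) * (\<Prod>z\<leftarrow>zs. theta \<tau> (z - w - \<gamma>)) else 0)"
proof -
  have "weight \<tau> \<gamma> z w \<Lambda> m v (M + 1) i =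
      (if m = M + 1 then alpha \<tau> \<gamma> (z - w) (\<Lambda> (M + 1) - \<Lambda> i) else 0) * (if v = i then 1 else 0)
    + (if m = i then beta \<tau> \<gamma> (z - w) (\<Lambda> (M + 1) - \<Lambda> i) else 0) * (if v = M + 1 then 1 else 0)" for v
    using assms(2) by (auto simp: weight_def)
  then have "grid M (z # zs) [w] \<Lambda> (m # ms) [M + 1] (replicate (Suc (length zs)) (M + 1)) [i] =
     (\<Sum>v\<in>colours M. ((if m = M + 1 then alpha \<tau> \<gamma> (z - w) (\<Lambda> (M + 1) - \<Lambda> i) else 0) * (if v = i then 1 else 0)
    + (if m = i then beta \<tau> \<gamma> (z - w) (\<Lambda> (M + 1) - \<Lambda> i) else 0) * (if v = M + 1 then 1 else 0)) * grid M zs [w] (sh \<Lambda> [m]) ms [M + 1] (replicate (length zs) (M + 1)) [v])"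
    by (simp only: replicate_Suc grid_one_col_Cons[OF top_colour_mem(1)])
  also have "\<dots> = (\<Sum>v\<in>colours M. ((if m = M + 1 then alpha \<tau> \<gamma> (z - w) (\<Lambda> (M + 1) - \<Lambda> i) else 0) * grid M zs [w] (sh \<Lambda> [m]) ms [M + 1] (replicate (length zs) (M + 1)) [v]) * (if v = i then 1 else 0)) +
     (\<Sum>v\<in>colours M. ((if m = i then beta \<tau> \<gamma> (z - w) (\<Lambda> (M + 1) - \<Lambda> i) else 0) * grid M zs [w] (sh \<Lambda> [m]) ms [M + 1] (replicate (length zs) (M + 1)) [v]) * (if v = M + 1 then 1 else 0))"
    unfolding sum.distrib[symmetric] by (intro sum.cong refl) (simp only: ring_distribs mult_ac)
  finally show ?thesis
    using assms grid_one_col_max[OF assms(3), of w "sh \<Lambda> [m]"]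
    by (simp add: sum_mult_delta del: grid.simps)
qed

text \<open>The row at which i turns does not affect \<open>S\<close>. If i goes on, the first
  vertex contributes z, and the shift by M + 1 lowers the dynamical difference by \<gamma>. If it
  turns, the first vertex contributes z plus that difference, and each vertex below contributes its
  variable minus \<gamma>. Both give the same total.\<close>

lemma quasi_periodic_grid_one_col:
  assumes "i \<in> colours M" "i \<noteq> M + 1" "ms \<in> words M (length zs)"
  shows "quasi_periodic (length zs) (sum_list zs + (\<Lambda> (M + 1) - \<Lambda> i) - \<gamma> * (of_nat (length zs) - 1))
     (\<lambda>w. grid M zs [w] \<Lambda> ms [M + 1] (replicate (length zs) (M + 1)) [i])"
  using assms
proof (induction zs arbitrary: \<Lambda> ms)
  case Nil
  then show ?case by (simp add: quasi_periodic_0)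
next
  case (Cons z zs)
  from Cons.prems obtain m ms' where ms: "ms = m # ms'" "m \<in> colours M" "ms' \<in> words M (length zs)"
    by (metis Cons_mem_words length_Cons length_Suc_conv length_words)
  let ?l = "\<Lambda> (M + 1) - \<Lambda> i"
  let ?S = "sum_list (z # zs) + ?l - \<gamma> * (of_nat (length (z # zs)) - 1)"
  have l: "sh \<Lambda> [M + 1] (M + 1) - sh \<Lambda> [M + 1] i = ?l - \<gamma>"
    using Cons.prems(2) by (simp add: dyn_shift_def)
  have 1: "quasi_periodic (length (z # zs)) ?S (\<lambda>w. alpha \<tau> \<gamma> (z - w) ?l * grid M zs [w] (sh \<Lambda> [M + 1]) ms' [M + 1] (replicate (length zs) (M + 1)) [i])"
    using quasi_periodic_cmult[OF quasi_periodic_mult[OF quasi_periodic_theta[of z] Cons.IH[OF Cons.prems(1,2) ms(3), of "sh \<Lambda> [M + 1]", unfolded l]], of "theta \<tau> (?l + \<gamma>) / theta \<tau> ?l"]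
    by (simp add: alpha_def algebra_simps del: grid.simps)
  have 2: "quasi_periodic (length (z # zs)) ?S (\<lambda>w. beta \<tau> \<gamma> (z - w) ?l * (\<Prod>z\<leftarrow>zs. theta \<tau> (z - w - \<gamma>)))"
  proof -
    have *: "(\<Sum>z\<leftarrow>zs. z - \<gamma>) = sum_list zs - \<gamma> * of_nat (length zs)"
      by (induction zs) (simp_all add: algebra_simps)
    show ?thesis
      using quasi_periodic_cmult[OF quasi_periodic_mult[OF quasi_periodic_theta[of "z + ?l"] quasi_periodic_prod_list[of zs, unfolded *]], of "- (theta \<tau> \<gamma> / theta \<tau> ?l)"]
      by (simp add: beta_def algebra_simps)
  qed
  show ?case
    unfolding ms(1) length_Cons grid_one_col_step[OF Cons.prems(1,2) ms(3)]
    using 1 2 quasi_periodic_0[of "length (z # zs)" ?S]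
    by (cases "m = M + 1"; cases "m = i \<and> ms' = replicate (length zs) (M + 1)")
      (simp_all only: length_Cons if_True if_False simp_thms)
qed

lemma generic_nonzero:
  assumes "generic \<tau> \<gamma> M \<Lambda>" "i \<in> colours M" "j \<in> colours M" "i \<noteq> j"
  shows "theta \<tau> (\<Lambda> i - \<Lambda> j + of_int n * \<gamma>) \<noteq> 0"
  using assms by (simp add: generic_def colours_def)

lemma grid_one_col_special:
  assumes "generic \<tau> \<gamma> M \<Lambda>" "i \<in> colours M" "i \<noteq> M + 1" "ms \<in> words M (Suc (length zs))"
  shows "grid M (zs @ [z]) [z - \<gamma>] \<Lambda> ms [M + 1] (replicate (Suc (length zs)) (M + 1)) [i] =
    (if ms = replicate (length zs) (M + 1) @ [i] then
       - ((\<Prod>z'\<leftarrow>zs. theta \<tau> (z' - z + \<gamma>)) * theta \<tau> (\<Lambda> (M + 1) - \<Lambda> i + \<gamma>) * theta \<tau> \<gamma>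
         / theta \<tau> (\<Lambda> (M + 1) - \<Lambda> i - \<gamma> * of_nat (length zs)))
     else 0)"
  using assms
proof (induction zs arbitrary: \<Lambda> ms)
  case Nil
  then obtain m where ms: "ms = [m]" by (auto simp: words_def length_Suc_conv)
  have "grid M ([] @ [z]) [z - \<gamma>] \<Lambda> ms [M + 1] (replicate (Suc (length [])) (M + 1)) [i] =
     (if m = i then beta \<tau> \<gamma> \<gamma> (\<Lambda> (M + 1) - \<Lambda> i) else 0)"
    using grid_one_col_step[of i M "[]" "[]" z "z - \<gamma>" \<Lambda> m] Nil ms by auto
  then show ?case by (simp add: ms beta_def algebra_simps del: grid.simps)
next
  case (Cons z' zs)
  from Cons.prems obtain m ms' where ms: "ms = m # ms'" "m \<in> colours M" "ms' \<in> words M (Suc (length zs))"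
    by (metis Cons_mem_words length_Cons length_Suc_conv length_words)
  let ?l = "\<Lambda> (M + 1) - \<Lambda> i"
  have nz: "theta \<tau> ?l \<noteq> 0"
    using generic_nonzero[OF Cons.prems(1) top_colour_mem(1) Cons.prems(2), of 0] Cons.prems(3) by simp
  have l: "sh \<Lambda> [M + 1] (M + 1) - sh \<Lambda> [M + 1] i = ?l - \<gamma>"
    using Cons.prems(3) by (simp add: dyn_shift_def)
  have step: "grid M ((z' # zs) @ [z]) [z - \<gamma>] \<Lambda> ms [M + 1] (replicate (Suc (length (z' # zs))) (M + 1)) [i] =
    (if m = M + 1 then alpha \<tau> \<gamma> (z' - (z - \<gamma>)) ?l * grid M (zs @ [z]) [z - \<gamma>] (sh \<Lambda> [M + 1]) ms' [M + 1] (replicate (Suc (length zs)) (M + 1)) [i]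
     else 0)"
    using grid_one_col_step[OF Cons.prems(2,3), of ms' "zs @ [z]" z' "z - \<gamma>" \<Lambda> m] ms
    by (simp del: grid.simps)
  show ?case
    unfolding step Cons.IH[OF generic_dyn_shift[OF Cons.prems(1)] Cons.prems(2,3) ms(3)] l
    using nz by (auto simp: ms alpha_def algebra_simps)
qed

lemma row_frozen:
  assumes "i \<noteq> M + 1" "length es = length ws" "row M z ws \<Lambda> a (replicate (length ws) (M + 1)) i es \<noteq> 0"
  shows "a = i" "es = replicate (length ws) (M + 1)"
proof -
  \<comment> \<open>The right colour i does not occur in the bottom word, so by conservation of
    colour it must enter from the left; only letters M + 1 then remain for the top.\<close>
  have eq: "add_mset a (mset (replicate (length ws) (M + 1))) = add_mset i (mset es)"
    using row_nonzero[OF assms(3)] assms(2) by simp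
  then have "i \<in># add_mset a (mset (replicate (length ws) (M + 1)))" by simp
  then show "a = i" using assms(1) by (auto split: if_splits)
  with eq have "mset es = mset (replicate (length ws) (M + 1))" by simp
  then have "set es \<subseteq> {M + 1}" by (metis mset_eq_setD set_replicate_conv_if empty_subsetI order_refl)
  then show "es = replicate (length ws) (M + 1)"
    using assms(2) by (intro replicate_eqI) auto
qed

text \<open>Every vertex is an \<open>alpha\<close>, and each top edge M + 1 raises the dynamical
  difference by \<gamma>, so the quotients telescope.\<close>

lemma row_frozen_eq:
  assumes "generic \<tau> \<gamma> M \<Lambda>" "i \<in> colours M" "i \<noteq> M + 1"
  shows "row M z ws \<Lambda> i (replicate (length ws) (M + 1)) i (replicate (length ws) (M + 1)) =
    (\<Prod>w\<leftarrow>ws. theta \<tau> (z - w)) * theta \<tau> (\<Lambda> i - \<Lambda> (M + 1) + \<gamma> * of_nat (length ws)) / theta \<tau> (\<Lambda> i - \<Lambda> (M + 1))"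
  using assms
proof (induction ws arbitrary: \<Lambda>)
  case Nil
  then show ?case using generic_nonzero[OF Nil(1,2) top_colour_mem(1), of 0] by simp
next
  case (Cons w ws)
  have nz: "theta \<tau> (\<Lambda> i - \<Lambda> (M + 1) + \<gamma>) \<noteq> 0"
    using generic_nonzero[OF Cons.prems(1,2) top_colour_mem(1), of 1] Cons.prems(3) by simp
  have "weight \<tau> \<gamma> z w \<Lambda> i (M + 1) x (M + 1) = alpha \<tau> \<gamma> (z - w) (\<Lambda> i - \<Lambda> (M + 1)) * (if x = i then 1 else 0)" for x
    using Cons.prems(3) by (auto simp: weight_def)
  then have "row M z (w # ws) \<Lambda> i (replicate (length (w # ws)) (M + 1)) i (replicate (length (w # ws)) (M + 1)) =
    (\<Sum>x\<in>colours M. (alpha \<tau> \<gamma> (z - w) (\<Lambda> i - \<Lambda> (M + 1)) * row M z ws (sh \<Lambda> [M + 1]) x (replicate (length ws) (M + 1)) i (replicate (length ws) (M + 1))) * (if x = i then 1 else 0))"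
    by (simp add: mult_ac)
  also have "\<dots> = alpha \<tau> \<gamma> (z - w) (\<Lambda> i - \<Lambda> (M + 1)) * row M z ws (sh \<Lambda> [M + 1]) i (replicate (length ws) (M + 1)) i (replicate (length ws) (M + 1))"
    using Cons.prems(2) by (simp add: sum_mult_delta)
  also have "row M z ws (sh \<Lambda> [M + 1]) i (replicate (length ws) (M + 1)) i (replicate (length ws) (M + 1)) =
     (\<Prod>w\<leftarrow>ws. theta \<tau> (z - w)) * theta \<tau> (\<Lambda> i - \<Lambda> (M + 1) + \<gamma> * of_nat (length (w # ws))) / theta \<tau> (\<Lambda> i - \<Lambda> (M + 1) + \<gamma>)"
  proof -
    have l: "sh \<Lambda> [M + 1] i - sh \<Lambda> [M + 1] (M + 1) = \<Lambda> i - \<Lambda> (M + 1) + \<gamma>"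
      using Cons.prems(3) by (simp add: dyn_shift_def)
    show ?thesis
      unfolding Cons.IH[OF generic_dyn_shift[OF Cons.prems(1)] Cons.prems(2,3)] l
      by (simp add: algebra_simps)
  qed
  finally show ?case using nz by (simp add: alpha_def)
qed

lemma grid_last_col:
  assumes "Y \<in> words M (length zs)" "length tops = length ws"
  shows "grid M zs (ws @ [w]) \<Lambda> Y (replicate (Suc (length ws)) (M + 1)) (replicate (length zs) (M + 1)) (tops @ [i]) =
    (\<Sum>ms\<in>words M (length zs). grid M zs ws \<Lambda> Y (replicate (length ws) (M + 1)) ms tops *
       grid M zs [w] (sh \<Lambda> tops) ms [M + 1] (replicate (length zs) (M + 1)) [i])"
proof -
  have "replicate (Suc (length ws)) (M + 1) = replicate (length ws) (M + 1) @ [M + 1]"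
    by (simp add: replicate_append_same)
  then show ?thesis
    using assms by (simp only:) (rule grid_append_cols, simp_all)
qed

lemma quasi_periodic_grid_last_col:
  assumes "Y \<in> words M (length zs)" "length tops = length ws" "i \<in> colours M" "i \<noteq> M + 1"
    and "count (mset tops) (M + 1) + length zs = Suc (length ws)"
  shows "quasi_periodic (length zs)
     (sum_list zs - (\<Lambda> i - \<Lambda> (M + 1) + \<gamma> * (of_nat (Suc (length ws)) - of_nat (Suc (count (mset tops) i)))))
     (\<lambda>w. grid M zs (ws @ [w]) \<Lambda> Y (replicate (Suc (length ws)) (M + 1)) (replicate (length zs) (M + 1)) (tops @ [i]))"
proof -
  \<comment> \<open>Exactly L_M - k_M letters of the top word are M + 1. This trades the size of the
    column for L_M in the multiplier.\<close>
  have c: "of_nat (count (mset tops) (M + 1)) = (of_nat (Suc (length ws)) - of_nat (length zs) :: complex)"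
    unfolding assms(5)[symmetric] by simp
  have S: "sum_list zs + (sh \<Lambda> tops (M + 1) - sh \<Lambda> tops i) - \<gamma> * (of_nat (length zs) - 1)
     = sum_list zs - (\<Lambda> i - \<Lambda> (M + 1) + \<gamma> * (of_nat (Suc (length ws)) - of_nat (Suc (count (mset tops) i))))"
    unfolding dyn_shift_def c by (simp add: algebra_simps)
  show ?thesis
    unfolding grid_last_col[OF assms(1,2)]
    by (intro quasi_periodic_sum quasi_periodic_cmult)
      (rule quasi_periodic_grid_one_col[OF assms(3,4), of _ zs "sh \<Lambda> tops", unfolded S])
qed

lemma grid_last_col_max:
  assumes "Y \<in> words M (length zs)" "length tops = length ws"
  shows "grid M zs (ws @ [w]) \<Lambda> Y (replicate (Suc (length ws)) (M + 1)) (replicate (length zs) (M + 1)) (tops @ [M + 1]) =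
    (\<Prod>z\<leftarrow>zs. theta \<tau> (z - w - \<gamma>)) * grid M zs ws \<Lambda> Y (replicate (length ws) (M + 1)) (replicate (length zs) (M + 1)) tops"
proof -
  have "(\<Sum>ms\<in>words M (length zs). grid M zs ws \<Lambda> Y (replicate (length ws) (M + 1)) ms tops *
       grid M zs [w] (sh \<Lambda> tops) ms [M + 1] (replicate (length zs) (M + 1)) [M + 1])
     = (\<Sum>ms\<in>words M (length zs). ((\<Prod>z\<leftarrow>zs. theta \<tau> (z - w - \<gamma>)) * grid M zs ws \<Lambda> Y (replicate (length ws) (M + 1)) ms tops) *
       (if ms = replicate (length zs) (M + 1) then 1 else 0))"
    by (intro sum.cong refl) (subst grid_one_col_max, simp_all)
  then show ?thesis
    unfolding grid_last_col[OF assms] by (simp add: sum_mult_delta)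
qed

lemma grid_one_row:
  assumes "bs \<in> words M (length ws)"
  shows "grid M [z] ws \<Lambda> [a] bs [c] es = row M z ws \<Lambda> a bs c es"
  using assms by (simp add: sum_mult_delta)

text \<open>The last column admits i only at the left edge of its lowest vertex. The last row of the
  remaining columns thus has right colour i and bottom colours M + 1 and is frozen as well. The
  denominator of the column and the numerator of the row agree up to sign, theta being odd, and
  cancel.\<close>

lemma grid_corner_frozen:
  fixes Y :: "nat list"
  assumes gen: "generic \<tau> \<gamma> M \<Lambda>" and i: "i \<in> colours M" "i \<noteq> M + 1"
    and Y: "Y \<in> words M (length zs)" and y: "y \<in> colours M" and tops: "tops \<in> words M (length ws)"
    and cnt: "count (mset tops) (M + 1) + length zs = length ws"
  shows "grid M (zs @ [z]) (ws @ [z - \<gamma>]) \<Lambda> (Y @ [y]) (replicate (Suc (length ws)) (M + 1))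
      (replicate (Suc (length zs)) (M + 1)) (tops @ [i]) =
    (if y = i then (\<Prod>w\<leftarrow>ws. theta \<tau> (z - w)) * (\<Prod>z'\<leftarrow>zs. theta \<tau> (z' - z + \<gamma>)) *
        (theta \<tau> \<gamma> * theta \<tau> (\<Lambda> (M + 1) - \<Lambda> i + \<gamma> * (of_nat (length zs) - of_nat (length ws) + of_nat (Suc (count (mset tops) i))))
          / theta \<tau> (\<Lambda> i - \<Lambda> (M + 1) + \<gamma> * (1 - of_nat (Suc (count (mset tops) i))))) *
        grid M zs ws \<Lambda> Y (replicate (length ws) (M + 1)) (replicate (length zs) (M + 1)) tops else 0)"
proof -
  let ?n = "M + 1" and ?k = "length zs" and ?N = "length ws"
  let ?bs = "replicate ?N ?n" and ?cs = "replicate ?k ?n"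
  let ?x = "\<Lambda> i - \<Lambda> ?n" and ?c = "count (mset tops) i"
  let ?V = "- ((\<Prod>z'\<leftarrow>zs. theta \<tau> (z' - z + \<gamma>)) * theta \<tau> (sh \<Lambda> tops ?n - sh \<Lambda> tops i + \<gamma>) * theta \<tau> \<gamma>
         / theta \<tau> (sh \<Lambda> tops ?n - sh \<Lambda> tops i - \<gamma> * of_nat ?k))"
  have ltops: "length tops = ?N" and lY: "length Y = ?k" using tops Y by (simp_all add: length_words)
  have Yy: "Y @ [y] \<in> words M (length (zs @ [z]))" using Y y by (auto simp: words_def)
  have ci: "?cs @ [i] \<in> words M (Suc ?k)" using i by (auto simp: words_def colours_def)
  have "grid M (zs @ [z]) (ws @ [z - \<gamma>]) \<Lambda> (Y @ [y]) (replicate (Suc ?N) ?n) (replicate (Suc ?k) ?n) (tops @ [i]) =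
     (\<Sum>ms\<in>words M (Suc ?k). grid M (zs @ [z]) ws \<Lambda> (Y @ [y]) ?bs ms tops *
       grid M (zs @ [z]) [z - \<gamma>] (sh \<Lambda> tops) ms [?n] (replicate (Suc ?k) ?n) [i])"
    using grid_last_col[OF Yy ltops, of "z - \<gamma>" \<Lambda> i] by (simp only: length_append_singleton)
  also have "\<dots> = (\<Sum>ms\<in>words M (Suc ?k). (grid M (zs @ [z]) ws \<Lambda> (Y @ [y]) ?bs ms tops * ?V) * (if ms = ?cs @ [i] then 1 else 0))"
    by (intro sum.cong refl) (subst grid_one_col_special[OF generic_dyn_shift[OF gen] i], simp_all)
  also have "\<dots> = grid M (zs @ [z]) ws \<Lambda> (Y @ [y]) ?bs (?cs @ [i]) tops * ?V"
    using ci by (simp only: sum_mult_delta finite_words if_True)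
  also have "grid M (zs @ [z]) ws \<Lambda> (Y @ [y]) ?bs (?cs @ [i]) tops =
     (\<Sum>us\<in>words M ?N. grid M zs ws \<Lambda> Y us ?cs tops * row M z ws (sh \<Lambda> Y) y ?bs i us)"
    using grid_append_rows[OF tops lY, of ?cs "[z]" \<Lambda> "[y]" ?bs "[i]"] by (simp add: grid_one_row del: grid.simps)
  also have "\<dots> = (\<Sum>us\<in>words M ?N. (grid M zs ws \<Lambda> Y us ?cs tops * row M z ws (sh \<Lambda> Y) y ?bs i us) * (if us = ?bs then 1 else 0))"
  proof (intro sum.cong refl)
    fix us assume "us \<in> words M ?N"
    then have "row M z ws (sh \<Lambda> Y) y ?bs i us = 0" if "us \<noteq> ?bs"
      using row_frozen(2)[OF i(2), where es = us and ws = ws and z = z and \<Lambda> = "sh \<Lambda> Y" and a = y] that by (auto simp: length_words)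
    then show "grid M zs ws \<Lambda> Y us ?cs tops * row M z ws (sh \<Lambda> Y) y ?bs i us =
      (grid M zs ws \<Lambda> Y us ?cs tops * row M z ws (sh \<Lambda> Y) y ?bs i us) * (if us = ?bs then 1 else 0)"
      by auto
  qed
  also have "\<dots> = grid M zs ws \<Lambda> Y ?bs ?cs tops * row M z ws (sh \<Lambda> Y) y ?bs i ?bs"
    by (simp add: sum_mult_delta)
  finally have eq: "grid M (zs @ [z]) (ws @ [z - \<gamma>]) \<Lambda> (Y @ [y]) (replicate (Suc ?N) ?n) (replicate (Suc ?k) ?n) (tops @ [i]) =
     grid M zs ws \<Lambda> Y ?bs ?cs tops * row M z ws (sh \<Lambda> Y) y ?bs i ?bs * ?V" .
  show ?thesis
  \<comment> \<open>The shift of the row parameter by \<open>Y\<close> is computed from conservation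
    of colour in the remaining grid, which is available only if that grid is nonzero; otherwise both
    sides are 0.\<close>
  proof (cases "y = i \<and> grid M zs ws \<Lambda> Y ?bs ?cs tops \<noteq> 0")
    case False
    then show ?thesis
      using row_frozen(1)[OF i(2), where es = ?bs and ws = ws and z = z and \<Lambda> = "sh \<Lambda> Y" and a = y] unfolding eq by auto
  next
    case True
    then have ms: "mset Y + mset ?bs = mset ?cs + mset tops"
      using grid_nonzero[of M zs ws \<Lambda> Y ?bs ?cs tops] lY ltops by simp
    from arg_cong[OF ms, of "\<lambda>X. count X i"] have cY: "count (mset Y) i = ?c" using i(2) by simp
    from arg_cong[OF ms, of "\<lambda>X. count X ?n"] have "count (mset Y) ?n + ?N = ?k + count (mset tops) ?n" by simp
    with cnt have cYn: "count (mset Y) ?n = 0" by linarith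
    have shY: "sh \<Lambda> Y i - sh \<Lambda> Y ?n = ?x - \<gamma> * of_nat ?c"
      unfolding dyn_shift_def cY cYn by simp
    have c: "of_nat (count (mset tops) ?n) = (of_nat ?N - of_nat ?k :: complex)"
      unfolding cnt[symmetric] by simp
    have sht: "sh \<Lambda> tops ?n - sh \<Lambda> tops i = - ?x - \<gamma> * (of_nat ?N - of_nat ?k) + \<gamma> * of_nat ?c"
      unfolding dyn_shift_def c by (simp add: algebra_simps)
    have nz: "theta \<tau> (?x - \<gamma> * of_nat ?c + \<gamma> * of_nat ?N) \<noteq> 0"
      using generic_nonzero[OF gen i(1) top_colour_mem(1), of "int ?N - int ?c"] i(2) by (simp add: algebra_simps)
    have den: "theta \<tau> (sh \<Lambda> tops ?n - sh \<Lambda> tops i - \<gamma> * of_nat ?k) = - theta \<tau> (?x - \<gamma> * of_nat ?c + \<gamma> * of_nat ?N)"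
      unfolding sht theta_minus[symmetric] by (simp add: algebra_simps)
    have RV0: "row M z ws (sh \<Lambda> Y) i ?bs i ?bs * ?V = (\<Prod>w\<leftarrow>ws. theta \<tau> (z - w)) * (\<Prod>z'\<leftarrow>zs. theta \<tau> (z' - z + \<gamma>)) *
        (theta \<tau> \<gamma> * theta \<tau> (sh \<Lambda> tops ?n - sh \<Lambda> tops i + \<gamma>) / theta \<tau> (?x - \<gamma> * of_nat ?c))"
      unfolding row_frozen_eq[OF generic_dyn_shift[OF gen] i] shY den
      using nz by (simp add: field_simps)
    have E1: "sh \<Lambda> tops ?n - sh \<Lambda> tops i + \<gamma> = \<Lambda> (M + 1) - \<Lambda> i + \<gamma> * (of_nat (length zs) - of_nat (length ws) + of_nat (Suc (count (mset tops) i)))"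
      unfolding sht by (simp add: algebra_simps)
    have E2: "?x - \<gamma> * of_nat ?c = \<Lambda> i - \<Lambda> (M + 1) + \<gamma> * (1 - of_nat (Suc (count (mset tops) i)))"
      by (simp add: algebra_simps)
    have RV: "row M z ws (sh \<Lambda> Y) i ?bs i ?bs * ?V = (\<Prod>w\<leftarrow>ws. theta \<tau> (z - w)) * (\<Prod>z'\<leftarrow>zs. theta \<tau> (z' - z + \<gamma>)) *
        (theta \<tau> \<gamma> * theta \<tau> (\<Lambda> (M + 1) - \<Lambda> i + \<gamma> * (of_nat (length zs) - of_nat (length ws) + of_nat (Suc (count (mset tops) i))))
          / theta \<tau> (\<Lambda> i - \<Lambda> (M + 1) + \<gamma> * (1 - of_nat (Suc (count (mset tops) i)))))" (is "_ = ?X")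
      by (rule trans[OF RV0]) (simp only: E1 E2)
    have "grid M zs ws \<Lambda> Y ?bs ?cs tops * row M z ws (sh \<Lambda> Y) i ?bs i ?bs * ?V
        = grid M zs ws \<Lambda> Y ?bs ?cs tops * (row M z ws (sh \<Lambda> Y) i ?bs i ?bs * ?V)"
      by (rule mult.assoc)
    also have "\<dots> = ?X * grid M zs ws \<Lambda> Y ?bs ?cs tops"
      unfolding RV by (rule mult.commute)
    finally show ?thesis
      unfolding eq using True by (simp only: simp_thms if_True)
  qed
qed

text \<open>In a single row the colour i runs straight to the last column and turns up there. The
  telescoped numerator of the \<open>alpha\<close> weights cancels the denominator of the final
  \<open>beta\<close>.\<close>

lemma row_initial:
  assumes gen: "generic \<tau> \<gamma> M \<Lambda>" and i: "i \<in> colours M" "i \<noteq> M + 1" and y: "y \<in> colours M"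
  shows "grid M [z] (ws @ [w]) \<Lambda> [y] (replicate (Suc (length ws)) (M + 1)) [M + 1] (replicate (length ws) (M + 1) @ [i]) =
    (if y = i then theta \<tau> \<gamma> * theta \<tau> (z - w + \<Lambda> (M + 1) - \<Lambda> i - \<gamma> * of_nat (length ws)) / theta \<tau> (\<Lambda> i - \<Lambda> (M + 1)) *
       (\<Prod>w\<leftarrow>ws. theta \<tau> (z - w)) else 0)"
proof -
  let ?n = "M + 1" and ?N = "length ws"
  let ?bs = "replicate ?N ?n" and ?x = "\<Lambda> i - \<Lambda> ?n"
  have r: "replicate (Suc ?N) ?n = ?bs @ [?n]" by (simp add: replicate_append_same)
  have w1: "row M z [w] (sh \<Lambda> ?bs) x [?n] ?n [i] = beta \<tau> \<gamma> (z - w) (sh \<Lambda> ?bs ?n - sh \<Lambda> ?bs i) * (if x = i then 1 else 0)" for x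
    using i(2) by (simp add: sum_mult_delta weight_def)
  have "grid M [z] (ws @ [w]) \<Lambda> [y] (replicate (Suc ?N) ?n) [?n] (?bs @ [i]) =
     (\<Sum>x\<in>colours M. row M z ws \<Lambda> y ?bs x ?bs * row M z [w] (sh \<Lambda> ?bs) x [?n] ?n [i])"
    unfolding r using y by (subst grid_one_row) (auto simp: words_def row_append colours_def simp del: row.simps)
  also have "\<dots> = row M z ws \<Lambda> y ?bs i ?bs * beta \<tau> \<gamma> (z - w) (sh \<Lambda> ?bs ?n - sh \<Lambda> ?bs i)"
    unfolding w1 mult.assoc[symmetric] using i by (subst sum_mult_delta) simp_all
  finally have eq: "grid M [z] (ws @ [w]) \<Lambda> [y] (replicate (Suc ?N) ?n) [?n] (?bs @ [i]) =
     row M z ws \<Lambda> y ?bs i ?bs * beta \<tau> \<gamma> (z - w) (sh \<Lambda> ?bs ?n - sh \<Lambda> ?bs i)" .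
  show ?thesis
  proof (cases "y = i")
    case False
    then show ?thesis using row_frozen(1)[OF i(2), where es = ?bs and ws = ws and z = z and \<Lambda> = \<Lambda> and a = y] unfolding eq by auto
  next
    case True
    have s: "sh \<Lambda> ?bs ?n - sh \<Lambda> ?bs i = - (?x + \<gamma> * of_nat ?N)"
      using i(2) unfolding dyn_shift_def by (simp add: algebra_simps)
    have nz: "theta \<tau> (?x + \<gamma> * of_nat ?N) \<noteq> 0"
      using generic_nonzero[OF gen i(1) top_colour_mem(1), of "int ?N"] i(2) by (simp add: algebra_simps)
    have a: "z - w + - (?x + \<gamma> * of_nat ?N) = z - w + \<Lambda> ?n - \<Lambda> i - \<gamma> * of_nat ?N" by simp
    show ?thesis
      unfolding eq unfolding True row_frozen_eq[OF gen i] beta_def s theta_minus[of \<tau> "?x + \<gamma> * of_nat ?N"] a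
      using nz by (simp add: field_simps)
  qed
qed

end

section \<open>Coordinates and colours of the top layer\<close>

lemma Ihat_top: "Ihat d (layers d) = coordsM d"
  by (simp add: Ihat_def layer_coords_def)

lemma count_colM: "count (mset (colM d I)) a = card {c \<in> coordsM d. colour d I c = a}"
proof -
  have "count (mset (colM d I)) a = card {j \<in> {..<length (wMvars d)}. colour d I (offsetI d (layers d) + Suc j) = a}"
    unfolding count_mset count_list_eq_length_filter length_filter_conv_card
    by (rule arg_cong[of _ _ card]) (auto simp: colM_def simp del: upt_Suc)
  also have "\<dots> = card {c \<in> coordsM d. colour d I c = a}"
    by (rule bij_betw_same_card[of "\<lambda>j. offsetI d (layers d) + Suc j"], rule bij_betwI[where g = "\<lambda>c. c - Suc (offsetI d (layers d))"])
      (auto simp: coordsM_def)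
  finally show ?thesis .
qed

text \<open>A coordinate of layer M has the colour M + 1 or belongs to I^(M), whose size
  admissibility fixes. This is how k_M enters the dynamical arguments.\<close>

lemma count_colM_top:
  assumes "admissible d I" "layers d \<ge> 1"
  shows "count (mset (colM d I)) (layers d + 1) + length (zvars d (layers d)) = length (wMvars d)"
proof -
  let ?M = "layers d"
  have M: "?M \<in> {1..?M}" using assms(2) by simp
  obtain col where col: "colouring d col" "\<forall>j\<in>{1..?M}. I j = tuple_of_colouring d col j \<and> card (I j) = length (zvars d j)"
    using assms(1) by (auto simp: admissible_def)
  have c: "colour d I c = col c" if "c \<in> coordsM d" for c
    using colour_tuple_of_colouring[of d col I ?M c] col M that by (simp add: layer_coords_def)
  have le: "col c \<in> {1..?M + 1}" if "c \<in> coordsM d" for c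
  proof -
    have "\<forall>c\<in>layer_coords d ?M. col c \<in> {1..?M + 1}" using col(1) M unfolding colouring_def by blast
    then show ?thesis using that by (simp add: layer_coords_def)
  qed
  have IM: "I ?M = tuple_of_colouring d col ?M" "card (I ?M) = length (zvars d ?M)"
    using col(2) M by blast+
  have "length (zvars d ?M) = card {c \<in> coordsM d. col c \<in> {1..?M}}"
    using IM by (simp add: tuple_of_colouring_def Ihat_top)
  moreover have "{c \<in> coordsM d. colour d I c = ?M + 1} = {c \<in> coordsM d. col c = ?M + 1}"
    using c by auto
  moreover have "coordsM d = {c \<in> coordsM d. col c \<in> {1..?M}} \<union> {c \<in> coordsM d. col c = ?M + 1}"
    using le by force
  moreover have "card ({c \<in> coordsM d. col c \<in> {1..?M}} \<union> {c \<in> coordsM d. col c = ?M + 1}) =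
      card {c \<in> coordsM d. col c \<in> {1..?M}} + card {c \<in> coordsM d. col c = ?M + 1}"
    by (rule card_Un_disjoint) (auto simp: coordsM_def)
  moreover have "card (coordsM d) = length (wMvars d)" by (simp add: coordsM_def)
  ultimately show ?thesis by (simp add: count_colM)
qed

text \<open>The coordinates of layer M end at L^I, so the bound in C_* excludes none of them: C_*
  counts occurrences in the whole top word, the last letter included.\<close>

lemma colour_count_top:
  "colour_count d I (layers d) (offsetI d (layers d) + length (wMvars d)) a = count (mset (colM d I)) a"
  unfolding colour_count_def Ihat_top count_colM by (rule arg_cong[of _ _ card]) (auto simp: coordsM_def)

text \<open>The layers are nested around the block of layer M, each lower layer adding a block on
  either side. Relabelling of coordinates thereby becomes arithmetic with intervals.\<close>

lemma Ihat_interval: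
  assumes "j \<in> {1..layers d}"
  shows "Ihat d j = {offsetI d j <.. offsetI d (layers d) + length (wMvars d) + (\<Sum>q=j..<layers d. length (wIIvars d q))}"
proof -
  have "j \<le> layers d" "1 \<le> j" using assms by auto
  then show ?thesis
  proof (induction rule: inc_induct)
    case base
    then show ?case by (auto simp: Ihat_top coordsM_def)
  next
    case (step m)
    have "{m..layers d} = insert m {Suc m..layers d}" using step.hyps by auto
    then have "Ihat d m = layer_coords d m \<union> Ihat d (Suc m)" by (simp add: Ihat_def)
    moreover have "offsetI d (Suc m) = offsetI d m + length (wIvars d m)"
      using step.prems by (rule offsetI_Suc)
    moreover have "(\<Sum>q=m..<layers d. length (wIIvars d q)) = length (wIIvars d m) + (\<Sum>q=Suc m..<layers d. length (wIIvars d q))"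
      using step.hyps by (simp add: sum.atLeast_Suc_lessThan)
    moreover have "offsetI d (Suc m) \<le> offsetI d (layers d)" using step.hyps by (intro offsetI_mono) simp
    ultimately show ?case
      using step by (auto simp: layer_coords_def coordsI_def coordsII_def offsetII_def)
  qed
qed

lemma Ihat_layerE:
  assumes "c \<in> Ihat d j" "1 \<le> j"
  obtains p where "p \<in> {1..layers d}" "c \<in> layer_coords d p"
proof -
  from assms(1) obtain p where "p \<in> {j..layers d}" "c \<in> layer_coords d p" by (auto simp: Ihat_def)
  then show thesis using that[of p] assms(2) by auto
qed

lemma finite_Ihat [simp]: "finite (Ihat d j)"
  by (auto simp: Ihat_def layer_coords_def coordsI_def coordsII_def coordsM_def)

section \<open>Order-preserving relabelling of coordinates\<close>

context
  fixes d d' :: pf_data and I J :: "nat \<Rightarrow> nat set" and col \<phi> :: "nat \<Rightarrow> nat"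
  assumes col: "colouring d col" "\<forall>j\<in>{1..layers d}. I j = tuple_of_colouring d col j"
    and layers_le: "layers d' \<le> layers d"
    and \<phi>: "strict_mono \<phi>"
    and image: "\<And>j. j \<in> {1..layers d'} \<Longrightarrow> \<phi> ` Ihat d' j \<subseteq> Ihat d j"
    and J: "\<And>j. j \<in> {1..layers d'} \<Longrightarrow> J j = {c \<in> Ihat d' j. \<phi> c \<in> I j}"
begin

text \<open>A coordinate that \<phi> misses and whose colour exceeds j does not belong to I^(j), so
  nothing of I^(j) is lost.\<close>

lemma relabel_image:
  assumes "j \<in> {1..layers d'}" "\<And>c. c \<in> Ihat d j - \<phi> ` Ihat d' j \<Longrightarrow> j < col c"
  shows "\<phi> ` J j = I j"
proof
  show "\<phi> ` J j \<subseteq> I j" using J[OF assms(1)] by auto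
  have "I j = tuple_of_colouring d col j" using col(2) assms(1) layers_le by auto
  then show "I j \<subseteq> \<phi> ` J j"
    using J[OF assms(1)] assms(2) by (force simp: tuple_of_colouring_def)
qed

lemma relabel_card:
  assumes "j \<in> {1..layers d'}" "\<And>c. c \<in> Ihat d j - \<phi> ` Ihat d' j \<Longrightarrow> j < col c"
  shows "card (J j) = card (I j)"
  using relabel_image[OF assms] card_image[of \<phi> "J j"] \<phi> by (metis strict_mono_imp_inj_on inj_on_subset subset_UNIV)

context
  assumes col': "colouring d' (col \<circ> \<phi>)"
begin

lemma relabel_tuple:
  assumes "j \<in> {1..layers d'}"
  shows "J j = tuple_of_colouring d' (col \<circ> \<phi>) j"
  using J[OF assms] image[OF assms] col(2) assms layers_le by (auto simp: tuple_of_colouring_def)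

lemma relabel_admissible:
  assumes "\<And>j. j \<in> {1..layers d'} \<Longrightarrow> card (J j) = length (zvars d' j)"
  shows "admissible d' J"
  unfolding admissible_def using col' relabel_tuple assms by blast

lemma relabel_colour:
  assumes "p \<in> {1..layers d'}" "c \<in> layer_coords d' p"
  shows "colour d' J c = col (\<phi> c)"
  using colour_tuple_of_colouring[OF col' _ assms] relabel_tuple by simp

text \<open>\<open>Itilde\<close> ranks elements among the coordinates of colour at most j + 1. If
  every missed coordinate has a larger colour, the increasing map \<phi> leaves the ranks
  unchanged.\<close>

lemma relabel_Itilde:
  assumes j: "j \<in> {1..layers d'}" and away: "\<And>c. c \<in> Ihat d j - \<phi> ` Ihat d' j \<Longrightarrow> j + 1 < col c"
  shows "Itilde d' J j = Itilde d I j"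
proof -
  have c: "colour d I c = col c" if "c \<in> Ihat d j" for c
    using that j colour_tuple_of_colouring[OF col] by (auto elim!: Ihat_layerE)
  have c': "colour d' J c = col (\<phi> c)" if "c \<in> Ihat d' j" for c
    using that j relabel_colour by (auto elim!: Ihat_layerE)
  have "card {c' \<in> Ihat d' j. colour d' J c' \<in> {1..j+1} \<and> c' \<le> c} =
      card {c' \<in> Ihat d j. colour d I c' \<in> {1..j+1} \<and> c' \<le> \<phi> c}" for c
  proof -
    have "{c' \<in> Ihat d j. colour d I c' \<in> {1..j+1} \<and> c' \<le> \<phi> c} =
       \<phi> ` {c' \<in> Ihat d' j. colour d' J c' \<in> {1..j+1} \<and> c' \<le> c}"
    proof (intro equalityI subsetI)
      fix x assume x: "x \<in> {c' \<in> Ihat d j. colour d I c' \<in> {1..j+1} \<and> c' \<le> \<phi> c}"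
      then have "col x \<le> j + 1" using c by auto
      then obtain y where "y \<in> Ihat d' j" "x = \<phi> y" using away[of x] x by force
      then show "x \<in> \<phi> ` {c' \<in> Ihat d' j. colour d' J c' \<in> {1..j+1} \<and> c' \<le> c}"
        using x c c' \<phi> by (auto simp: strict_mono_less_eq)
    next
      fix x assume "x \<in> \<phi> ` {c' \<in> Ihat d' j. colour d' J c' \<in> {1..j+1} \<and> c' \<le> c}"
      then show "x \<in> {c' \<in> Ihat d j. colour d I c' \<in> {1..j+1} \<and> c' \<le> \<phi> c}"
        using c c' image[OF j] \<phi> by (auto simp: strict_mono_less_eq)
    qed
    then show ?thesis
      using \<phi> by (simp add: card_image strict_mono_imp_inj_on inj_on_subset[of \<phi> UNIV])
  qed
  moreover have "\<phi> ` J j = I j" using relabel_image[OF j] away by fastforce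
  ultimately show ?thesis
    unfolding Itilde_def by (simp only: image_image flip: \<open>\<phi> ` J j = I j\<close>)
qed

lemma relabel_col_words:
  shows "p \<in> {1..<layers d'} \<Longrightarrow> (\<And>s. s \<in> {1..length (wIvars d' p)} \<Longrightarrow> \<phi> (offsetI d' p + s) = offsetI d p + s) \<Longrightarrow>
      length (wIvars d' p) = length (wIvars d p) \<Longrightarrow> colI d' J p = colI d I p"
    and "p \<in> {1..<layers d'} \<Longrightarrow> (\<And>s. s \<in> {1..length (wIIvars d' p)} \<Longrightarrow> \<phi> (offsetII d' p + s) = offsetII d p + s) \<Longrightarrow>
      length (wIIvars d' p) = length (wIIvars d p) \<Longrightarrow> colII d' J p = colII d I p"
proof -
  assume p: "p \<in> {1..<layers d'}" and s: "\<And>s. s \<in> {1..length (wIvars d' p)} \<Longrightarrow> \<phi> (offsetI d' p + s) = offsetI d p + s"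
    and l: "length (wIvars d' p) = length (wIvars d p)"
  have "colour d' J (offsetI d' p + r) = colour d I (offsetI d p + r)" if r: "r \<in> {1..length (wIvars d p)}" for r
  proof -
    have "colour d' J (offsetI d' p + r) = col (offsetI d p + r)"
      using relabel_colour[of p "offsetI d' p + r"] p r l s[of r] by (simp add: layer_coords_def coordsI_def)
    also have "\<dots> = colour d I (offsetI d p + r)"
      using colour_tuple_of_colouring[OF col, of p "offsetI d p + r"] p r layers_le by (simp add: layer_coords_def coordsI_def)
    finally show ?thesis .
  qed
  then show "colI d' J p = colI d I p" using l by (auto simp: colI_def simp del: upt_Suc)
next
  assume p: "p \<in> {1..<layers d'}" and s: "\<And>s. s \<in> {1..length (wIIvars d' p)} \<Longrightarrow> \<phi> (offsetII d' p + s) = offsetII d p + s"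
    and l: "length (wIIvars d' p) = length (wIIvars d p)"
  have "colour d' J (offsetII d' p + r) = colour d I (offsetII d p + r)" if r: "r \<in> {1..length (wIIvars d p)}" for r
  proof -
    have "colour d' J (offsetII d' p + r) = col (offsetII d p + r)"
      using relabel_colour[of p "offsetII d' p + r"] p r l s[of r] by (simp add: layer_coords_def coordsII_def)
    also have "\<dots> = colour d I (offsetII d p + r)"
      using colour_tuple_of_colouring[OF col, of p "offsetII d p + r"] p r layers_le by (simp add: layer_coords_def coordsII_def)
    finally show ?thesis .
  qed
  then show "colII d' J p = colII d I p" using l by (auto simp: colII_def simp del: upt_Suc)
qed

end

end

text \<open>Descending from layer m: parameters that agree after a shift by the same word agree
  before it.\<close>

lemma shifted_lam_cong:
  assumes "shifted_lam \<gamma> d' J lam' m = shifted_lam \<gamma> d I lam m" "m \<le> layers d" "m \<le> layers d'"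
    and "\<And>q. q \<in> {1..<m} \<Longrightarrow> colI d' J q = colI d I q" "p \<in> {1..m}"
  shows "shifted_lam \<gamma> d' J lam' p = shifted_lam \<gamma> d I lam p"
proof -
  have "p \<le> m" "1 \<le> p" using assms(5) by auto
  then show ?thesis
  proof (induction rule: inc_induct)
    case (step q)
    then have "dyn_shift \<gamma> (shifted_lam \<gamma> d' J lam' q) (colI d I q) = dyn_shift \<gamma> (shifted_lam \<gamma> d I lam q) (colI d I q)"
      using dyn_shift_colI[of q d' \<gamma> J lam'] dyn_shift_colI[of q d \<gamma> I lam] assms(2-4) by simp
    then show ?case by (simp add: dyn_shift_def fun_eq_iff)
  qed (rule assms(1))
qed

section \<open>Restriction to fewer colours\<close>

lemma colours_mono: "N \<le> M \<Longrightarrow> colours N \<subseteq> colours M"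
  by (auto simp: colours_def)

lemma words_mono: "N \<le> M \<Longrightarrow> words N n \<subseteq> words M n"
  using colours_mono by (auto simp: words_def)

context vertex_model
begin

lemma row_fewer_colours:
  assumes "N \<le> M" "a \<in> colours N" "bs \<in> words N (length ws)"
  shows "row M z ws \<Lambda> a bs c es = row N z ws \<Lambda> a bs c es"
  using assms
proof (induction ws arbitrary: \<Lambda> a bs es)
  case (Cons w ws)
  from Cons.prems obtain b bs' where [simp]: "bs = b # bs'" and b: "b \<in> colours N" "bs' \<in> words N (length ws)"
    by (metis Cons_mem_words length_Cons length_Suc_conv length_words)
  have "row M z (w # ws) \<Lambda> a bs c es = (\<Sum>x\<in>colours M. weight \<tau> \<gamma> z w \<Lambda> a b x (hd es) * row M z ws (sh \<Lambda> [hd es]) x bs' c (tl es))"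
    by simp
  also have "\<dots> = (\<Sum>x\<in>colours N. weight \<tau> \<gamma> z w \<Lambda> a b x (hd es) * row M z ws (sh \<Lambda> [hd es]) x bs' c (tl es))"
    using colours_mono[OF Cons.prems(1)] weight_nonzero[of \<tau> \<gamma> z w \<Lambda> a b _ "hd es"] Cons.prems(2) b
    by (intro sum.mono_neutral_right) auto
  also have "\<dots> = row N z (w # ws) \<Lambda> a bs c es"
    using Cons.IH Cons.prems(1) b by (simp cong: sum.cong)
  finally show ?case .
qed simp

text \<open>By conservation of colour no colour occurs inside a grid that does not enter on its left
  or bottom boundary. The additional words in the larger sum contribute 0, which allows a layer of
  the larger model to be read in the smaller one.\<close>

lemma grid_fewer_colours:
  assumes "N \<le> M" "as \<in> words N (length zs)" "bs \<in> words N (length ws)" "length cs = length zs"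
  shows "grid M zs ws \<Lambda> as bs cs es = grid N zs ws \<Lambda> as bs cs es"
  using assms
proof (induction zs arbitrary: \<Lambda> as cs es)
  case (Cons z zs)
  from Cons.prems obtain a as' c cs' where [simp]: "as = a # as'" "cs = c # cs'" and a: "a \<in> colours N" "as' \<in> words N (length zs)"
    and l: "length cs' = length zs"
    by (metis Cons_mem_words length_Cons length_Suc_conv length_words)
  have zero: "grid M zs ws (sh \<Lambda> [a]) as' bs cs' us = 0" if "us \<in> words M (length ws) - words N (length ws)" for us
  proof (rule ccontr)
    assume "grid M zs ws (sh \<Lambda> [a]) as' bs cs' us \<noteq> 0"
    from grid_nonzero[OF this] a l Cons.prems(3) that have "mset as' + mset bs = mset cs' + mset us"
      by (auto simp: words_def)
    then have "set us \<subseteq> set as' \<union> set bs"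
      by (metis Un_upper2 set_mset_mset set_mset_union)
    then show False using that a Cons.prems(3) by (auto simp: words_def)
  qed
  have "grid M (z # zs) ws \<Lambda> as bs cs es = (\<Sum>us\<in>words M (length ws). row M z ws \<Lambda> a us c es * grid M zs ws (sh \<Lambda> [a]) as' bs cs' us)"
    by simp
  also have "\<dots> = (\<Sum>us\<in>words N (length ws). row M z ws \<Lambda> a us c es * grid M zs ws (sh \<Lambda> [a]) as' bs cs' us)"
    using words_mono[OF Cons.prems(1)] zero by (intro sum.mono_neutral_right) auto
  also have "\<dots> = (\<Sum>us\<in>words N (length ws). row N z ws \<Lambda> a us c es * grid N zs ws (sh \<Lambda> [a]) as' bs cs' us)"
    using Cons.IH[of as' cs'] Cons.prems a l row_fewer_colours[OF Cons.prems(1) a(1)] by (intro sum.cong refl) simp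
  finally show ?case by simp
qed simp

text \<open>The bottom boundary of layer p supplies only the colour p + 1, and the left boundary, by
  induction, only colours up to p; hence the word above has colours up to p + 1.\<close>

lemma layers_sum_support:
  assumes adm: "admissible d I" and "p < layers d" "layers_sum d I lam p X \<noteq> 0" "length X = length (zvars d (Suc p))"
  shows "set X \<subseteq> colours p"
  using assms(2-4)
proof (induction p arbitrary: X)
  case 0
  then show ?case by (auto simp: layers_sum_def colours_def split: if_splits)
next
  case (Suc p)
  from Suc.prems(2) obtain Y where Y: "Y \<in> words (layers d) (length (zvars d (Suc p)))"
    "layers_sum d I lam p Y \<noteq> 0" "layer_kernel d I lam (Suc p) Y X \<noteq> 0"
    unfolding layers_sum_def lay.simps by (metis (no_types, lifting) mult_eq_0_iff sum.neutral)
  have len: "length (top_word d I (Suc p) X) = ncols d (Suc p)"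
    using Suc.prems by (simp add: top_word_def ncols_def column_vars_def)
  have "mset Y + mset (replicate (ncols d (Suc p)) (Suc p + 1)) = mset (replicate (nrows d (Suc p)) (Suc p + 1)) + mset (top_word d I (Suc p) X)"
    using grid_nonzero[OF Y(3)[unfolded layer_kernel_def]] Y(1) len by (simp add: nrows_def ncols_def length_words)
  then have "set (top_word d I (Suc p) X) \<subseteq> set Y \<union> set (replicate (ncols d (Suc p)) (Suc p + 1))"
    by (metis Un_upper2 set_mset_mset set_mset_union)
  moreover have "set X \<subseteq> set (top_word d I (Suc p) X)" using Suc.prems by (auto simp: top_word_def)
  moreover have "set Y \<subseteq> colours p" using Suc.IH[of Y] Suc.prems Y by (simp add: length_words)
  moreover have "set (replicate (ncols d (Suc p)) (Suc p + 1)) \<subseteq> {Suc p + 1}" by auto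
  ultimately have "set X \<subseteq> colours p \<union> {Suc p + 1}" by blast
  also have "\<dots> \<subseteq> colours (Suc p)" by (auto simp: colours_def)
  finally show ?case .
qed

lemma layers_sum_cong:
  assumes "layers d' = layers d" "zvars d' 1 = zvars d 1"
    and "\<And>q. q \<in> {1..p} \<Longrightarrow> zvars d' q = zvars d q"
    and "\<And>q. q \<in> {1..p} \<Longrightarrow> column_vars d' q = column_vars d q"
    and "\<And>q X. q \<in> {1..p} \<Longrightarrow> top_word d' J q X = top_word d I q X"
    and "\<And>q. q \<in> {1..p} \<Longrightarrow> shifted_lam \<gamma> d' J lam' q = shifted_lam \<gamma> d I lam q"
  shows "layers_sum d' J lam' p X = layers_sum d I lam p X"
  unfolding layers_sum_def assms(1)
  by (rule lay_cong) (use assms in \<open>auto simp: layer_kernel_def nrows_def ncols_def\<close>)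

end

lemma prod_entry: "(\<Prod>j=1..length xs. f (entry xs j)) = (\<Prod>x\<leftarrow>xs. f x)"
proof (induction xs rule: rev_induct)
  case (snoc x xs)
  have "(\<Prod>j=1..length xs. f (entry (xs @ [x]) j)) = (\<Prod>j=1..length xs. f (entry xs j))"
    by (intro prod.cong) (auto simp: entry_def nth_append)
  then show ?case using snoc by (simp add: entry_def)
qed simp

lemma sum_entry: "(\<Sum>j=1..length xs. entry xs j) = sum_list xs"
proof (induction xs rule: rev_induct)
  case (snoc x xs)
  have "(\<Sum>j=1..length xs. entry (xs @ [x]) j) = (\<Sum>j=1..length xs. entry xs j)"
    by (intro sum.cong) (auto simp: entry_def nth_append)
  then show ?case using snoc by (simp add: entry_def)
qed simp

section \<open>Consequences for the last variable of the top layer\<close>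

lemma update_wM:
  assumes "length ws = length (wMvars d)"
  shows "colour (d\<lparr>wMvars := ws\<rparr>) I = colour d I"
    and "offsetI (d\<lparr>wMvars := ws\<rparr>) = offsetI d" "offsetII (d\<lparr>wMvars := ws\<rparr>) = offsetII d"
    and "Ihat (d\<lparr>wMvars := ws\<rparr>) = Ihat d" "layer_coords (d\<lparr>wMvars := ws\<rparr>) = layer_coords d"
    and "coordsI (d\<lparr>wMvars := ws\<rparr>) = coordsI d"
  using assms
  by (simp_all add: fun_eq_iff colour_def Ihat_def layer_coords_def coordsI_def coordsII_def coordsM_def offsetI_def offsetII_def)

context vertex_model
begin

lemma psi_update_wM:
  assumes adm: "admissible d I" and M: "layers d \<ge> 1" and ws: "length ws = length (wMvars d)"
  shows "psi \<tau> \<gamma> (d\<lparr>wMvars := ws\<rparr>) I lam = (\<Sum>Y\<in>words (layers d) (length (zvars d (layers d))).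
     layers_sum d I lam (layers d - 1) Y * grid (layers d) (zvars d (layers d)) ws lam Y
       (replicate (length ws) (layers d + 1)) (replicate (length (zvars d (layers d))) (layers d + 1)) (colM d I))"
proof -
  let ?d = "d\<lparr>wMvars := ws\<rparr>"
  note u = update_wM[OF ws]
  have "admissible ?d I"
    using adm by (simp add: admissible_def colouring_def tuple_of_colouring_def u)
  moreover have "colM ?d I = colM d I" by (simp add: colM_def u ws del: upt_Suc)
  moreover have "layers_sum ?d I lam (layers d - 1) Y = layers_sum d I lam (layers d - 1) Y" for Y
  proof (rule layers_sum_cong)
    fix q assume q: "q \<in> {1..layers d - 1}"
    then show "column_vars ?d q = column_vars d q" by (auto simp: column_vars_def)
    show "top_word ?d I q X = top_word d I q X" for X
      using q by (auto simp: top_word_def colI_def colII_def u simp del: upt_Suc)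
    show "shifted_lam \<gamma> ?d I lam q = shifted_lam \<gamma> d I lam q"
      by (simp add: shifted_lam_def fun_eq_iff u)
  qed simp_all
  ultimately show ?thesis using psi_layers[of ?d I lam] M by simp
qed

lemma colM_snoc:
  assumes "length (wMvars d) = Suc n"
  obtains tops where "colM d I = tops @ [colour d I (offsetI d (layers d) + Suc n)]" "length tops = n"
    "tops = map (\<lambda>s. colour d I (offsetI d (layers d) + s)) [1..<Suc n]"
  using assms by (auto simp: colM_def)

text \<open>The variable enters through the last column of the top grid only, and \<open>S\<close>
  is the same for every interface word Y, so the sum over Y stays in the class.\<close>

lemma psi_quasi_periodic:
  fixes d
  defines "M \<equiv> layers d"
  assumes adm: "admissible d I" and M: "M \<ge> 1" and L: "length (wMvars d) = Suc n"
    and i: "i = colour d I (offsetI d M + Suc n)" "i \<noteq> M + 1"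
  shows "quasi_periodic (length (zvars d M))
     (sum_list (zvars d M) - (lam i - lam (M + 1) + \<gamma> * (of_nat (Suc n) - of_nat (count (mset (colM d I)) i))))
     (\<lambda>x. psi \<tau> \<gamma> (d\<lparr>wMvars := (wMvars d)[n := x]\<rparr>) I lam)"
proof -
  define ws where "ws = butlast (wMvars d)"
  have lws: "length ws = n" using L by (simp add: ws_def)
  have upd: "(wMvars d)[n := x] = ws @ [x]" for x
    using L unfolding ws_def by (metis append_butlast_last_id length_0_conv length_append_singleton list_update_length nat.inject nat.distinct(1))
  obtain tops where t: "colM d I = tops @ [i]" "length tops = n"
    using colM_snoc[OF L, of I] i(1) M_def by metis
  have cw: "colM d I \<in> words M (Suc n)"
    using colI_colII_colM_words(3)[OF adm, of M] M L by (simp add: M_def)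
  then have iw: "i \<in> colours M" using t by (auto simp: words_def)
  have cnt: "count (mset tops) (M + 1) + length (zvars d M) = Suc n"
    using count_colM_top[OF adm] M L i(2) t by (simp add: M_def)
  have psi: "psi \<tau> \<gamma> (d\<lparr>wMvars := (wMvars d)[n := x]\<rparr>) I lam = (\<Sum>Y\<in>words M (length (zvars d M)).
     layers_sum d I lam (M - 1) Y * grid M (zvars d M) (ws @ [x]) lam Y
       (replicate (Suc (length ws)) (M + 1)) (replicate (length (zvars d M)) (M + 1)) (tops @ [i]))" for x
    using psi_update_wM[OF adm, of "(wMvars d)[n := x]" lam] M L unfolding t upd M_def by (simp add: lws)
  have c: "count (mset (colM d I)) i = Suc (count (mset tops) i)" by (simp add: t)
  show ?thesis
    unfolding psi c
    using quasi_periodic_grid_last_col[OF _ _ iw i(2), of _ "zvars d M" tops ws lam] t(2) lws cnt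
    by (intro quasi_periodic_sum quasi_periodic_cmult) auto
qed

text \<open>A coordinate of colour M + 1 lies in no I^(j); deleting it only renumbers the
  coordinates behind it. Its column is frozen and contributes a product independent of the interface
  word.\<close>

lemma psi_remove_top:
  fixes d
  defines "M \<equiv> layers d"
  assumes adm: "admissible d I" and M: "M \<ge> 1" and L: "length (wMvars d) = Suc n"
    and i: "colour d I (offsetI d M + Suc n) = M + 1"
  defines "LI \<equiv> offsetI d M + Suc n"
  defines "d' \<equiv> d\<lparr>wMvars := butlast (wMvars d)\<rparr>"
    and "J \<equiv> (\<lambda>i. if i < M then {j \<in> I i. j \<le> LI} \<union> {j - 1 | j. j \<in> I i \<and> j > LI} else I i)"
  shows "admissible d' J" "\<And>j. j \<in> {1..M - 1} \<Longrightarrow> Itilde d' J j = Itilde d I j"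
    and "psi \<tau> \<gamma> d I lam = (\<Prod>z\<leftarrow>zvars d M. theta \<tau> (z - last (wMvars d) - \<gamma>)) * psi \<tau> \<gamma> d' J lam"
proof -
  \<comment> \<open>The increasing map that skips the deleted coordinate \<open>LI\<close>.\<close>
  define \<phi> where "\<phi> c = (if c < LI then c else Suc c)" for c
  obtain col where col: "colouring d col" "\<forall>j\<in>{1..layers d}. I j = tuple_of_colouring d col j \<and> card (I j) = length (zvars d j)"
    using adm by (auto simp: admissible_def)
  then have col2: "\<forall>j\<in>{1..layers d}. I j = tuple_of_colouring d col j" by blast
  have off: "offsetI d' = offsetI d" "\<And>p. Suc (offsetII d' p) = offsetII d p" "\<And>p. LI \<le> offsetII d p"
    using L by (auto simp: offsetI_def offsetII_def d'_def LI_def M_def fun_eq_iff)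
  have ld: "layers d' = M" "zvars d' = zvars d" "length (wMvars d') = n" "wIvars d' = wIvars d" "wIIvars d' = wIIvars d" using L by (simp_all add: d'_def M_def)
  have smono: "strict_mono \<phi>" by (auto simp: strict_mono_def \<phi>_def)
  have offM: "offsetI d j \<le> offsetI d M" if "j \<le> M" for j using that by (rule offsetI_mono)
  have Ih: "Ihat d j = insert LI (\<phi> ` Ihat d' j)" "LI \<notin> \<phi> ` Ihat d' j" if j: "j \<in> {1..M}" for j
  proof -
    define U where "U = offsetI d M + n + (\<Sum>q=j..<M. length (wIIvars d q))"
    have 1: "Ihat d j = {offsetI d j <.. Suc U}" "Ihat d' j = {offsetI d j <.. U}"
      using Ihat_interval[of j d] Ihat_interval[of j d'] j off ld L by (simp_all add: U_def M_def d'_def)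
    have 2: "offsetI d j < LI" "LI \<le> Suc U" using offM[of j] j by (auto simp: LI_def U_def)
    have A: "x \<in> \<phi> ` {offsetI d j <.. U}" if "x \<in> {offsetI d j <.. Suc U}" "x \<noteq> LI" for x
      using that 2 by (intro image_eqI[of _ _ "if x < LI then x else x - 1"]) (auto simp: \<phi>_def)
    have B: "\<phi> ` {offsetI d j <.. U} \<subseteq> {offsetI d j <.. Suc U}" by (auto simp: \<phi>_def)
    have "LI \<in> {offsetI d j <.. Suc U}" using 2 by simp
    then show "Ihat d j = insert LI (\<phi> ` Ihat d' j)" unfolding 1 using A B by blast
    show "LI \<notin> \<phi> ` Ihat d' j" by (auto simp: \<phi>_def)
  qed
  have LIM: "LI \<in> layer_coords d M" "M \<in> {1..layers d}" using L M by (simp_all add: layer_coords_def coordsM_def LI_def M_def)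
  have colLI: "col LI = M + 1"
    using colour_tuple_of_colouring[OF col(1) col2 LIM(2,1)] i by (simp add: LI_def)
  have notin: "LI \<notin> I j" if "j \<in> {1..M}" for j
    using col2 that colLI by (auto simp: tuple_of_colouring_def M_def)
  have sub: "I j \<subseteq> Ihat d j" if "j \<in> {1..M}" for j
    using col2 that by (auto simp: tuple_of_colouring_def M_def)
  have Jeq: "J j = {c \<in> Ihat d' j. \<phi> c \<in> I j}" if j: "j \<in> {1..M}" for j
  proof -
    have pre: "{c. \<phi> c \<in> I j} = {c \<in> I j. c \<le> LI} \<union> {c - 1 | c. c \<in> I j \<and> c > LI}"
    proof (intro equalityI subsetI)
      fix c assume c: "c \<in> {c. \<phi> c \<in> I j}"
      show "c \<in> {c \<in> I j. c \<le> LI} \<union> {c - 1 | c. c \<in> I j \<and> c > LI}"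
        using c by (cases "c < LI") (auto simp: \<phi>_def intro!: exI[of _ "Suc c"])
    next
      fix c assume "c \<in> {c \<in> I j. c \<le> LI} \<union> {c - 1 | c. c \<in> I j \<and> c > LI}"
      then show "c \<in> {c. \<phi> c \<in> I j}" using notin[OF j] by (auto simp: \<phi>_def le_less)
    qed
    have "c \<in> Ihat d' j" if "\<phi> c \<in> I j" for c
      using sub[OF j] Ih[OF j] notin[OF j] that smono by (auto simp: strict_mono_eq)
    then have "{c \<in> Ihat d' j. \<phi> c \<in> I j} = {c. \<phi> c \<in> I j}" by auto
    also have "\<dots> = J j"
    \<comment> \<open>No coordinate of layer M lies behind \<open>LI\<close>, so for j = M nothing
      is renumbered.\<close>
    proof (cases "j < M")
      case True
      then show ?thesis unfolding pre by (simp add: J_def)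
    next
      case False
      then have "j = M" using j by auto
      then have "I j \<subseteq> {..LI}" using sub[OF j] by (auto simp: Ihat_top M_def coordsM_def LI_def L)
      then show ?thesis unfolding pre using False by (auto simp: J_def)
    qed
    finally show ?thesis ..
  qed
  have image: "\<phi> ` Ihat d' j \<subseteq> Ihat d j" if "j \<in> {1..layers d'}" for j using Ih[of j] that ld by auto
  have Jeq': "J j = {c \<in> Ihat d' j. \<phi> c \<in> I j}" if "j \<in> {1..layers d'}" for j using Jeq that ld by simp
  have le: "layers d' \<le> layers d" using ld by (simp add: M_def)
  note rl = col(1) col2 le smono image Jeq'
  have lay: "\<phi> c \<in> layer_coords d p" if "p \<in> {1..layers d'}" "c \<in> layer_coords d' p" for p c
  proof (cases "p < M")
    case True
    then have "offsetI d p + length (wIvars d p) \<le> offsetI d M" using offsetI_less[of p M d] that by auto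
    then show ?thesis
      using that True off(2)[of p] off(3)[of p] ld L
      by (auto simp: layer_coords_def M_def coordsI_def coordsII_def off(1) \<phi>_def LI_def split: if_splits)
  next
    case False
    then show ?thesis
      using that ld L by (auto simp: layer_coords_def M_def coordsM_def off(1) \<phi>_def LI_def)
  qed
  have col': "colouring d' (col \<circ> \<phi>)"
    unfolding colouring_def using lay col(1) ld by (auto simp: colouring_def M_def)
  have away: "col c = M + 1" if "c \<in> Ihat d j - \<phi> ` Ihat d' j" "j \<in> {1..M}" for c j
    using Ih[of j] that colLI by auto
  have card: "card (J j) = length (zvars d' j)" if j: "j \<in> {1..layers d'}" for j
  proof -
    have "card (J j) = card (I j)"
      by (rule relabel_card[OF rl j]) (use away j ld in fastforce)+
    moreover have "card (I j) = length (zvars d j)" using col(2) j unfolding ld(1) M_def by blast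
    ultimately show ?thesis using ld by simp
  qed
  show admJ: "admissible d' J"
    by (rule relabel_admissible[OF rl col' card])
  show "Itilde d' J j = Itilde d I j" if j: "j \<in> {1..M - 1}" for j
    by (rule relabel_Itilde[OF rl col']) (use j ld away[of _ j] in auto)
  have cI: "colI d' J p = colI d I p" if p: "p \<in> {1..<M}" for p
  proof (rule relabel_col_words(1)[OF rl col'])
    have "offsetI d p + length (wIvars d p) \<le> offsetI d M" using offsetI_less[of p M d] p by auto
    then show "\<phi> (offsetI d' p + s) = offsetI d p + s" if "s \<in> {1..length (wIvars d' p)}" for s
      using that by (auto simp: off(1) ld \<phi>_def LI_def)
  qed (use p ld in auto)
  have cII: "colII d' J p = colII d I p" if p: "p \<in> {1..<M}" for p
  proof (rule relabel_col_words(2)[OF rl col'])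
    show "\<phi> (offsetII d' p + s) = offsetII d p + s" if "s \<in> {1..length (wIIvars d' p)}" for s
      using that off(2)[of p] off(3)[of p] by (auto simp: \<phi>_def)
  qed (use p ld in auto)
  obtain tops where t: "colM d I = tops @ [M + 1]" "length tops = n"
    "tops = map (\<lambda>s. colour d I (offsetI d M + s)) [1..<Suc n]"
    using colM_snoc[OF L, of I] i unfolding M_def by metis
  have cM: "colM d' J = tops"
  proof -
    have "colour d' J (offsetI d M + s) = colour d I (offsetI d M + s)" if s: "s \<in> {1..n}" for s
    proof -
      have c: "offsetI d M + s \<in> layer_coords d' M" "offsetI d M + s \<in> layer_coords d M"
        using s ld L by (simp_all add: layer_coords_def coordsM_def off(1) M_def)
      have "colour d' J (offsetI d M + s) = col (offsetI d M + s)"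
        using relabel_colour[OF rl col' _ c(1)] M ld s by (simp add: \<phi>_def LI_def)
      then show ?thesis using colour_tuple_of_colouring[OF col(1) col2 LIM(2) c(2)] by simp
    qed
    then show ?thesis unfolding t(3) using ld by (auto simp: colM_def off(1) M_def simp del: upt_Suc)
  qed
  have shl: "shifted_lam \<gamma> d' J lam q = shifted_lam \<gamma> d I lam q" if "q \<in> {1..M}" for q
    by (rule shifted_lam_cong[where m = M])
      (use that cI ld shifted_lam_top[of \<gamma> d' J lam] shifted_lam_top[of \<gamma> d I lam] in \<open>auto simp: M_def\<close>)
  have ls: "layers_sum d' J lam (M - 1) Y = layers_sum d I lam (M - 1) Y" for Y
  proof (rule layers_sum_cong)
    fix q assume q: "q \<in> {1..M - 1}"
    then show "column_vars d' q = column_vars d q" by (auto simp: column_vars_def d'_def M_def)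
    show "top_word d' J q X = top_word d I q X" for X
      using q cI[of q] cII[of q] ld by (auto simp: top_word_def M_def)
    show "shifted_lam \<gamma> d' J lam q = shifted_lam \<gamma> d I lam q" using q by (intro shl) auto
  qed (simp_all add: d'_def)
  define ws where "ws = butlast (wMvars d)"
  have ws: "wMvars d = ws @ [last (wMvars d)]" "length ws = n" "wMvars d' = ws"
    using L by (auto simp: ws_def d'_def intro!: append_butlast_last_id[symmetric])
  let ?k = "length (zvars d M)" and ?P = "\<Prod>z\<leftarrow>zvars d M. theta \<tau> (z - last (wMvars d) - \<gamma>)"
  have "psi \<tau> \<gamma> d I lam = (\<Sum>Y\<in>words M ?k. layers_sum d I lam (M - 1) Y *
      grid M (zvars d M) (ws @ [last (wMvars d)]) lam Y (replicate (Suc (length ws)) (M + 1)) (replicate ?k (M + 1)) (tops @ [M + 1]))"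
    using psi_layers[OF adm, of lam] M ws L unfolding t(1) M_def by simp
  also have "\<dots> = (\<Sum>Y\<in>words M ?k. ?P * (layers_sum d' J lam (M - 1) Y *
      grid M (zvars d M) ws lam Y (replicate (length ws) (M + 1)) (replicate ?k (M + 1)) tops))"
  proof (intro sum.cong refl)
    fix Y assume Y: "Y \<in> words M ?k"
    have "grid M (zvars d M) (ws @ [last (wMvars d)]) lam Y (replicate (Suc (length ws)) (M + 1)) (replicate ?k (M + 1)) (tops @ [M + 1])
      = ?P * grid M (zvars d M) ws lam Y (replicate (length ws) (M + 1)) (replicate ?k (M + 1)) tops"
      using Y t(2) ws(2) by (intro grid_last_col_max) simp_all
    then show "layers_sum d I lam (M - 1) Y * grid M (zvars d M) (ws @ [last (wMvars d)]) lam Y (replicate (Suc (length ws)) (M + 1)) (replicate ?k (M + 1)) (tops @ [M + 1])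
      = ?P * (layers_sum d' J lam (M - 1) Y * grid M (zvars d M) ws lam Y (replicate (length ws) (M + 1)) (replicate ?k (M + 1)) tops)"
      by (simp only: ls mult.left_commute)
  qed
  also have "\<dots> = ?P * psi \<tau> \<gamma> d' J lam"
    using psi_layers[OF admJ, of lam] M ws ld cM by (simp add: sum_distrib_left)
  finally show "psi \<tau> \<gamma> d I lam = ?P * psi \<tau> \<gamma> d' J lam" .
qed

end

text \<open>Once the last row and the last column are frozen, the line of the last z-variable is a
  column of layer M - 1 that enters with the colour i. The coordinate \<open>LI\<close> is not
  deleted; it passes from layer M to layer M - 1 in its old position, and therefore only I^(M)
  changes.\<close>

lemma (in vertex_model) psi_specialise:
  fixes d
  defines "M \<equiv> layers d"
  assumes adm: "admissible d I" and M: "M \<ge> 2" and gen: "generic \<tau> \<gamma> M lam"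
    and L: "length (wMvars d) = Suc n"
    and i: "i = colour d I (offsetI d M + Suc n)" "i \<noteq> M + 1"
  defines "LI \<equiv> offsetI d M + Suc n" and "z \<equiv> last (zvars d M)"
  defines "d' \<equiv> d\<lparr>zvars := (zvars d)(M := butlast (zvars d M)),
      wIIvars := (wIIvars d)(M - 1 := z # wIIvars d (M - 1)), wMvars := butlast (wMvars d)\<rparr>"
    and "J \<equiv> I(M := I M - {LI})"
  shows "zvars d M \<noteq> []" "admissible d' J" "\<And>j. j \<in> {1..M - 1} \<Longrightarrow> Itilde d' J j = Itilde d I j"
    and "psi \<tau> \<gamma> (d\<lparr>wMvars := (wMvars d)[n := z - \<gamma>]\<rparr>) I lam =
      (\<Prod>w\<leftarrow>butlast (wMvars d). theta \<tau> (z - w)) * (\<Prod>z'\<leftarrow>butlast (zvars d M). theta \<tau> (z' - z + \<gamma>)) *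
        (theta \<tau> \<gamma> * theta \<tau> (lam (M + 1) - lam i + \<gamma> * (of_nat (length (zvars d M) - 1) - of_nat n + of_nat (count (mset (colM d I)) i)))
          / theta \<tau> (lam i - lam (M + 1) + \<gamma> * (1 - of_nat (count (mset (colM d I)) i)))) * psi \<tau> \<gamma> d' J lam"
proof -
  obtain col where col: "colouring d col" "\<forall>j\<in>{1..layers d}. I j = tuple_of_colouring d col j \<and> card (I j) = length (zvars d j)"
    using adm by (auto simp: admissible_def)
  then have col2: "\<forall>j\<in>{1..layers d}. I j = tuple_of_colouring d col j" by blast
  obtain p2 where p2: "M = Suc (Suc p2)" using M by (metis Suc_le_D numeral_2_eq_2 Suc_le_mono)
  let ?p1 = "Suc p2"
  obtain tops where t: "colM d I = tops @ [i]" "length tops = n"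
    "tops = map (\<lambda>s. colour d I (offsetI d M + s)) [1..<Suc n]"
    using colM_snoc[OF L, of I] i unfolding M_def by metis
  have cnt0: "count (mset tops) (M + 1) + length (zvars d M) = Suc n"
    using count_colM_top[OF adm] M L t(1) i(2) by (simp add: M_def)
  \<comment> \<open>The last of the n + 1 top colours differs from M + 1, so at most n of them equal
    M + 1, which leaves k_M \<ge> 1.\<close>
  have "count (mset tops) (M + 1) \<le> n" using count_le_size[of "mset tops"] t(2) by simp
  with cnt0 show zne: "zvars d M \<noteq> []" by auto
  define zs where "zs = butlast (zvars d M)"
  have zs: "zvars d M = zs @ [z]" using zne by (simp add: zs_def z_def)
  have cnt: "count (mset tops) (M + 1) + length zs = n" using cnt0 zs by simp
  define ws where "ws = butlast (wMvars d)"
  have lws: "length ws = n" using L by (simp add: ws_def)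
  have ld: "layers d' = M" "length (wMvars d') = n" "wIvars d' = wIvars d" "wMvars d' = ws"
    "zvars d' M = zs" "\<And>p. p \<noteq> M \<Longrightarrow> zvars d' p = zvars d p"
    "wIIvars d' ?p1 = z # wIIvars d ?p1" "\<And>p. p \<noteq> ?p1 \<Longrightarrow> wIIvars d' p = wIIvars d p"
    using L p2 by (simp_all add: d'_def M_def zs_def ws_def)
  have sumII: "(\<Sum>q=j..<M. length (wIIvars d' q)) = Suc (\<Sum>q=j..<M. length (wIIvars d q))" if "j \<le> ?p1" for j
  proof -
    have "(\<Sum>q=j..<?p1. length (wIIvars d' q)) = (\<Sum>q=j..<?p1. length (wIIvars d q))"
      by (intro sum.cong) (auto simp: ld)
    then show ?thesis using that by (simp add: p2 ld(7))
  qed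
  \<comment> \<open>The second block of layer M - 1 used to begin just behind \<open>LI\<close>; it
    now begins at \<open>LI\<close>, and all blocks further out keep their places.\<close>
  have off: "offsetI d' = offsetI d" "\<And>p. p < ?p1 \<Longrightarrow> offsetII d' p = offsetII d p"
    "Suc (offsetII d' ?p1) = offsetII d ?p1" "offsetII d ?p1 = LI"
    using sumII L p2 lws by (auto simp: offsetI_def offsetII_def ld LI_def fun_eq_iff M_def[symmetric])
  have LIM: "LI \<in> layer_coords d M" "M \<in> {1..layers d}" using L M by (simp_all add: layer_coords_def coordsM_def LI_def M_def)
  have colLI: "col LI = i"
    using colour_tuple_of_colouring[OF col(1) col2 LIM(2,1)] i(1) by (simp add: LI_def)
  have iM: "i \<in> {1..M}"
    using col(1) LIM i(2) colLI by (fastforce simp: colouring_def M_def)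
  have Ih: "Ihat d' j = Ihat d j" if "j \<in> {1..?p1}" for j
    using Ihat_interval[of j d'] Ihat_interval[of j d] that sumII[of j] off(1) ld L p2 lws by (simp add: M_def[symmetric])
  have IhM: "Ihat d' M = Ihat d M - {LI}"
    using Ihat_top[of d'] Ihat_top[of d] ld L lws by (auto simp: M_def[symmetric] coordsM_def off(1) LI_def)
  \<comment> \<open>The relabelling is the identity.\<close>
  have smono: "strict_mono (\<lambda>c::nat. c)" by (simp add: strict_mono_def)
  have sub: "I j \<subseteq> Ihat d j" if "j \<in> {1..M}" for j
    using col2 that by (auto simp: tuple_of_colouring_def M_def)
  have Jeq: "J j = {c \<in> Ihat d' j. c \<in> I j}" if j: "j \<in> {1..layers d'}" for j
    using sub[of j] Ih[of j] IhM j ld(1) p2 by (cases "j = M") (auto simp: J_def)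
  have image: "(\<lambda>c. c) ` Ihat d' j \<subseteq> Ihat d j" if "j \<in> {1..layers d'}" for j
    using that Ih[of j] IhM ld(1) p2 by (cases "j = M") auto
  have le: "layers d' \<le> layers d" using ld by (simp add: M_def)
  note rl = col(1) col2 le smono image Jeq
  have lay: "col c \<in> {1..p + 1}" if p: "p \<in> {1..layers d'}" and c: "c \<in> layer_coords d' p" for p c
  proof (cases "c \<in> layer_coords d p")
    case True
    then show ?thesis using p col(1) ld(1) by (auto simp: colouring_def M_def)
  next
    case False
    consider "p < ?p1" | "p = ?p1" | "p = M" using p ld(1) p2 by force
    then show ?thesis
    proof cases
      case 1
      then have "layer_coords d' p = layer_coords d p"
        using p2 ld off by (simp add: layer_coords_def coordsI_def coordsII_def M_def[symmetric])
      then show ?thesis using False c by simp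
    next
      case 2
      then have "c = LI"
        using False c p2 ld off by (auto simp: layer_coords_def coordsI_def coordsII_def M_def[symmetric])
      then show ?thesis using colLI iM 2 p2 by simp
    next
      case 3
      then show ?thesis using False c p2 ld off L by (auto simp: layer_coords_def coordsM_def M_def[symmetric])
    qed
  qed
  have col': "colouring d' (col \<circ> (\<lambda>c. c))"
    using lay by (simp add: colouring_def)
  have card: "card (J j) = length (zvars d' j)" if j: "j \<in> {1..layers d'}" for j
  proof (cases "j = M")
    case True
    have "LI \<in> I M"
      using col2 LIM colLI iM Ihat_top[of d] by (auto simp: tuple_of_colouring_def M_def layer_coords_def)
    moreover have "finite (I M)" using sub[of M] M finite_subset finite_Ihat by fastforce
    moreover have "card (I M) = length (zvars d M)" using col(2) LIM(2) unfolding M_def by blast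
    ultimately show ?thesis using True ld(5) zs by (simp add: J_def)
  next
    case False
    moreover have "card (I j) = length (zvars d j)" using col(2) j unfolding ld(1) M_def by blast
    ultimately show ?thesis using ld(6) by (simp add: J_def)
  qed
  show admJ: "admissible d' J"
    by (rule relabel_admissible[OF rl col' card])
  show "Itilde d' J j = Itilde d I j" if j: "j \<in> {1..M - 1}" for j
    by (rule relabel_Itilde[OF rl col']) (use j ld Ih[of j] p2 in auto)
  have cd: "colour d I c = col c" if "p \<in> {1..M}" "c \<in> layer_coords d p" for p c
    using colour_tuple_of_colouring[OF col(1) col2] that by (simp add: M_def)
  have cd': "colour d' J c = col c" if "p \<in> {1..M}" "c \<in> layer_coords d' p" for p c
    using relabel_colour[OF rl col'] that ld(1) by simp
  have cI: "colI d' J p = colI d I p" if p: "p \<in> {1..<M}" for p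
    by (rule relabel_col_words(1)[OF rl col']) (use p ld off in auto)
  have cII: "colII d' J p = colII d I p" if p: "p \<in> {1..<?p1}" for p
    by (rule relabel_col_words(2)[OF rl col']) (use p ld off p2 in auto)
  have cII1: "colII d' J ?p1 = i # colII d I ?p1"
  proof (rule nth_equalityI)
    fix r assume r: "r < length (colII d' J ?p1)"
    show "colII d' J ?p1 ! r = (i # colII d I ?p1) ! r"
    proof (cases r)
      case 0
      have "LI \<in> layer_coords d' ?p1"
        using p2 ld off by (auto simp: layer_coords_def coordsII_def)
      then show ?thesis using 0 cd'[of ?p1 LI] p2 off colLI ld by (simp add: colII_def del: upt_Suc)
    next
      case (Suc r')
      then have r': "r' < length (wIIvars d ?p1)" using r ld by simp
      have "offsetII d ?p1 + Suc r' \<in> layer_coords d' ?p1" "offsetII d ?p1 + Suc r' \<in> layer_coords d ?p1"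
        using p2 ld off(3) r' by (auto simp: layer_coords_def coordsII_def M_def[symmetric])
      then have "colour d' J (offsetII d ?p1 + Suc r') = colour d I (offsetII d ?p1 + Suc r')"
        using cd[of ?p1] cd'[of ?p1] p2 by simp
      moreover have "offsetII d' ?p1 + Suc (Suc r') = offsetII d ?p1 + Suc r'" using off(3) by simp
      ultimately have "colour d' J (offsetII d' ?p1 + Suc (Suc r')) = colour d I (offsetII d ?p1 + Suc r')"
        by (simp only:)
      then show ?thesis using Suc r' ld by (simp add: colII_def del: upt_Suc)
    qed
  qed (simp add: ld)
  have cM: "colM d' J = tops"
  proof -
    have "colour d' J (offsetI d M + s) = colour d I (offsetI d M + s)" if s: "s \<in> {1..n}" for s
    proof -
      have c: "offsetI d M + s \<in> layer_coords d' M" "offsetI d M + s \<in> layer_coords d M"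
        using s ld L by (simp_all add: layer_coords_def coordsM_def off(1) M_def)
      then show ?thesis using cd[of M] cd'[of M] M by simp
    qed
    then show ?thesis unfolding t(3) using ld lws by (auto simp: colM_def off(1) M_def simp del: upt_Suc)
  qed
  have shl: "shifted_lam \<gamma> d' J lam q = shifted_lam \<gamma> d I lam q" if "q \<in> {1..M}" for q
    by (rule shifted_lam_cong[where m = M])
      (use that cI ld shifted_lam_top[of \<gamma> d' J lam] shifted_lam_top[of \<gamma> d I lam] in \<open>auto simp: M_def\<close>)
  have ls2: "layers_sum d' J lam p2 Y = layers_sum d I lam p2 Y" for Y
  proof (rule layers_sum_cong)
    fix q assume q: "q \<in> {1..p2}"
    then show "zvars d' q = zvars d q" by (simp add: ld p2)
    show "column_vars d' q = column_vars d q" using q p2 ld by (auto simp: column_vars_def M_def[symmetric])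
    show "top_word d' J q X = top_word d I q X" for X
      using q cI[of q] cII[of q] ld p2 by (auto simp: top_word_def M_def[symmetric])
    show "shifted_lam \<gamma> d' J lam q = shifted_lam \<gamma> d I lam q" using q p2 by (intro shl) auto
  qed (use ld p2 in \<open>auto simp: M_def\<close>)
  \<comment> \<open>The list of columns of layer M - 1 does not change: z is only transferred from
    the end of its z-part to the beginning of its second w-part. Its colour i ceases to be summed
    over.\<close>
  have kern: "layer_kernel d' J lam ?p1 Z Y = layer_kernel d I lam ?p1 Z (Y @ [i])" for Z Y
  proof -
    have "column_vars d' ?p1 = column_vars d ?p1" using p2 ld zs by (simp add: column_vars_def M_def[symmetric])
    moreover have "top_word d' J ?p1 Y = top_word d I ?p1 (Y @ [i])"
      using cI[of ?p1] cII1 ld p2 by (simp add: top_word_def M_def[symmetric])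
    moreover have "zvars d' ?p1 = zvars d ?p1" using p2 ld(6) by simp
    ultimately show ?thesis
      using shl[of ?p1] p2 ld(1) by (simp add: layer_kernel_def ncols_def nrows_def M_def[symmetric])
  qed
  have ls: "layers_sum d' J lam (M - 1) Y = layers_sum d I lam (M - 1) (Y @ [i])" for Y
  proof -
    have "layers_sum d'' J' lam ?p1 X = (\<Sum>Z\<in>words (layers d'') (length (zvars d'' ?p1)). layers_sum d'' J' lam p2 Z * layer_kernel d'' J' lam ?p1 Z X)" for d'' J' X
      by (simp add: layers_sum_def)
    moreover have "zvars d' ?p1 = zvars d ?p1" "layers d' = layers d" using p2 ld by (simp_all add: M_def)
    ultimately show ?thesis using p2 by (simp add: ls2 kern)
  qed
  have upd: "(wMvars d)[n := x] = ws @ [x]" for x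
    using L unfolding ws_def by (metis append_butlast_last_id length_0_conv length_append_singleton list_update_length nat.inject nat.distinct(1))
  have iw: "i \<in> colours M" using iM by (auto simp: colours_def)
  have tw: "tops \<in> words M (length ws)"
    using colI_colII_colM_words(3)[OF adm, of M] M t lws by (auto simp: M_def words_def)
  have c: "count (mset (colM d I)) i = Suc (count (mset tops) i)" by (simp add: t)
  let ?K = "(\<Prod>w\<leftarrow>ws. theta \<tau> (z - w)) * (\<Prod>z'\<leftarrow>zs. theta \<tau> (z' - z + \<gamma>)) *
        (theta \<tau> \<gamma> * theta \<tau> (lam (M + 1) - lam i + \<gamma> * (of_nat (length zs) - of_nat (length ws) + of_nat (Suc (count (mset tops) i))))
          / theta \<tau> (lam i - lam (M + 1) + \<gamma> * (1 - of_nat (Suc (count (mset tops) i)))))"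
  let ?G = "\<lambda>Y. grid M zs ws lam Y (replicate (length ws) (M + 1)) (replicate (length zs) (M + 1)) tops"
  have "psi \<tau> \<gamma> (d\<lparr>wMvars := (wMvars d)[n := z - \<gamma>]\<rparr>) I lam = (\<Sum>Y\<in>words M (length zs + 1).
     layers_sum d I lam (M - 1) Y * grid M (zs @ [z]) (ws @ [z - \<gamma>]) lam Y
       (replicate (Suc (length ws)) (M + 1)) (replicate (Suc (length zs)) (M + 1)) (tops @ [i]))"
    using psi_update_wM[OF adm, of "(wMvars d)[n := z - \<gamma>]" lam] M L zs unfolding t(1) upd M_def[symmetric] by (simp add: lws)
  also have "\<dots> = (\<Sum>Y\<in>words M (length zs). \<Sum>y\<in>colours M.
     layers_sum d I lam (M - 1) (Y @ [y]) * grid M (zs @ [z]) (ws @ [z - \<gamma>]) lam (Y @ [y])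
       (replicate (Suc (length ws)) (M + 1)) (replicate (Suc (length zs)) (M + 1)) (tops @ [i]))"
    unfolding sum_words_append by (simp only: One_nat_def sum_words_Suc words_0) simp
  also have "\<dots> = (\<Sum>Y\<in>words M (length zs). \<Sum>y\<in>colours M.
     (layers_sum d I lam (M - 1) (Y @ [y]) * (?K * ?G Y)) * (if y = i then 1 else 0))"
  proof (intro sum.cong refl)
    fix Y y assume Y: "Y \<in> words M (length zs)" and y: "y \<in> colours M"
    have cnt': "count (mset tops) (M + 1) + length zs = length ws" using cnt lws by simp
    show "layers_sum d I lam (M - 1) (Y @ [y]) * grid M (zs @ [z]) (ws @ [z - \<gamma>]) lam (Y @ [y])
       (replicate (Suc (length ws)) (M + 1)) (replicate (Suc (length zs)) (M + 1)) (tops @ [i])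
      = (layers_sum d I lam (M - 1) (Y @ [y]) * (?K * ?G Y)) * (if y = i then 1 else 0)"
      unfolding grid_corner_frozen[OF gen iw i(2) Y y tw cnt'] by simp
  qed
  also have "\<dots> = (\<Sum>Y\<in>words M (length zs). ?K * (layers_sum d' J lam (M - 1) Y * ?G Y))"
    using iw by (simp only: sum_mult_delta finite_colours if_True ls mult.left_commute)
  also have "\<dots> = ?K * psi \<tau> \<gamma> d' J lam"
    using psi_layers[OF admJ, of lam] M ld(1,2,4,5) lws cM by (simp add: sum_distrib_left)
  finally show "psi \<tau> \<gamma> (d\<lparr>wMvars := (wMvars d)[n := z - \<gamma>]\<rparr>) I lam =
      (\<Prod>w\<leftarrow>butlast (wMvars d). theta \<tau> (z - w)) * (\<Prod>z'\<leftarrow>butlast (zvars d M). theta \<tau> (z' - z + \<gamma>)) *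
        (theta \<tau> \<gamma> * theta \<tau> (lam (M + 1) - lam i + \<gamma> * (of_nat (length (zvars d M) - 1) - of_nat n + of_nat (count (mset (colM d I)) i)))
          / theta \<tau> (lam i - lam (M + 1) + \<gamma> * (1 - of_nat (count (mset (colM d I)) i)))) * psi \<tau> \<gamma> d' J lam"
    unfolding c zs_def[symmetric] ws_def[symmetric] using lws zs by simp
qed

lemma count_eq_length_imp_replicate:
  "count (mset xs) a = length xs \<Longrightarrow> xs = replicate (length xs) a"
proof (induction xs)
  case (Cons x xs)
  then show ?case using count_le_size[of "mset xs" a] by (auto split: if_splits)
qed simp

text \<open>With k_M = 1 the single row is frozen and its line goes down as a column of layer M - 1
  with colour i. That layer becomes the top layer of a model with one colour less. Its corner
  parameter, formerly \<lambda>^[M-1], becomes the dynamical variable.\<close>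

lemma (in vertex_model) psi_initial:
  fixes d
  defines "M \<equiv> layers d"
  assumes adm: "admissible d I" and M: "M \<ge> 2" and gen: "generic \<tau> \<gamma> M lam"
    and L: "length (wMvars d) = Suc n" and k: "zvars d M = [z]"
    and i: "i = colour d I (offsetI d M + Suc n)" "i \<noteq> M + 1"
  defines "LI \<equiv> offsetI d M + Suc n"
  defines "d' \<equiv> d\<lparr>layers := M - 1, wMvars := wIvars d (M - 1) @ [z] @ wIIvars d (M - 1)\<rparr>"
    and "J \<equiv> (\<lambda>i. {j \<in> I i. j < LI} \<union> {j - Suc n + 1 | j. j \<in> I i \<and> j \<ge> LI})"
  shows "admissible d' J" "\<And>j. j \<in> {1..M - 1} \<Longrightarrow> Itilde d' J j = Itilde d I j"
    and "(\<lambda>j. j - offsetI d (M - 1)) ` J (M - 1) = Itilde d I (M - 1)"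
    and "psi \<tau> \<gamma> d I lam = theta \<tau> \<gamma> * theta \<tau> (z - last (wMvars d) + lam (M + 1) - lam i - \<gamma> * of_nat n) / theta \<tau> (lam i - lam (M + 1)) *
       (\<Prod>w\<leftarrow>butlast (wMvars d). theta \<tau> (z - w)) * psi \<tau> \<gamma> d' J (shifted_lam \<gamma> d I lam (M - 1))"
proof -
  obtain col where col: "colouring d col" "\<forall>j\<in>{1..layers d}. I j = tuple_of_colouring d col j \<and> card (I j) = length (zvars d j)"
    using adm by (auto simp: admissible_def)
  then have col2: "\<forall>j\<in>{1..layers d}. I j = tuple_of_colouring d col j" by blast
  obtain p2 where p2: "M = Suc (Suc p2)" using M by (metis Suc_le_D numeral_2_eq_2 Suc_le_mono)
  let ?p1 = "Suc p2"
  define lam' where "lam' = shifted_lam \<gamma> d I lam ?p1"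
  define o1 where "o1 = offsetI d M"
  \<comment> \<open>The n coordinates of layer M before \<open>LI\<close> disappear:
    \<open>LI\<close> itself is the image of o1 + 1, and everything behind it is moved by n.\<close>
  define \<phi> where "\<phi> c = (if c \<le> o1 then c else c + n)" for c
  have LI: "LI = o1 + Suc n" by (simp add: LI_def o1_def)
  have ld: "layers d' = ?p1" "zvars d' = zvars d" "wIvars d' = wIvars d" "wIIvars d' = wIIvars d"
    "wMvars d' = wIvars d ?p1 @ [z] @ wIIvars d ?p1"
    using p2 by (simp_all add: d'_def)
  have o1: "o1 = offsetI d ?p1 + length (wIvars d ?p1)"
    using offsetI_Suc[of ?p1 d] p2 by (simp add: o1_def)
  have off: "offsetI d' = offsetI d" "\<And>p. p \<le> ?p1 \<Longrightarrow> offsetII d p = offsetI d' ?p1 + length (wMvars d') + (\<Sum>q=p+1..<M. length (wIIvars d q)) - length (wIIvars d ?p1) + n"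
    "\<And>p. p < ?p1 \<Longrightarrow> offsetII d p = offsetII d' p + n" "offsetII d ?p1 = LI" "\<And>p. p < ?p1 \<Longrightarrow> offsetII d' p > o1"
    using L p2 o1 by (auto simp: offsetI_def[abs_def] offsetII_def ld LI M_def[symmetric] o1_def[symmetric])
  have smono: "strict_mono \<phi>" by (auto simp: strict_mono_def \<phi>_def)
  have LIM: "LI \<in> layer_coords d M" "M \<in> {1..layers d}" using L M by (simp_all add: layer_coords_def coordsM_def LI_def M_def)
  have colLI: "col LI = i"
    using colour_tuple_of_colouring[OF col(1) col2 LIM(2,1)] i(1) by (simp add: LI_def)
  have iM: "i \<in> {1..M}"
    using col(1) LIM i(2) colLI by (fastforce simp: colouring_def M_def)
  obtain tops where t: "colM d I = tops @ [i]" "length tops = n"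
    "tops = map (\<lambda>s. colour d I (offsetI d M + s)) [1..<Suc n]"
    using colM_snoc[OF L, of I] i unfolding M_def by metis
  have "count (mset tops) (M + 1) + length (zvars d M) = Suc n"
    using count_colM_top[OF adm] M L t(1) i(2) by (simp add: M_def)
  \<comment> \<open>Since k_M = 1 and the last top colour is not M + 1, counting forces all the
    others to be M + 1; the deleted coordinates are therefore invisible to the tuple.\<close>
  then have tops: "tops = replicate n (M + 1)"
    using count_eq_length_imp_replicate[of tops "M + 1"] t(2) k by simp
  have cd: "colour d I c = col c" if "p \<in> {1..M}" "c \<in> layer_coords d p" for p c
    using colour_tuple_of_colouring[OF col(1) col2] that by (simp add: M_def)
  have removed: "col c = M + 1" if c: "o1 < c" "c < LI" for c
  proof -
    have "c \<in> layer_coords d M" using c L by (simp add: layer_coords_def coordsM_def M_def LI o1_def)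
    then have "col c = colour d I c" using cd[of M c] M by simp
    also have "\<dots> = tops ! (c - Suc o1)"
    proof -
      have "[1..<Suc n] ! (c - Suc o1) = c - o1" using c by (subst nth_upt) (auto simp: LI)
      then show ?thesis using c unfolding t(3)
        by (subst nth_map) (auto simp: LI o1_def[symmetric] simp del: upt_Suc)
    qed
    finally show ?thesis using c by (simp add: tops LI)
  qed
  have offM: "offsetI d j \<le> o1" if "j \<le> M" for j unfolding o1_def using that by (rule offsetI_mono)
  have Ih: "Ihat d j = {o1<..<LI} \<union> \<phi> ` Ihat d' j" if j: "j \<in> {1..?p1}" for j
  proof -
    define U where "U = Suc o1 + (\<Sum>q=j..<M. length (wIIvars d q))"
    have "(\<Sum>q=j..<M. length (wIIvars d q)) = (\<Sum>q=j..<?p1. length (wIIvars d q)) + length (wIIvars d ?p1)"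
      using j p2 by simp
    then have 1: "Ihat d j = {offsetI d j <.. U + n}" "Ihat d' j = {offsetI d j <.. U}"
      using Ihat_interval[of j d] Ihat_interval[of j d'] j off(1) ld L p2 o1 by (simp_all add: U_def M_def[symmetric] o1_def[symmetric] offsetI_Suc add_ac)
    have 2: "offsetI d j \<le> o1" "o1 < U" using offM[of j] j p2 by (auto simp: U_def)
    have A: "x \<in> \<phi> ` {offsetI d j <.. U}" if "x \<in> {offsetI d j <.. U + n}" "x \<notin> {o1<..<LI}" for x
      using that 2 by (intro image_eqI[of _ _ "if x \<le> o1 then x else x - n"]) (auto simp: \<phi>_def LI)
    have B: "\<phi> ` {offsetI d j <.. U} \<subseteq> {offsetI d j <.. U + n}" by (auto simp: \<phi>_def)
    have "{o1<..<LI} \<subseteq> {offsetI d j <.. U + n}" using 2 by (auto simp: LI)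
    then show ?thesis unfolding 1 using A B by blast
  qed
  have sub: "I j \<subseteq> Ihat d j" if "j \<in> {1..M}" for j
    using col2 that by (auto simp: tuple_of_colouring_def M_def)
  have notin: "c \<notin> I j" if "j \<in> {1..?p1}" "c \<in> {o1<..<LI}" for j c
    using col2 that removed[of c] p2 by (auto simp: tuple_of_colouring_def M_def[symmetric])
  have Jeq: "J j = {c \<in> Ihat d' j. \<phi> c \<in> I j}" if j: "j \<in> {1..layers d'}" for j
  proof -
    have j': "j \<in> {1..?p1}" "j \<in> {1..M}" using j ld(1) p2 by auto
    have pre: "{c. \<phi> c \<in> I j} = J j"
    proof (intro equalityI subsetI)
      fix c assume c: "c \<in> {c. \<phi> c \<in> I j}"
      show "c \<in> J j"
      proof (cases "c \<le> o1")
        case True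
        then show ?thesis using c by (simp add: J_def \<phi>_def LI)
      next
        case False
        then have "c = (c + n) - Suc n + 1" "c + n \<in> I j" "c + n \<ge> LI" using c by (auto simp: \<phi>_def LI)
        then show ?thesis unfolding J_def by blast
      qed
    next
      fix c assume "c \<in> J j"
      then consider "c \<in> I j" "c < LI" | b where "c = b - Suc n + 1" "b \<in> I j" "b \<ge> LI" unfolding J_def by blast
      then show "c \<in> {c. \<phi> c \<in> I j}"
      proof cases
        case 1
        then have "c \<le> o1" using notin[OF j'(1), of c] by fastforce
        then show ?thesis using 1 by (simp add: \<phi>_def)
      next
        case 2
        then have "\<phi> c = b" by (auto simp: \<phi>_def LI)
        then show ?thesis using 2 by simp
      qed
    qed
    have "c \<in> Ihat d' j" if "\<phi> c \<in> I j" for c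
      using sub[OF j'(2)] Ih[OF j'(1)] notin[OF j'(1)] that smono by (auto simp: strict_mono_eq)
    then show ?thesis using pre by auto
  qed
  have image: "\<phi> ` Ihat d' j \<subseteq> Ihat d j" if "j \<in> {1..layers d'}" for j using Ih[of j] that ld by auto
  have le: "layers d' \<le> layers d" using ld p2 by (simp add: M_def)
  note rl = col(1) col2 le smono image Jeq
  have lay: "col (\<phi> c) \<in> {1..p + 1}" if p: "p \<in> {1..layers d'}" and c: "c \<in> layer_coords d' p" for p c
  proof (cases "p < ?p1")
    case True
    then have "offsetI d p + length (wIvars d p) \<le> offsetI d ?p1" using offsetI_less[of p ?p1 d] p by auto
    then have "\<phi> c \<in> layer_coords d p"
      using c True off(1) off(3)[OF True] off(5)[OF True] ld p2 o1
      by (auto simp: layer_coords_def M_def[symmetric] coordsI_def coordsII_def \<phi>_def split: if_splits)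
    then show ?thesis using p col(1) ld(1) p2 by (auto simp: colouring_def M_def[symmetric])
  next
    case False
    then have p: "p = ?p1" using p ld by simp
    have "\<phi> c = LI \<or> \<phi> c \<in> layer_coords d ?p1"
      using c p off(1,4) ld p2 o1
      by (auto simp: layer_coords_def M_def[symmetric] coordsI_def coordsII_def coordsM_def \<phi>_def LI)
    then show ?thesis using p colLI iM col(1) p2 by (fastforce simp: colouring_def M_def[symmetric])
  qed
  have col': "colouring d' (col \<circ> \<phi>)"
    unfolding colouring_def using lay by simp
  have away: "col c = M + 1" if "c \<in> Ihat d j - \<phi> ` Ihat d' j" "j \<in> {1..layers d'}" for c j
    using Ih[of j] that removed[of c] ld by auto
  have card: "card (J j) = length (zvars d' j)" if j: "j \<in> {1..layers d'}" for j
  proof -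
    have "card (J j) = card (I j)"
      by (rule relabel_card[OF rl j]) (use away j ld p2 in fastforce)+
    moreover have "j \<in> {1..layers d}" using j le by auto
    then have "card (I j) = length (zvars d j)" using col(2) by blast
    ultimately show ?thesis using ld by simp
  qed
  show admJ: "admissible d' J"
    by (rule relabel_admissible[OF rl col' card])
  show It: "Itilde d' J j = Itilde d I j" if j: "j \<in> {1..M - 1}" for j
    by (rule relabel_Itilde[OF rl col']) (use j ld away[of _ j] p2 in auto)
  have cd': "colour d' J c = col (\<phi> c)" if "p \<in> {1..?p1}" "c \<in> layer_coords d' p" for p c
    using relabel_colour[OF rl col'] that ld(1) by simp
  have IhJ: "Ihat d' ?p1 = {offsetI d ?p1<..offsetI d ?p1 + length (wMvars d')}"
    using Ihat_interval[of ?p1 d'] ld off(1) by simp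
  show "(\<lambda>j. j - offsetI d (M - 1)) ` J (M - 1) = Itilde d I (M - 1)"
  proof -
    \<comment> \<open>In the new top layer every colour is at most (M - 1) + 1, so the rank of a
      coordinate is just its position in the block.\<close>
    have "card {c' \<in> Ihat d' ?p1. colour d' J c' \<in> {1..?p1 + 1} \<and> c' \<le> c} = c - offsetI d ?p1" if "c \<in> J ?p1" for c
    proof -
      have c: "c \<in> Ihat d' ?p1" using Jeq[of ?p1] that ld by auto
      have "colour d' J c' \<in> {1..?p1 + 1}" if "c' \<in> Ihat d' ?p1" for c'
        using colour_bounds[OF admJ, of ?p1 c'] that ld by (auto simp: Ihat_def)
      then have "{c' \<in> Ihat d' ?p1. colour d' J c' \<in> {1..?p1 + 1} \<and> c' \<le> c} = {offsetI d ?p1<..c}"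
        using c unfolding IhJ by auto
      then show ?thesis by simp
    qed
    then have "Itilde d' J ?p1 = (\<lambda>j. j - offsetI d ?p1) ` J ?p1" by (simp add: Itilde_def)
    then show ?thesis using It[of ?p1] p2 by simp
  qed
  have cI: "colI d' J p = colI d I p" if p: "p \<in> {1..<?p1}" for p
  proof (rule relabel_col_words(1)[OF rl col'])
    have "offsetI d p + length (wIvars d p) \<le> offsetI d ?p1" using offsetI_less[of p ?p1 d] p by auto
    then show "\<phi> (offsetI d' p + s) = offsetI d p + s" if "s \<in> {1..length (wIvars d' p)}" for s
      using that o1 by (auto simp: off(1) ld \<phi>_def)
  qed (use p ld in auto)
  have cII: "colII d' J p = colII d I p" if p: "p \<in> {1..<?p1}" for p
  proof (rule relabel_col_words(2)[OF rl col'])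
    show "\<phi> (offsetII d' p + s) = offsetII d p + s" if "s \<in> {1..length (wIIvars d' p)}" for s
      using off(3)[of p] off(5)[of p] p by (auto simp: \<phi>_def)
  qed (use p ld in auto)
  have cM: "colM d' J = colI d I ?p1 @ [i] @ colII d I ?p1"
  proof -
    let ?a = "length (wIvars d ?p1)" and ?b = "length (wIIvars d ?p1)"
    have c: "colour d' J (offsetI d ?p1 + s) = col (\<phi> (offsetI d ?p1 + s))" if "s \<in> {1..?a + 1 + ?b}" for s
      using cd'[of ?p1 "offsetI d ?p1 + s"] that ld off(1) by (simp add: layer_coords_def coordsM_def)
    have 1: "colour d' J (offsetI d ?p1 + s) = colour d I (offsetI d ?p1 + s)" if s: "s \<in> {1..?a}" for s
    proof -
      have "offsetI d ?p1 + s \<in> layer_coords d ?p1" using s p2 by (simp add: layer_coords_def coordsI_def M_def[symmetric])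
      then show ?thesis using c[of s] cd[of ?p1] s p2 o1 by (simp add: \<phi>_def)
    qed
    have 2: "colour d' J (offsetI d ?p1 + (?a + 1)) = i"
      using c[of "?a + 1"] o1 colLI by (simp add: \<phi>_def LI)
    have 3: "colour d' J (offsetI d ?p1 + (?a + 1 + s)) = colour d I (offsetII d ?p1 + s)" if s: "s \<in> {1..?b}" for s
    proof -
      have "offsetII d ?p1 + s \<in> layer_coords d ?p1" using s p2 by (simp add: layer_coords_def coordsII_def M_def[symmetric])
      then have "colour d I (offsetII d ?p1 + s) = col (offsetII d ?p1 + s)" using cd[of ?p1] p2 by simp
      moreover have "\<phi> (offsetI d ?p1 + (?a + 1 + s)) = offsetII d ?p1 + s" using o1 off(4) by (simp add: \<phi>_def LI)
      ultimately show ?thesis using c[of "?a + 1 + s"] s by simp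
    qed
    have "colM d' J = map (\<lambda>s. colour d' J (offsetI d ?p1 + s)) [1..<Suc (?a + 1 + ?b)]"
      by (simp add: colM_def ld off(1) del: upt_Suc)
    also have "\<dots> = map (\<lambda>s. colour d' J (offsetI d ?p1 + s)) [1..<Suc ?a] @ [colour d' J (offsetI d ?p1 + (?a + 1))]
        @ map (\<lambda>s. colour d' J (offsetI d ?p1 + (?a + 1 + s))) [1..<Suc ?b]"
      unfolding upt_split3 map_append map_map o_def by simp
    also have "\<dots> = colI d I ?p1 @ [i] @ colII d I ?p1"
      unfolding 2 colI_def colII_def using 1 3 by (auto simp del: upt_Suc)
    finally show ?thesis .
  qed
  have shl: "shifted_lam \<gamma> d' J lam' q = shifted_lam \<gamma> d I lam q" if "q \<in> {1..?p1}" for q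
  proof (rule shifted_lam_cong[where m = ?p1])
    show "shifted_lam \<gamma> d' J lam' ?p1 = shifted_lam \<gamma> d I lam ?p1"
      using shifted_lam_top[of \<gamma> d' J lam'] ld by (simp add: lam'_def)
  qed (use that cI ld p2 in \<open>auto simp: M_def\<close>)
  have kern: "layer_kernel d I lam q Y X = layer_kernel d' J lam' q Y X"
    if q: "q \<in> {1..p2}" and Y: "Y \<in> words ?p1 (length (zvars d q))" for q Y X
  proof -
    have cv: "column_vars d' q = column_vars d q" using q p2 ld by (simp add: column_vars_def M_def[symmetric])
    have tw: "top_word d' J q X = top_word d I q X"
      using q cI[of q] cII[of q] ld p2 by (simp add: top_word_def M_def[symmetric])
    have "replicate (ncols d q) (q + 1) \<in> words ?p1 (length (column_vars d q))"
      using q by (auto simp: words_def colours_def ncols_def)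
    then have "layer_kernel d I lam q Y X = grid ?p1 (zvars d q) (column_vars d q) (shifted_lam \<gamma> d I lam q) Y
       (replicate (ncols d q) (q + 1)) (replicate (nrows d q) (q + 1)) (top_word d I q X)"
      unfolding layer_kernel_def using Y p2 by (intro grid_fewer_colours) (auto simp: M_def[symmetric] nrows_def)
    then show ?thesis using shl[of q] q by (simp add: layer_kernel_def ld cv tw ncols_def nrows_def)
  qed
  have ls: "layers_sum d I lam p X = layers_sum d' J lam' p X" if "p \<le> p2" for p X
    using that
  proof (induction p arbitrary: X)
    case 0
    then show ?case by (simp add: layers_sum_def ld)
  next
    case (Suc p)
    let ?W = "\<lambda>N. words N (length (zvars d (Suc p)))"
    \<comment> \<open>The word above layer p has colours up to p + 1 only, so words containing the
      surplus colour M + 1 drop out.\<close>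
    have zero: "layers_sum d I lam p Y = 0" if "Y \<in> ?W M - ?W ?p1" for Y
    proof (rule ccontr)
      assume "layers_sum d I lam p Y \<noteq> 0"
      then have "set Y \<subseteq> colours p"
        using Suc.prems p2 that by (intro layers_sum_support[OF adm]) (auto simp: M_def[symmetric] words_def)
      then show False using that colours_mono[of p ?p1] Suc.prems by (auto simp: words_def)
    qed
    have "layers_sum d I lam (Suc p) X = (\<Sum>Y\<in>?W M. layers_sum d I lam p Y * layer_kernel d I lam (Suc p) Y X)"
      by (simp add: layers_sum_def M_def)
    also have "\<dots> = (\<Sum>Y\<in>?W ?p1. layers_sum d I lam p Y * layer_kernel d I lam (Suc p) Y X)"
      using words_mono[of ?p1 M] zero p2 by (intro sum.mono_neutral_right) auto
    also have "\<dots> = (\<Sum>Y\<in>?W ?p1. layers_sum d' J lam' p Y * layer_kernel d' J lam' (Suc p) Y X)"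
      using Suc kern[of "Suc p"] by (intro sum.cong refl) simp
    also have "\<dots> = layers_sum d' J lam' (Suc p) X"
      by (simp add: layers_sum_def ld)
    finally show ?case .
  qed
  have main: "layers_sum d I lam ?p1 [i] = psi \<tau> \<gamma> d' J lam'"
  proof -
    let ?W = "\<lambda>N. words N (length (zvars d ?p1))"
    have zero: "layers_sum d I lam p2 Y = 0" if "Y \<in> ?W M - ?W ?p1" for Y
    proof (rule ccontr)
      assume "layers_sum d I lam p2 Y \<noteq> 0"
      then have "set Y \<subseteq> colours p2"
        using p2 that by (intro layers_sum_support[OF adm]) (auto simp: M_def[symmetric] words_def)
      then show False using that colours_mono[of p2 ?p1] by (auto simp: words_def)
    qed
    have kern1: "layer_kernel d I lam ?p1 Y [i] = grid ?p1 (zvars d ?p1) (wMvars d') lam' Y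
        (replicate (length (wMvars d')) (?p1 + 1)) (replicate (length (zvars d ?p1)) (?p1 + 1)) (colM d' J)"
      if Y: "Y \<in> ?W ?p1" for Y
    proof -
      have cv: "column_vars d ?p1 = wMvars d'" using p2 ld k by (simp add: column_vars_def M_def[symmetric])
      have tw: "top_word d I ?p1 [i] = colM d' J" using p2 cM by (simp add: top_word_def M_def[symmetric])
      show ?thesis
        unfolding layer_kernel_def tw ncols_def cv nrows_def lam'_def M_def[symmetric]
        using Y p2 by (intro grid_fewer_colours) (auto simp: words_def colours_def)
    qed
    have "layers_sum d I lam ?p1 [i] = (\<Sum>Y\<in>?W M. layers_sum d I lam p2 Y * layer_kernel d I lam ?p1 Y [i])"
      by (simp add: layers_sum_def M_def)
    also have "\<dots> = (\<Sum>Y\<in>?W ?p1. layers_sum d I lam p2 Y * layer_kernel d I lam ?p1 Y [i])"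
      using words_mono[of ?p1 M] zero p2 by (intro sum.mono_neutral_right) auto
    also have "\<dots> = (\<Sum>Y\<in>?W ?p1. layers_sum d' J lam' p2 Y * grid ?p1 (zvars d ?p1) (wMvars d') lam' Y
        (replicate (length (wMvars d')) (?p1 + 1)) (replicate (length (zvars d ?p1)) (?p1 + 1)) (colM d' J))"
      by (intro sum.cong refl) (simp only: kern1 ls[OF order_refl])
    also have "\<dots> = psi \<tau> \<gamma> d' J lam'"
      using psi_layers[OF admJ, of lam'] ld(1,2) by simp
    finally show ?thesis .
  qed
  define ws where "ws = butlast (wMvars d)"
  have ws: "wMvars d = ws @ [last (wMvars d)]" "length ws = n"
    using L by (auto simp: ws_def intro!: append_butlast_last_id[symmetric])
  have iw: "i \<in> colours M" using iM by (auto simp: colours_def)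
  let ?K = "theta \<tau> \<gamma> * theta \<tau> (z - last (wMvars d) + lam (M + 1) - lam i - \<gamma> * of_nat n) / theta \<tau> (lam i - lam (M + 1)) * (\<Prod>w\<leftarrow>ws. theta \<tau> (z - w))"
  have "psi \<tau> \<gamma> d I lam = (\<Sum>y\<in>colours M. layers_sum d I lam ?p1 [y] *
      grid M [z] (ws @ [last (wMvars d)]) lam [y] (replicate (Suc (length ws)) (M + 1)) [M + 1] (replicate (length ws) (M + 1) @ [i]))"
    using psi_layers[OF adm, of lam] p2 L k ws unfolding t(1) M_def[symmetric] tops
    by (simp add: sum_words_Suc del: grid.simps)
  also have "\<dots> = (\<Sum>y\<in>colours M. (layers_sum d I lam ?p1 [y] * ?K) * (if y = i then 1 else 0))"
    by (intro sum.cong refl) (subst row_initial[OF gen iw i(2)], simp_all add: ws(2))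
  also have "\<dots> = ?K * psi \<tau> \<gamma> d' J lam'"
    using iw by (simp only: sum_mult_delta finite_colours if_True main) (rule mult.commute)
  finally show "psi \<tau> \<gamma> d I lam = theta \<tau> \<gamma> * theta \<tau> (z - last (wMvars d) + lam (M + 1) - lam i - \<gamma> * of_nat n) / theta \<tau> (lam i - lam (M + 1)) *
       (\<Prod>w\<leftarrow>butlast (wMvars d). theta \<tau> (z - w)) * psi \<tau> \<gamma> d' J (shifted_lam \<gamma> d I lam (M - 1))"
    using p2 by (simp add: ws_def lam'_def)
qed

section \<open>Characters and assembly\<close>

lemma entry_length: "xs \<noteq> [] \<Longrightarrow> entry xs (length xs) = last xs"
  by (simp add: entry_def last_conv_nth)

lemma prod_entry_butlast:
  "(\<Prod>j=1..length xs - 1. f (entry xs j)) = (\<Prod>x\<leftarrow>butlast xs. f x)"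
proof -
  have "(\<Prod>j=1..length xs - 1. f (entry xs j)) = (\<Prod>j=1..length (butlast xs). f (entry (butlast xs) j))"
    by (intro prod.cong) (auto simp: entry_def nth_butlast)
  then show ?thesis by (simp only: prod_entry)
qed

text \<open>Since Im \<tau> > 0, the numbers 1 and \<tau> form a basis of the lattice and the values
  on them can be prescribed. The coordinates are recovered by floors, which are exact on lattice
  points and extend the character to all of the plane.\<close>

lemma lattice_character_exists:
  assumes "Im \<tau> > 0" "a \<noteq> 0" "b \<noteq> 0"
  obtains chi where "lattice_character \<tau> chi" "chi 1 = a" "chi \<tau> = b"
proof -
  define N where "N x = \<lfloor>Im x / Im \<tau>\<rfloor>" for x
  define K where "K x = \<lfloor>Re x - of_int (N x) * Re \<tau>\<rfloor>" for x
  define chi where "chi x = a powi K x * b powi N x" for x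
  have N: "N (of_int m + of_int n * \<tau>) = n" for m n using assms by (simp add: N_def)
  have K: "K (of_int m + of_int n * \<tau>) = m" for m n by (simp add: K_def N)
  have chi: "chi (of_int m + of_int n * \<tau>) = a powi m * b powi n" for m n
    by (simp add: chi_def N K)
  have "chi (x + y) = chi x * chi y" if xy: "x \<in> period_lattice \<tau>" "y \<in> period_lattice \<tau>" for x y
  proof -
    obtain m n m' n' :: int where "x = of_int m + of_int n * \<tau>" "y = of_int m' + of_int n' * \<tau>"
      using xy unfolding period_lattice_def by blast
    moreover from this have "x + y = of_int (m + m') + of_int (n + n') * \<tau>" by (simp add: algebra_simps)
    ultimately show ?thesis
      using assms chi[of "m + m'" "n + n'"] by (simp only: chi) (simp add: power_int_add)
  qed
  moreover have "chi x \<noteq> 0" for x using assms by (simp add: chi_def)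
  ultimately have "lattice_character \<tau> chi" by (simp add: lattice_character_def)
  moreover have "chi 1 = a" "chi \<tau> = b" using chi[of 1 0] chi[of 0 1] by simp_all
  ultimately show ?thesis using that by blast
qed

text \<open>The multiplier under \<tau> factors into the one prescribed for degree k and the
  constant exp(2 \<pi> \<i> S), which is absorbed into the value of the character at \<tau>.\<close>

lemma (in vertex_model) quasi_periodic_elliptic:
  assumes "quasi_periodic k S \<phi>"
  obtains chi where "lattice_character \<tau> chi" "chi 1 = (-1) ^ k"
    "chi \<tau> = (-1) ^ k * exp (2 * pi * \<i> * S)" "\<phi> \<in> elliptic_polynomials \<tau> k chi"
proof -
  obtain chi where chi: "lattice_character \<tau> chi" "chi 1 = (-1) ^ k"
    "chi \<tau> = (-1) ^ k * exp (2 * pi * \<i> * S)"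
    using lattice_character_exists[OF Im_tau, of "(-1) ^ k" "(-1) ^ k * exp (2 * pi * \<i> * S)"] by auto
  have "exp (- 2 * pi * \<i> * (of_nat k * x - S) - pi * \<i> * of_nat k * \<tau>) =
      exp (2 * pi * \<i> * S) * exp (- 2 * pi * \<i> * k * x - pi * \<i> * k * \<tau>)" for x
    unfolding exp_add[symmetric] by (simp add: algebra_simps)
  then have "\<phi> \<in> elliptic_polynomials \<tau> k chi"
    using assms by (simp add: elliptic_polynomials_def quasi_periodic_def chi mult.assoc)
  then show ?thesis using chi that by blast
qed

theorem proposition3p2:
  fixes \<tau> \<gamma> :: complex and d :: pf_data and I :: "nat \<Rightarrow> nat set" and lam :: "nat \<Rightarrow> complex"
  defines "M \<equiv> layers d"
    and "k \<equiv> length (zvars d (layers d))"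
    and "L \<equiv> length (wMvars d)"
    and "z \<equiv> entry (zvars d (layers d))"
    and "w \<equiv> entry (wMvars d)"
    and "LI \<equiv> (\<Sum>p=1..<layers d. length (wIvars d p)) + length (wMvars d)"
  defines "i\<^sub>s \<equiv> colour d I LI"
  defines "C \<equiv> colour_count d I M LI i\<^sub>s"
  assumes "\<tau> \<noteq> 0" and "\<gamma> \<noteq> 0" and "Im \<tau> > 0"
    and "M \<ge> 1" and "L \<ge> 1"
    and "admissible d I"
    and "generic \<tau> \<gamma> M lam"
  shows
    "(i\<^sub>s \<noteq> M + 1 \<longrightarrow>
       (\<exists>\<phi> chi. \<phi> = (\<lambda>x. psi \<tau> \<gamma> (d\<lparr>wMvars := (wMvars d)[L - 1 := x]\<rparr>) I lam) \<and>
          lattice_character \<tau> chi \<and>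
          chi 1 = (-1) ^ k \<and>
          chi \<tau> = (-1) ^ k * exp (- 2 * pi * \<i> *
             (- (\<Sum>j=1..k. z j) + lam i\<^sub>s - lam (M + 1) + \<gamma> * (of_nat L - of_nat C))) \<and>
          \<phi> \<in> elliptic_polynomials \<tau> k chi \<and>
          (\<forall>x. \<phi> (x + 1) = (-1) ^ k * \<phi> x) \<and>
          (\<forall>x. \<phi> (x + \<tau>) = (-1) ^ k * exp (- 2 * pi * \<i> *
             (of_nat k * x - (\<Sum>j=1..k. z j) + lam i\<^sub>s - lam (M + 1)
                + \<gamma> * (of_nat L - of_nat C)) - pi * \<i> * of_nat k * \<tau>) * \<phi> x)))
     \<and>
     (\<forall>zs. mset zs = mset (zvars d M) \<longrightarrow>
       psi \<tau> \<gamma> (d\<lparr>zvars := (zvars d)(M := zs)\<rparr>) I lam = psi \<tau> \<gamma> d I lam)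
     \<and>
     (M \<ge> 2 \<and> i\<^sub>s \<noteq> M + 1 \<longrightarrow>
       (\<exists>d' J.
          d' = d\<lparr>zvars := (zvars d)(M := butlast (zvars d M)),
                 wIIvars := (wIIvars d)(M - 1 := z k # wIIvars d (M - 1)),
                 wMvars := butlast (wMvars d)\<rparr> \<and>
          J = I(M := I M - {LI}) \<and>
          admissible d' J \<and>
          (\<forall>i\<in>{1..M-1}. Itilde d' J i = Itilde d I i) \<and>
          psi \<tau> \<gamma> (d\<lparr>wMvars := (wMvars d)[L - 1 := z k - \<gamma>]\<rparr>) I lam =
            (\<Prod>j=1..L-1. theta \<tau> (z k - w j)) *
            (\<Prod>j=1..k-1. theta \<tau> (z j - z k + \<gamma>)) *
            (theta \<tau> \<gamma> *
               theta \<tau> (lam (M + 1) - lam i\<^sub>s + \<gamma> * (of_nat k - of_nat L + of_nat C)) /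
             theta \<tau> (lam i\<^sub>s - lam (M + 1) + \<gamma> * (1 - of_nat C))) *
            psi \<tau> \<gamma> d' J lam))
     \<and>
     (i\<^sub>s = M + 1 \<longrightarrow>
       (\<exists>d' J.
          d' = d\<lparr>wMvars := butlast (wMvars d)\<rparr> \<and>
          J = (\<lambda>i. if i < M then {j \<in> I i. j \<le> LI} \<union> {j - 1 | j. j \<in> I i \<and> j > LI} else I i) \<and>
          admissible d' J \<and>
          (\<forall>i\<in>{1..M-1}. Itilde d' J i = Itilde d I i) \<and>
          psi \<tau> \<gamma> d I lam = (\<Prod>j=1..k. theta \<tau> (z j - w L - \<gamma>)) * psi \<tau> \<gamma> d' J lam))
     \<and>
     (M \<ge> 2 \<and> k = 1 \<and> i\<^sub>s \<noteq> M + 1 \<longrightarrow>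
       (\<exists>d' J.
          d' = d\<lparr>layers := M - 1,
                 wMvars := wIvars d (M - 1) @ [z 1] @ wIIvars d (M - 1)\<rparr> \<and>
          J = (\<lambda>i. {j \<in> I i. j < LI} \<union> {j - L + 1 | j. j \<in> I i \<and> j \<ge> LI}) \<and>
          admissible d' J \<and>
          (\<forall>i\<in>{1..M-2}. Itilde d' J i = Itilde d I i) \<and>
          (\<lambda>j. j - (\<Sum>p=1..<M-1. length (wIvars d p))) ` J (M - 1) = Itilde d I (M - 1) \<and>
          psi \<tau> \<gamma> d I lam =
            theta \<tau> \<gamma> * theta \<tau> (z 1 - w L + lam (M + 1) - lam i\<^sub>s - \<gamma> * (of_nat L - 1)) /
              theta \<tau> (lam i\<^sub>s - lam (M + 1)) *
            (\<Prod>j=1..L-1. theta \<tau> (z 1 - w j)) *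
            psi \<tau> \<gamma> d' J (shifted_lam \<gamma> d I lam (M - 1))))"
proof -
  interpret vertex_model \<tau> \<gamma> by unfold_locales (fact \<open>Im \<tau> > 0\<close>)
  obtain n where n: "length (wMvars d) = Suc n" using \<open>L \<ge> 1\<close> unfolding L_def by (cases "length (wMvars d)") auto
  have adm: "admissible d I" and gen: "generic \<tau> \<gamma> (layers d) lam" and M1: "layers d \<ge> 1"
    using \<open>admissible d I\<close> \<open>generic \<tau> \<gamma> M lam\<close> \<open>M \<ge> 1\<close> by (simp_all add: M_def)
  have LI: "LI = offsetI d (layers d) + Suc n" by (simp add: LI_def offsetI_def n)
  have i: "i\<^sub>s = colour d I (offsetI d (layers d) + Suc n)" by (simp only: i\<^sub>s_def LI)
  have C: "C = count (mset (colM d I)) i\<^sub>s"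
    unfolding C_def M_def LI using colour_count_top[of d I i\<^sub>s] n by simp
  have L: "L = Suc n" by (simp add: L_def n)
  have wL: "w L = last (wMvars d)"
    unfolding w_def L_def by (rule entry_length) (use n in auto)
  have w: "(\<Prod>j=1..L - 1. f (w j)) = (\<Prod>x\<leftarrow>butlast (wMvars d). f x)" for f :: "complex \<Rightarrow> complex"
    unfolding w_def L_def by (rule prod_entry_butlast)
  have z: "(\<Prod>j=1..k. f (z j)) = (\<Prod>x\<leftarrow>zvars d (layers d). f x)"
      "(\<Prod>j=1..k - 1. f (z j)) = (\<Prod>x\<leftarrow>butlast (zvars d (layers d)). f x)" for f :: "complex \<Rightarrow> complex"
    unfolding z_def k_def by (rule prod_entry prod_entry_butlast)+
  have zs: "(\<Sum>j=1..k. z j) = sum_list (zvars d (layers d))"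
    unfolding z_def k_def by (rule sum_entry)
  show ?thesis
  proof (intro conjI impI allI, goal_cases)
    case i': 1
    define \<phi> where "\<phi> = (\<lambda>x. psi \<tau> \<gamma> (d\<lparr>wMvars := (wMvars d)[L - 1 := x]\<rparr>) I lam)"
    define S where "S = (\<Sum>j=1..k. z j) - (lam i\<^sub>s - lam (M + 1) + \<gamma> * (of_nat L - of_nat C))"
    have qp: "quasi_periodic k S \<phi>"
      using psi_quasi_periodic[OF adm M1 n i, of lam] i'
      unfolding \<phi>_def S_def zs C by (simp add: k_def M_def L)
    obtain chi where chi: "lattice_character \<tau> chi" "chi 1 = (-1) ^ k"
      "chi \<tau> = (-1) ^ k * exp (2 * pi * \<i> * S)" "\<phi> \<in> elliptic_polynomials \<tau> k chi"
      using quasi_periodic_elliptic[OF qp] .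
    have "2 * pi * \<i> * S = - 2 * pi * \<i> * (- (\<Sum>j=1..k. z j) + lam i\<^sub>s - lam (M + 1) + \<gamma> * (of_nat L - of_nat C))"
      by (simp add: S_def algebra_simps)
    moreover have "of_nat k * x - S = of_nat k * x - (\<Sum>j=1..k. z j) + lam i\<^sub>s - lam (M + 1) + \<gamma> * (of_nat L - of_nat C)" for x
      by (simp add: S_def)
    ultimately show ?case
      using chi qp unfolding quasi_periodic_def by (intro exI[of _ \<phi>] exI[of _ chi]) (simp only: \<phi>_def simp_thms)
  next
    case (2 zs)
    then show ?case using psi_symmetric[OF adm M1 gen, of zs] by (simp add: M_def)
  next
    case 3
    then have M: "M \<ge> 2" and i': "i\<^sub>s \<noteq> M + 1" by blast+
    note sp = psi_specialise[OF adm _ gen n i, folded M_def, OF M i']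
    have zk: "z k = last (zvars d M)"
      unfolding z_def k_def M_def by (rule entry_length) (use sp(1) in \<open>simp add: M_def\<close>)
    have "k \<ge> 1" using sp(1) by (cases "zvars d (layers d)") (auto simp: k_def M_def)
    \<comment> \<open>\<open>psi_specialise\<close> is stated with the reduced sizes k - 1 and L - 1
      = n, whose difference is that of k and L.\<close>
    then have kL: "of_nat (length (zvars d M) - 1) - of_nat n = (of_nat k - of_nat L :: complex)"
      by (simp add: k_def M_def L of_nat_diff)
    show ?case
      unfolding w[of "\<lambda>x. theta \<tau> (z k - x)"] z(2)[of "\<lambda>x. theta \<tau> (x - z k + \<gamma>)"]
      unfolding zk C kL[symmetric] unfolding L LI diff_Suc_1 M_def[symmetric]
      by (intro exI conjI ballI) (assumption | rule refl | rule sp)+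
  next
    case i': 4
    note rt = psi_remove_top[OF adm M1 n i[symmetric, unfolded i' M_def]]
    show ?case
      unfolding z(1)[of "\<lambda>x. theta \<tau> (x - w L - \<gamma>)"] unfolding wL M_def LI
      by (intro exI conjI ballI) (assumption | rule refl | rule rt)+
  next
    case 5
    then have M: "M \<ge> 2" and k: "k = 1" and i': "i\<^sub>s \<noteq> M + 1" by blast+
    have z1: "zvars d (layers d) = [z 1]"
      using k by (cases "zvars d (layers d)") (auto simp: k_def z_def entry_def)
    note ini = psi_initial[OF adm _ gen n z1 i, folded M_def, OF M i']
    have n': "of_nat L - 1 = (of_nat n :: complex)" by (simp add: L)
    show ?case
      unfolding w[of "\<lambda>x. theta \<tau> (z 1 - x)"] wL n' offsetI_def[symmetric] unfolding LI L M_def[symmetric]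
      by (intro exI conjI ballI) (assumption | rule refl | rule ini | fastforce)+
  qed
qed

end
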